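(* Consider the leader, the $n$ followers, the local disturbances and the communication graph $\mathcal G$ described in the context, where the bound $l>0$ on the leader's input is given, and suppose that Assumptions 1, 2, 3 and 5 of the context hold. For $i=1,\dots,n$ let $\Psi_i,F_i,G_i$ be the internal-model matrices of the context. Then the distributed generalized output regulation problem is semi-globally solved by a distributed control law of the form $$u_i=-\Psi_i\eta_i-\rho_i(e_{vi})e_{vi}-\gamma_i\,\mathrm{sgn}(e_{vi}),\qquad \dot\eta_i=F_i\eta_i+G_iu_i,\qquad i=1,\dots,n,$$ with $e_{vi}=\sum_{j=0}^n a_{ij}(y_i-y_j)$. That is, for any given $M>0$ there exist smooth positive functions $\rho_i:\mathbb{R}\to(0,\infty)$, constants $\gamma_i>0$ $(i=1,\dots,n)$ and a constant $\bar M\ge0$ such that, for every $\mu\in\mathbb{R}^{n_\mu}_M$, every continuous leader input $w$ with $\|w(t)\|_\infty\le l$ for all $t\ge 0$, and all initial conditions $v(0)\in\mathbb{R}^{n_v}_M$, $(z_i(0),y_i(0))\in\mathbb{R}^{n_{z_i}+1}_M$, $\omega_i(0)\in\mathbb{R}^{n_{\omega_i}}_M$, $\eta_i(0)\in\mathbb{R}^{n_{p_i}}_{\bar M}$ $(i=1,\dots,n)$, the trajectory of the closed-loop system (in the sense of Filippov) is well-defined for all $t>0$ and $$\lim_{t\to\infty}\big(y_i(t)-y_0(t)\big)=0,\qquad i=1,\dots,n.$$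
   Context: **Notation.** $\mathbb{R}^m_M=\{s\in\mathbb{R}^m:-M\le s_j\le M,\ j=1,\dots,m\}$. Class $\mathcal K$: continuous, strictly increasing functions on $[0,a)$ vanishing at $0$; class $\mathcal K_\infty$: moreover $a=\infty$ and unbounded. **Leader (node 0).** $\dot v=p(v)+q(v)w(t)$, $y_0=r(v,\mu)$, with state $v\in\mathbb{R}^{n_v}$, output $y_0\in\mathbb{R}$, uncertain constant parameter $\mu\in\mathbb{R}^{n_\mu}$, and unknown input $w(t)\in\mathbb{R}^{n_w}$, continuous in $t$ with $\|w(t)\|_\infty\le l$ for a constant $l>0$ (known in this setting, so the controller parameters may depend on it). **Followers** $i=1,\dots,n$: $\dot z_i=f_i(z_i,y_i,\mu)$, $\dot y_i=g_i(z_i,y_i,\mu)+u_i+d_i$, with $z_i\in\mathbb{R}^{n_{z_i}}$, $y_i,u_i,d_i\in\mathbb{R}$. The functions $f_i,g_i,p,q,r$ are smooth, with $f_i(0,0,\mu)=0$, $g_i(0,0,\mu)=0$, $p(0)=0$, $r(0,\mu)=0$. **Local disturbances.** $\dot\omega_i=S_i\omega_i$, $d_i=D_i(\mu)\omega_i$, $\omega_i\in\mathbb{R}^{n_{\omega_i}}$, where $S_i$ has no eigenvalues with negative real parts. **Graph.** $\mathcal G=(\mathcal V,\mathcal E)$ is a directed graph with $\mathcal V=\{0,1,\dots,n\}$ and weighted adjacency matrix $A=[a_{ij}]\in\mathbb{R}^{(n+1)\times(n+1)}$, $a_{ii}=0$, $a_{ij}\ge0$, and $a_{ij}>0$ if and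 only if $(j,i)\in\mathcal E$ (an arc leaving $j$ and entering $i$). **Assumption 1.** For every follower $i$ there is a directed walk in $\mathcal G$ from node 0 to node $i$, and the subgraph induced by $\{1,\dots,n\}$ is undirected ($a_{ij}=a_{ji}$ for $i,j=1,\dots,n$). **Assumption 2.** There are class $\mathcal K$ functions $\alpha_0,\gamma_0$ such that every solution of the leader satisfies $\|v(t)\|\le\alpha_0(\|v(0)\|)+\gamma_0(\sup_{s\ge0}\|w(s)\|_\infty)$ for all $t\ge0$. **Assumption 3.** For each $i=1,\dots,n$ there is a smooth function $\mathbf z_i(v,\mu)$ with $\mathbf z_i(0,\mu)=0$ and $\frac{\partial\mathbf z_i(v,\mu)}{\partial v}p(v)=f_i(\mathbf z_i(v,\mu),r(v,\mu),\mu)$. **Error coordinates.** $\bar z_i=z_i-\mathbf z_i(v,\mu)$, $e_i=y_i-r(v,\mu)$. Then $\dot{\bar z}_i=\bar f_i(\bar z_i,e_i,v,w,\mu)$ with $$\bar f_i(\bar z_i,e_i,v,w,\mu)=f_i(\bar z_i+\mathbf z_i(v,\mu),e_i+r(v,\mu),\mu)-f_i(\mathbf z_i(v,\mu),r(v,\mu),\mu)-\tfrac{\partial\mathbf z_i(v,\mu)}{\partial v}q(v)w.$$ **Assumption 5.** Given any compact $\Sigma\subset\mathbb{R}^{n_v+n_w+n_\mu}$, for each $i=1,\dots,n$ there exist a smooth function $V_{\bar z_i}$ with $\alpha_{1i}(\|\bar z_i\|)\le V_{\bar z_i}(\bar z_i)\le\alpha_{2i}(\|\bar z_i\|)$ for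 some smooth $\alpha_{1i},\alpha_{2i}\in\mathcal K_\infty$, (known) smooth positive definite functions $\gamma_{1i}:\mathbb{R}\to\mathbb{R}$, $\gamma_{2i}:\mathbb{R}^{n_w}\to\mathbb{R}$, and a (known) class $\mathcal K_\infty$ function $\alpha_i$ with $\limsup_{s\to0+}\alpha_i^{-1}(s^2)/s<\infty$, such that for all $(v,w,\mu)\in\Sigma$ and all $\bar z_i,e_i$, $$\tfrac{\partial V_{\bar z_i}}{\partial\bar z_i}(\bar z_i)\,\bar f_i(\bar z_i,e_i,v,w,\mu)\le-\alpha_i(\|\bar z_i\|)+\gamma_{1i}(e_i)+\gamma_{2i}(w).$$ **Internal-model matrices.** Let $s^{n_{p_i}}+\hat p_{i,1}s^{n_{p_i}-1}+\cdots+\hat p_{i,n_{p_i}}$ be the minimal polynomial of $S_i$. $\Phi_i\in\mathbb{R}^{n_{p_i}\times n_{p_i}}$ is its companion matrix (ones on the superdiagonal, last row $[-\hat p_{i,n_{p_i}},-\hat p_{i,n_{p_i}-1},\dots,-\hat p_{i,1}]$, zeros elsewhere), $\Psi_i=[1,0,\dots,0]\in\mathbb{R}^{1\times n_{p_i}}$, and $G_i\in\mathbb{R}^{n_{p_i}\times1}$ is a constant matrix such that $F_i=\Phi_i+G_i\Psi_i$ is Hurwitz (it exists since $(\Psi_i,\Phi_i)$ is observable). **Solutions.** Since the control is discontinuous (sgn is the sign function), solutions of the closed-loop system are understood in the sense of Filippov; "well-defined for all $t>0$" means that Filippov solutions exist and are defined for all $t>0$; the limit is asserted along any such solution. *)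

theory Defs
  imports
    "HOL-Analysis.Analysis"
    "Jordan_Normal_Form.Char_Poly"
begin

(* Throughout, $ and \<bullet> are the operations on Euclidean spaces; matrix entries are accessed by $$. *)
no_notation vec_index (infixl "$" 100)
no_notation scalar_prod (infix "\<bullet>" 70)


section \<open>Smooth functions, comparison functions\<close>

(* Derivatives are taken within S. This is used only for S = UNIV and S = {0..}, where the
   derivative within S is unique; in finite dimension it amounts to C^k. *)
primrec Ck_on :: "nat \<Rightarrow> 'a::real_normed_vector set \<Rightarrow> ('a \<Rightarrow> 'b::real_normed_vector) \<Rightarrow> bool" where
  "Ck_on 0 S f \<longleftrightarrow> continuous_on S f"
| "Ck_on (Suc k) S f \<longleftrightarrow>
     f differentiable_on S \<and> (\<forall>h. Ck_on k S (\<lambda>x. frechet_derivative f (at x within S) h))"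

definition smooth_on :: "'a::real_normed_vector set \<Rightarrow> ('a \<Rightarrow> 'b::real_normed_vector) \<Rightarrow> bool" where
  "smooth_on S f \<longleftrightarrow> (\<forall>k. Ck_on k S f)"

definition class_K :: "ereal \<Rightarrow> (real \<Rightarrow> real) \<Rightarrow> bool" where
  "class_K a \<alpha> \<longleftrightarrow>
     0 < a \<and> continuous_on {s. 0 \<le> s \<and> ereal s < a} \<alpha> \<and>
     strict_mono_on {s. 0 \<le> s \<and> ereal s < a} \<alpha> \<and> \<alpha> 0 = 0"

definition class_Kinf :: "(real \<Rightarrow> real) \<Rightarrow> bool" where
  "class_Kinf \<alpha> \<longleftrightarrow> class_K \<infinity> \<alpha> \<and> filterlim \<alpha> at_top at_top"

definition pos_def_fun :: "('a::zero \<Rightarrow> real) \<Rightarrow> bool" where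
  "pos_def_fun \<gamma> \<longleftrightarrow> \<gamma> 0 = 0 \<and> (\<forall>x. x \<noteq> 0 \<longrightarrow> 0 < \<gamma> x)"


section \<open>Spaces whose dimension depends on the follower\<close>

(* The dimensions of the follower states depend on the follower, so they cannot be types.
   For n \<le> CARD('k), the space R^n is represented by the vectors in real^'k whose coordinates at
   positions n, n+1, ... vanish, the position of a coordinate being its rank in the linear order
   of 'k. A function with argument in R^n is represented by its unique extension to real^'k that
   ignores the coordinates at positions n, n+1, ... (see depends_on). *)
definition coord_pos :: "'k::{finite,linorder} \<Rightarrow> nat" where
  "coord_pos k = card {j. j < k}"

definition coord_space :: "nat \<Rightarrow> (real^'k::{finite,linorder}) set" where
  "coord_space n = {x. \<forall>k. n \<le> coord_pos k \<longrightarrow> x $ k = 0}"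

definition coord_proj :: "nat \<Rightarrow> real^'k::{finite,linorder} \<Rightarrow> real^'k::{finite,linorder}" where
  "coord_proj n x = (\<chi> k. if coord_pos k < n then x $ k else 0)"

definition depends_on :: "nat \<Rightarrow> (real^'k::{finite,linorder} \<Rightarrow> 'b) \<Rightarrow> bool" where
  "depends_on n f \<longleftrightarrow> (\<forall>x. f (coord_proj n x) = f x)"

definition cube :: "real \<Rightarrow> (real^'k) set" where
  "cube M = {s. \<forall>j. - M \<le> s $ j \<and> s $ j \<le> M}"

(* product of an explicitly sized matrix with a vector in the above representation *)
definition mat_app :: "real mat \<Rightarrow> real^'b::{finite,linorder} \<Rightarrow> real^'a::{finite,linorder}" where
  "mat_app B x =
     (\<chi> k. if coord_pos k < dim_row B
           then (\<Sum>j | coord_pos j < dim_col B. B $$ (coord_pos k, coord_pos j) * x $ j) else 0)"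

definition row_app :: "real mat \<Rightarrow> real^'b::{finite,linorder} \<Rightarrow> real" where
  "row_app B x = (mat_app B x :: real^1) $ 1"

definition col_app :: "real mat \<Rightarrow> real \<Rightarrow> real^'a::{finite,linorder}" where
  "col_app B u = mat_app B ((\<chi> _. u) :: real^1)"


section \<open>Matrices\<close>

definition is_eigenvalue :: "real mat \<Rightarrow> complex \<Rightarrow> bool" where
  "is_eigenvalue B c \<longleftrightarrow> eigenvalue (map_mat complex_of_real B) c"

definition hurwitz :: "real mat \<Rightarrow> bool" where
  "hurwitz B \<longleftrightarrow> (\<forall>c. is_eigenvalue B c \<longrightarrow> Re c < 0)"

definition annihilates :: "real poly \<Rightarrow> real mat \<Rightarrow> bool" where
  "annihilates m B \<longleftrightarrow>
     (\<forall>a<dim_row B. \<forall>b<dim_row B. (\<Sum>k\<le>degree m. coeff m k * (B ^\<^sub>m k) $$ (a, b)) = 0)"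

definition is_minimal_poly :: "real mat \<Rightarrow> real poly \<Rightarrow> bool" where
  "is_minimal_poly B m \<longleftrightarrow>
     lead_coeff m = 1 \<and> annihilates m B \<and>
     (\<forall>m'. m' \<noteq> 0 \<longrightarrow> annihilates m' B \<longrightarrow> degree m \<le> degree m')"

(* Indices start at 0, so the last row [-p_n, -p_(n-1), ..., -p_1] of the companion matrix of
   s^n + p_1 s^(n-1) + ... + p_n has the entry - coeff m b in column b. *)
definition Phi_mat :: "real poly \<Rightarrow> real mat" where
  "Phi_mat m = Matrix.mat (degree m) (degree m)
     (\<lambda>(a, b). if a + 1 < degree m then (if b = a + 1 then 1 else 0) else - coeff m b)"

definition Psi_mat :: "real poly \<Rightarrow> real mat" where
  "Psi_mat m = Matrix.mat 1 (degree m) (\<lambda>(a, b). if b = 0 then 1 else 0)"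

definition F_mat :: "real poly \<Rightarrow> real mat \<Rightarrow> real mat" where
  "F_mat m G = Phi_mat m + G * Psi_mat m"


section \<open>Filippov solutions\<close>

definition abs_continuous_on :: "real \<Rightarrow> real \<Rightarrow> (real \<Rightarrow> 'a::metric_space) \<Rightarrow> bool" where
  "abs_continuous_on a b x \<longleftrightarrow>
     (\<forall>\<epsilon>>0. \<exists>\<delta>>0. \<forall>D. D division_of \<Union>D \<longrightarrow> \<Union>D \<subseteq> {a..b} \<longrightarrow> (\<Sum>K\<in>D. Sup K - Inf K) < \<delta> \<longrightarrow>
        (\<Sum>K\<in>D. dist (x (Inf K)) (x (Sup K))) < \<epsilon>)"

definition filippov_map ::
  "(real \<Rightarrow> 'a::euclidean_space \<Rightarrow> 'a) \<Rightarrow> real \<Rightarrow> 'a \<Rightarrow> 'a set" where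
  "filippov_map X t x =
     (\<Inter>\<delta>\<in>{0<..}. \<Inter>N\<in>{N. negligible N}. closure (convex hull (X t ` (ball x \<delta> - N))))"

definition filippov_solution ::
  "(real \<Rightarrow> 'a::euclidean_space \<Rightarrow> 'a) \<Rightarrow> real set \<Rightarrow> (real \<Rightarrow> 'a) \<Rightarrow> bool" where
  "filippov_solution X J x \<longleftrightarrow>
     (\<forall>a b. a \<le> b \<longrightarrow> {a..b} \<subseteq> J \<longrightarrow> abs_continuous_on a b x) \<and>
     (AE t in lebesgue. t \<in> J \<longrightarrow>
        (\<exists>d \<in> filippov_map X t (x t). (x has_vector_derivative d) (at t within J)))"

(* A solution from x0 exists for all t \<ge> 0, and no solution from x0 ends at a finite time. *)
definition filippov_well_defined ::
  "(real \<Rightarrow> 'a::euclidean_space \<Rightarrow> 'a) \<Rightarrow> 'a \<Rightarrow> bool" where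
  "filippov_well_defined X x0 \<longleftrightarrow>
     (\<exists>x. filippov_solution X {0..} x \<and> x 0 = x0) \<and>
     (\<forall>T>0. \<forall>x. filippov_solution X {0..<T} x \<and> x 0 = x0 \<longrightarrow>
        (\<exists>x'. filippov_solution X {0..} x' \<and> (\<forall>t\<in>{0..<T}. x' t = x t)))"


section \<open>Communication graph\<close>

(* The followers form the finite type 'i, and a node is an element of 'i option: None is the
   leader (node 0), Some i is follower i. *)
definition directed_walk :: "('n \<times> 'n) set \<Rightarrow> 'n list \<Rightarrow> 'n \<Rightarrow> 'n \<Rightarrow> bool" where
  "directed_walk E xs a b \<longleftrightarrow>
     xs \<noteq> [] \<and> hd xs = a \<and> last xs = b \<and> successively (\<lambda>c d. (c, d) \<in> E) xs"

definition weighted_digraph :: "('n \<times> 'n) set \<Rightarrow> ('n \<Rightarrow> 'n \<Rightarrow> real) \<Rightarrow> bool" where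
  "weighted_digraph E A \<longleftrightarrow>
     (\<forall>i. A i i = 0) \<and> (\<forall>i j. 0 \<le> A i j) \<and> (\<forall>i j. 0 < A i j \<longleftrightarrow> (j, i) \<in> E)"

definition graph_connectivity :: "('i option \<times> 'i option) set \<Rightarrow> ('i option \<Rightarrow> 'i option \<Rightarrow> real) \<Rightarrow> bool" where
  "graph_connectivity E A \<longleftrightarrow>
     (\<forall>i. \<exists>xs. directed_walk E xs None (Some i)) \<and>
     (\<forall>i j. A (Some i) (Some j) = A (Some j) (Some i))"


section \<open>Leader\<close>

definition leader_solution ::
  "(real^'v \<Rightarrow> real^'v) \<Rightarrow> (real^'v \<Rightarrow> real^'w^'v) \<Rightarrow> (real \<Rightarrow> real^'w) \<Rightarrow> real set \<Rightarrow>
   (real \<Rightarrow> real^'v) \<Rightarrow> bool" where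
  "leader_solution p q w J v \<longleftrightarrow>
     (\<forall>t\<in>J. (v has_vector_derivative (p (v t) + q (v t) *v w t)) (at t within J))"

definition admissible_input :: "real \<Rightarrow> (real \<Rightarrow> real^'w) \<Rightarrow> bool" where
  "admissible_input l w \<longleftrightarrow> continuous_on {0..} w \<and> (\<forall>t\<ge>0. infnorm (w t) \<le> l)"

(* Solutions on all bounded intervals [0,T) are included: the bound also says that the leader has
   no finite escape time, and restriction covers the solutions on [0,\<infinity>). *)
definition leader_stability :: "(real^'v \<Rightarrow> real^'v) \<Rightarrow> (real^'v \<Rightarrow> real^'w^'v) \<Rightarrow> real \<Rightarrow> bool" where
  "leader_stability p q l \<longleftrightarrow>
     (\<exists>\<alpha>0 \<gamma>0. class_K \<infinity> \<alpha>0 \<and> class_K \<infinity> \<gamma>0 \<and>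
        (\<forall>w v T. admissible_input l w \<longrightarrow> 0 < T \<longrightarrow> leader_solution p q w {0..<T} v \<longrightarrow>
           (\<forall>t\<in>{0..<T}. norm (v t) \<le> \<alpha>0 (norm (v 0)) + \<gamma>0 (SUP s\<in>{0..}. infnorm (w s)))))"


section \<open>A follower: regulator equation and error dynamics\<close>

(* n is the dimension of the follower's zero-dynamics state z; zs v \<mu> is the solution of the
   regulator equation. *)
definition regulator_solution ::
  "(real^'v \<Rightarrow> real^'v) \<Rightarrow> (real^'v \<Rightarrow> real^'m \<Rightarrow> real) \<Rightarrow> nat \<Rightarrow>
   (real^'z::{finite,linorder} \<Rightarrow> real \<Rightarrow> real^'m \<Rightarrow> real^'z::{finite,linorder}) \<Rightarrow>
   (real^'v \<Rightarrow> real^'m \<Rightarrow> real^'z::{finite,linorder}) \<Rightarrow> bool" where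
  "regulator_solution p r n f zs \<longleftrightarrow>
     smooth_on UNIV (\<lambda>(v, \<mu>). zs v \<mu>) \<and>
     (\<forall>v \<mu>. zs v \<mu> \<in> coord_space n) \<and>
     (\<forall>\<mu>. zs 0 \<mu> = 0) \<and>
     (\<forall>v \<mu>. frechet_derivative (\<lambda>v. zs v \<mu>) (at v) (p v) = f (zs v \<mu>) (r v \<mu>) \<mu>)"

definition fbar ::
  "(real^'v \<Rightarrow> real^'w^'v) \<Rightarrow> (real^'v \<Rightarrow> real^'m \<Rightarrow> real) \<Rightarrow>
   (real^'z::{finite,linorder} \<Rightarrow> real \<Rightarrow> real^'m \<Rightarrow> real^'z::{finite,linorder}) \<Rightarrow>
   (real^'v \<Rightarrow> real^'m \<Rightarrow> real^'z::{finite,linorder}) \<Rightarrow>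
   real^'z::{finite,linorder} \<Rightarrow> real \<Rightarrow> real^'v \<Rightarrow> real^'w \<Rightarrow> real^'m \<Rightarrow> real^'z::{finite,linorder}" where
  "fbar q r f zs zb e v w \<mu> =
     f (zb + zs v \<mu>) (e + r v \<mu>) \<mu> - f (zs v \<mu>) (r v \<mu>) \<mu>
     - frechet_derivative (\<lambda>v. zs v \<mu>) (at v) (q v *v w)"

definition error_dynamics_iss ::
  "(real^'v \<Rightarrow> real^'w^'v) \<Rightarrow> (real^'v \<Rightarrow> real^'m \<Rightarrow> real) \<Rightarrow> nat \<Rightarrow>
   (real^'z::{finite,linorder} \<Rightarrow> real \<Rightarrow> real^'m \<Rightarrow> real^'z::{finite,linorder}) \<Rightarrow>
   (real^'v \<Rightarrow> real^'m \<Rightarrow> real^'z::{finite,linorder}) \<Rightarrow> bool" where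
  "error_dynamics_iss q r n f zs \<longleftrightarrow>
     (\<forall>\<Sigma> :: ((real^'v) \<times> (real^'w) \<times> (real^'m)) set. compact \<Sigma> \<longrightarrow>
       (\<exists>(V :: real^'z::{finite,linorder} \<Rightarrow> real) \<alpha>1 \<alpha>2 (\<gamma>1 :: real \<Rightarrow> real) (\<gamma>2 :: real^'w \<Rightarrow> real) \<alpha>.
          smooth_on UNIV V \<and> depends_on n V \<and>
          smooth_on {0..} \<alpha>1 \<and> class_Kinf \<alpha>1 \<and>
          smooth_on {0..} \<alpha>2 \<and> class_Kinf \<alpha>2 \<and>
          (\<forall>zb\<in>coord_space n. \<alpha>1 (norm zb) \<le> V zb \<and> V zb \<le> \<alpha>2 (norm zb)) \<and>
          smooth_on UNIV \<gamma>1 \<and> pos_def_fun \<gamma>1 \<and>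
          smooth_on UNIV \<gamma>2 \<and> pos_def_fun \<gamma>2 \<and>
          class_Kinf \<alpha> \<and>
          Limsup (at_right 0) (\<lambda>s. ereal (inv_into {0..} \<alpha> (s\<^sup>2) / s)) < \<infinity> \<and>
          (\<forall>(v, w, \<mu>)\<in>\<Sigma>. \<forall>zb\<in>coord_space n. \<forall>e.
             frechet_derivative V (at zb) (fbar q r f zs zb e v w \<mu>)
               \<le> - \<alpha> (norm zb) + \<gamma>1 e + \<gamma>2 w)))"


section \<open>Closed-loop system\<close>

(* The state consists of v, (z_i)_i, (y_i)_i, (\<omega>_i)_i and (\<eta>_i)_i, in this order. *)
type_synonym ('v, 'z, 'o, 'i) cl_state =
  "(real^'v) \<times> (real^'z^'i) \<times> (real^'i) \<times> (real^'o^'i) \<times> (real^'o^'i)"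

fun node_output ::
  "(real^'v \<Rightarrow> real^'m \<Rightarrow> real) \<Rightarrow> real^'m \<Rightarrow> real^'v \<Rightarrow> real^'i \<Rightarrow> 'i option \<Rightarrow> real" where
  "node_output r \<mu> v y None = r v \<mu>"
| "node_output r \<mu> v y (Some i) = y $ i"

definition e_virtual ::
  "('i option \<Rightarrow> 'i option \<Rightarrow> real) \<Rightarrow> ('i::finite option \<Rightarrow> real) \<Rightarrow> 'i \<Rightarrow> real" where
  "e_virtual A Y i = (\<Sum>j\<in>UNIV. A (Some i) j * (Y (Some i) - Y j))"

definition control_law ::
  "real mat \<Rightarrow> (real \<Rightarrow> real) \<Rightarrow> real \<Rightarrow> real^'o::{finite,linorder} \<Rightarrow> real \<Rightarrow> real" where
  "control_law \<Psi> \<rho> \<gamma> \<eta> ev = - row_app \<Psi> \<eta> - \<rho> ev * ev - \<gamma> * sgn ev"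

(* S i and D i \<mu> generate the disturbance of follower i; m i and G i determine its internal
   model, whose dimension degree (m i) is at most the dimension of \<omega>_i by Cayley-Hamilton, so that
   \<eta>_i fits into the same ambient space as \<omega>_i.
   The vector field ignores the superfluous coordinates of z, \<omega>, \<eta> and is 0 in them. Hence its
   Filippov map is the one of the system without these coordinates, extended by 0. *)
definition closed_loop ::
  "(real^'v \<Rightarrow> real^'v) \<Rightarrow> (real^'v \<Rightarrow> real^'w^'v) \<Rightarrow> (real^'v \<Rightarrow> real^'m \<Rightarrow> real) \<Rightarrow>
   ('i::finite \<Rightarrow> real^'z::{finite,linorder} \<Rightarrow> real \<Rightarrow> real^'m \<Rightarrow> real^'z::{finite,linorder}) \<Rightarrow>
   ('i \<Rightarrow> real^'z::{finite,linorder} \<Rightarrow> real \<Rightarrow> real^'m \<Rightarrow> real) \<Rightarrow>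
   ('i \<Rightarrow> real mat) \<Rightarrow> ('i \<Rightarrow> real^'m \<Rightarrow> real mat) \<Rightarrow> ('i option \<Rightarrow> 'i option \<Rightarrow> real) \<Rightarrow>
   ('i \<Rightarrow> real poly) \<Rightarrow> ('i \<Rightarrow> real mat) \<Rightarrow> ('i \<Rightarrow> real \<Rightarrow> real) \<Rightarrow> ('i \<Rightarrow> real) \<Rightarrow>
   real^'m \<Rightarrow> (real \<Rightarrow> real^'w) \<Rightarrow> real \<Rightarrow>
   ('v, 'z::{finite,linorder}, 'o::{finite,linorder}, 'i::finite) cl_state \<Rightarrow> ('v, 'z, 'o, 'i) cl_state" where
  "closed_loop p q r f g S D A m G \<rho> \<gamma> \<mu> w t = (\<lambda>(v, z, y, \<omega>, \<eta>).
     let u = (\<lambda>i. control_law (Psi_mat (m i)) (\<rho> i) (\<gamma> i) (\<eta> $ i)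
                    (e_virtual A (node_output r \<mu> v y) i));
         d = (\<lambda>i. row_app (D i \<mu>) (\<omega> $ i))
     in (p v + q v *v w t,
         (\<chi> i. f i (z $ i) (y $ i) \<mu>),
         (\<chi> i. g i (z $ i) (y $ i) \<mu> + u i + d i),
         (\<chi> i. mat_app (S i) (\<omega> $ i)),
         (\<chi> i. mat_app (F_mat (m i) (G i)) (\<eta> $ i) + col_app (G i) (u i))))"

definition initial_states ::
  "('i \<Rightarrow> nat) \<Rightarrow> ('i \<Rightarrow> nat) \<Rightarrow> ('i \<Rightarrow> nat) \<Rightarrow> real \<Rightarrow> real \<Rightarrow>
   ('v::finite, 'z::{finite,linorder}, 'o::{finite,linorder}, 'i::finite) cl_state set" where
  "initial_states nz nom np M Mbar = {(v, z, y, \<omega>, \<eta>).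
     v \<in> cube M \<and> y \<in> cube M \<and>
     (\<forall>i. z $ i \<in> coord_space (nz i) \<inter> cube M \<and>
          \<omega> $ i \<in> coord_space (nom i) \<inter> cube M \<and>
          \<eta> $ i \<in> coord_space (np i) \<inter> cube Mbar)}"

definition tracking_error ::
  "(real^'v \<Rightarrow> real^'m \<Rightarrow> real) \<Rightarrow> real^'m \<Rightarrow> 'i::finite \<Rightarrow> ('v, 'z::finite, 'o::finite, 'i) cl_state \<Rightarrow> real" where
  "tracking_error r \<mu> i = (\<lambda>(v, z, y, \<omega>, \<eta>). y $ i - r v \<mu>)"

end

(* Each follower has a dissipation inequality for the error of its zero dynamics (Assumption 5, after a change of the supply
   rate) and one for the internal model error, relative to its steady state and shifted by G_i e_i. Adding the quadratic form
   of the grounded Laplacian in the tracking errors e, which is positive definite, gives a proper Lyapunov function U. If the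
   gain rho grows fast enough then dU/dt is at most a constant, independent of gamma and of the initial state, minus a proper
   function, so U ends up below a level that does not depend on gamma. Below that level all terms in the equation for e other
   than the switching term are bounded by some constant; with gamma exceeding it by 1, the Laplacian form has derivative at
   most minus the 1-norm of e_v, and the errors vanish. The discontinuous terms sgn (e_vi) enter dU/dt only through products
   -gamma e_vi sgn (e_vi), which extend continuously to the switching surfaces, so these inequalities hold along every
   Filippov solution. Existence is obtained from limits of Euler polygons; the bound on U and Assumption 2 exclude finite escape. *)
theory Submission
  imports Defs "HOL-Complex_Analysis.Great_Picard" "Jordan_Normal_Form.Spectral_Radius"
begin

text \<open>The obstacle is that the disturbances may grow without bound, so no constant switching
  gain can dominate them. The internal model removes them exactly: \<open>Psi_i eta_i\<close> at the
  steady state is \<open>d_i\<close>, and only deviations from the steady state, which U controls,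
  are left to the feedback. The shift by \<open>G_i e_i\<close> is forced by the same idea. The
  control drives both \<open>eta_i\<close> and \<open>e_i\<close>, in the ratio given by
  \<open>G_i\<close>; in the shifted variable it cancels together with its jumps, so the
  discontinuity acts on e alone. Symmetry of the follower weights makes the derivative of
  \<open>(1/2) e . L e\<close> equal to \<open>L e . e'\<close>. Hence the feedback of follower i is
  multiplied by exactly the virtual error that this follower measures. The gain of a follower sees
  one virtual error, whereas the terms to be dominated involve all tracking errors. Since L is
  invertible, the virtual error of largest modulus bounds all of e, and the gain of that single
  follower suffices.\<close>

no_notation vec_index (infixl "$" 100)
no_notation scalar_prod (infix "\<bullet>" 70)

subsection \<open>Absolutely continuous functions\<close>

lemma division_Inf_Sup:
  fixes D :: "real set set"
  assumes "D division_of S" "K \<in> D"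
  shows "Inf K \<le> Sup K" "K = {Inf K..Sup K}" "Inf K \<in> K" "Sup K \<in> K" "measure lebesgue K = Sup K - Inf K"
proof -
  obtain u v where uv: "K = cbox u v" "K \<noteq> {}"
    using division_ofD(3,4)[OF assms] by metis
  then have "u \<le> v" by auto
  then show "Inf K \<le> Sup K" "K = {Inf K..Sup K}" "Inf K \<in> K" "Sup K \<in> K" "measure lebesgue K = Sup K - Inf K"
    using uv by auto
qed

lemma abs_continuous_on_lipschitz_compose:
  assumes ac: "abs_continuous_on a b x" and lip: "L-lipschitz_on S \<phi>" and sub: "x ` {a..b} \<subseteq> S"
  shows "abs_continuous_on a b (\<lambda>t. \<phi> (x t))"
  unfolding abs_continuous_on_def
proof (intro allI impI)
  fix e :: real assume "e > 0"
  have L: "L \<ge> 0" using lip lipschitz_on_nonneg by blast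
  then obtain d where d: "d > 0" and *: "\<And>D. D division_of \<Union>D \<Longrightarrow> \<Union>D \<subseteq> {a..b} \<Longrightarrow> (\<Sum>K\<in>D. Sup K - Inf K) < d \<Longrightarrow>
        (\<Sum>K\<in>D. dist (x (Inf K)) (x (Sup K))) < e / (L + 1)"
    using ac[unfolded abs_continuous_on_def, rule_format, of "e / (L + 1)"] \<open>e > 0\<close> by auto
  show "\<exists>\<delta>>0. \<forall>D. D division_of \<Union>D \<longrightarrow> \<Union>D \<subseteq> {a..b} \<longrightarrow> (\<Sum>K\<in>D. Sup K - Inf K) < \<delta> \<longrightarrow>
        (\<Sum>K\<in>D. dist (\<phi> (x (Inf K))) (\<phi> (x (Sup K)))) < e"
  proof (intro exI conjI allI impI)
    fix D :: "real set set" assume D: "D division_of \<Union>D" "\<Union>D \<subseteq> {a..b}" "(\<Sum>K\<in>D. Sup K - Inf K) < d"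
    have "(\<Sum>K\<in>D. dist (\<phi> (x (Inf K))) (\<phi> (x (Sup K)))) \<le> (\<Sum>K\<in>D. L * dist (x (Inf K)) (x (Sup K)))"
    proof (rule sum_mono)
      fix K assume "K \<in> D"
      then have "Inf K \<in> {a..b}" "Sup K \<in> {a..b}" using division_Inf_Sup(3,4)[OF D(1), of K] D(2) by auto
      then show "dist (\<phi> (x (Inf K))) (\<phi> (x (Sup K))) \<le> L * dist (x (Inf K)) (x (Sup K))"
        using lipschitz_onD[OF lip] sub by blast
    qed
    also have "\<dots> = L * (\<Sum>K\<in>D. dist (x (Inf K)) (x (Sup K)))" by (simp add: sum_distrib_left)
    also have "\<dots> \<le> L * (e / (L + 1))" using *[OF D] L by (intro mult_left_mono) auto
    also have "\<dots> < e" using L \<open>e > 0\<close> by (simp add: field_simps)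
    finally show "(\<Sum>K\<in>D. dist (\<phi> (x (Inf K))) (\<phi> (x (Sup K)))) < e" .
  qed fact
qed

lemma abs_continuous_on_imp_continuous_on:
  assumes ac: "abs_continuous_on a b x"
  shows "continuous_on {a..b} x"
proof -
  have "\<exists>d>0. \<forall>s\<in>{a..b}. \<forall>t\<in>{a..b}. s \<le> t \<and> t - s < d \<longrightarrow> dist (x s) (x t) < e" if "e > 0" for e
  proof -
    obtain d where d: "d > 0" and *: "\<And>D. D division_of \<Union>D \<Longrightarrow> \<Union>D \<subseteq> {a..b} \<Longrightarrow> (\<Sum>K\<in>D. Sup K - Inf K) < d \<Longrightarrow>
        (\<Sum>K\<in>D. dist (x (Inf K)) (x (Sup K))) < e"
      using ac[unfolded abs_continuous_on_def, rule_format, OF \<open>e > 0\<close>] by auto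
    have "dist (x s) (x t) < e" if "s \<in> {a..b}" "t \<in> {a..b}" "s \<le> t" "t - s < d" for s t
    proof -
      have "{{s..t}} division_of \<Union>{{s..t}}" using that(3) division_of_self[of s t] by (simp add: cbox_interval)
      from *[OF this] that show ?thesis by auto
    qed
    then show ?thesis using d by blast
  qed
  then show ?thesis
    unfolding continuous_on_iff dist_real_def
    by (metis abs_minus_commute abs_of_nonneg dist_commute linear diff_ge_0_iff_ge)
qed

lemma lipschitz_on_imp_abs_continuous_on:
  assumes "L-lipschitz_on {a..b} x"
  shows "abs_continuous_on a b x"
proof -
  have "abs_continuous_on a b (\<lambda>t::real. t)"
    unfolding abs_continuous_on_def
  proof (intro allI impI exI conjI)
    fix e :: real and D :: "real set set" assume "0 < e" and D: "D division_of \<Union>D" "(\<Sum>K\<in>D. Sup K - Inf K) < e"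
    have "(\<Sum>K\<in>D. dist (Inf K) (Sup K)) = (\<Sum>K\<in>D. Sup K - Inf K)"
      using division_Inf_Sup(1)[OF D(1)] by (intro sum.cong) (auto simp: dist_real_def)
    then show "(\<Sum>K\<in>D. dist (Inf K) (Sup K)) < e" using D(2) by simp
  qed
  then show ?thesis using assms abs_continuous_on_lipschitz_compose by fastforce
qed

lemma abs_continuous_on_cong:
  assumes "\<And>t. t \<in> {a..b} \<Longrightarrow> x t = y t"
  shows "abs_continuous_on a b x \<longleftrightarrow> abs_continuous_on a b y"
proof -
  have "abs_continuous_on a b y" if ac: "abs_continuous_on a b x" and eq: "\<And>t. t \<in> {a..b} \<Longrightarrow> x t = y t" for x y
  proof -
    have "(\<Sum>K\<in>D. dist (y (Inf K)) (y (Sup K))) = (\<Sum>K\<in>D. dist (x (Inf K)) (x (Sup K)))"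
      if "D division_of \<Union>D" "\<Union>D \<subseteq> {a..b}" for D
    proof (intro sum.cong refl)
      fix K assume "K \<in> D"
      then have "Inf K \<in> {a..b}" "Sup K \<in> {a..b}"
        using division_Inf_Sup(3,4)[OF that(1), of K] that(2) by auto
      then show "dist (y (Inf K)) (y (Sup K)) = dist (x (Inf K)) (x (Sup K))" using eq by metis
    qed
    then show ?thesis using ac unfolding abs_continuous_on_def by simp
  qed
  then show ?thesis using assms by metis
qed

text \<open>A Henstock gauge that is an open superset of the exceptional set, small in measure, at its points
  and comes from the derivative elsewhere turns the pointwise bound into the bound on the increment.\<close>

lemma abs_continuous_on_increment_le:
  fixes g :: "real \<Rightarrow> real"
  assumes ab: "a \<le> b" and ac: "abs_continuous_on a b g" and N: "negligible N"
    and der: "\<And>t. t \<in> {a..b} - N \<Longrightarrow> \<exists>d. (g has_vector_derivative d) (at t within {a..b}) \<and> d \<le> c"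
  shows "g b - g a \<le> c * (b - a)"
proof -
  \<comment> \<open>Intervals tagged outside N contribute at most \<open>e * (b - a)\<close>. Those
    tagged in N contribute at most \<open>e + \<bar>c\<bar> * e\<close>: absolute continuity bounds
    the sum of their increments by e, and their total length is below e.\<close>
  have *: "g b - g a - c * (b - a) \<le> e * (b - a + 1 + \<bar>c\<bar>)" if e: "e > 0" for e
  proof -
    obtain d0 where d0: "d0 > 0" and ac': "\<And>D. D division_of \<Union>D \<Longrightarrow> \<Union>D \<subseteq> {a..b} \<Longrightarrow> (\<Sum>K\<in>D. Sup K - Inf K) < d0 \<Longrightarrow>
        (\<Sum>K\<in>D. dist (g (Inf K)) (g (Sup K))) < e"
      using ac[unfolded abs_continuous_on_def, rule_format, OF \<open>e > 0\<close>] by auto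
    define d1 where "d1 = min d0 e"
    have d1: "d1 > 0" using d0 e by (simp add: d1_def)
    obtain T where T: "open T" "N \<subseteq> T" "emeasure lebesgue (T - N) < ennreal d1"
      using sets_lebesgue_outer_open[of N d1] N d1 by (metis negligible_imp_sets)
    have TN: "emeasure lebesgue T < ennreal d1"
    proof -
      have "emeasure lebesgue T \<le> emeasure lebesgue (T - N) + emeasure lebesgue N"
      proof -
        have "emeasure lebesgue T \<le> emeasure lebesgue ((T - N) \<union> N)"
          using T N by (intro emeasure_mono) (auto simp: negligible_imp_sets)
        also have "\<dots> \<le> emeasure lebesgue (T - N) + emeasure lebesgue N"
          using T N by (intro emeasure_subadditive) (auto simp: negligible_imp_sets)
        finally show ?thesis .
      qed
      also have "emeasure lebesgue N = 0" using N negligible_iff_emeasure0[OF negligible_imp_sets[OF N]] by simp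
      finally show ?thesis using T by simp
    qed
    have "\<exists>\<delta>>0. \<forall>y\<in>{a..b}. \<bar>y - t\<bar> < \<delta> \<longrightarrow> (\<exists>d\<le>c. \<bar>g y - g t - (y - t) * d\<bar> \<le> e * \<bar>y - t\<bar>)"
      and "\<exists>\<delta>>0. \<exists>d\<le>c. \<forall>y\<in>{a..b}. \<bar>y - t\<bar> < \<delta> \<longrightarrow> \<bar>g y - g t - (y - t) * d\<bar> \<le> e * \<bar>y - t\<bar>" if t: "t \<in> {a..b} - N" for t
    proof -
      obtain d where d: "(g has_vector_derivative d) (at t within {a..b})" "d \<le> c" using der[OF t] by blast
      then have "\<exists>\<delta>>0. \<forall>y\<in>{a..b}. \<bar>y - t\<bar> < \<delta> \<longrightarrow> \<bar>g y - g t - (y - t) * d\<bar> \<le> e * \<bar>y - t\<bar>"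
        using e unfolding has_vector_derivative_def has_derivative_within_alt by (auto simp: mult.commute)
      then show "\<exists>\<delta>>0. \<forall>y\<in>{a..b}. \<bar>y - t\<bar> < \<delta> \<longrightarrow> (\<exists>d\<le>c. \<bar>g y - g t - (y - t) * d\<bar> \<le> e * \<bar>y - t\<bar>)"
       "\<exists>\<delta>>0. \<exists>d\<le>c. \<forall>y\<in>{a..b}. \<bar>y - t\<bar> < \<delta> \<longrightarrow> \<bar>g y - g t - (y - t) * d\<bar> \<le> e * \<bar>y - t\<bar>" using d(2) by blast+
    qed
    then obtain \<delta> where \<delta>: "\<And>t. t \<in> {a..b} - N \<Longrightarrow> \<delta> t > 0 \<and> (\<exists>d\<le>c. \<forall>y\<in>{a..b}. \<bar>y - t\<bar> < \<delta> t \<longrightarrow> \<bar>g y - g t - (y - t) * d\<bar> \<le> e * \<bar>y - t\<bar>)"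
      by metis
    define G where "G t = (if t \<in> N then T else if t \<in> {a..b} then ball t (\<delta> t) else ball t 1)" for t
    have "gauge G" unfolding gauge_def G_def using T \<delta> by auto
    then obtain p where p: "p tagged_division_of {a..b}" "G fine p"
      using fine_division_exists_real by metis
    define p1 where "p1 = {xK \<in> p. fst xK \<in> N}"
    have fin: "finite p" using p by blast
    have sub: "p1 \<subseteq> p" by (auto simp: p1_def)
    have tp: "p1 tagged_division_of \<Union>(snd ` p1)"
    proof -
      have "p tagged_partial_division_of {a..b}" using p(1) by (simp add: tagged_division_of_def)
      then show ?thesis by (rule tagged_partial_division_of_Union_self[OF tagged_partial_division_subset[OF _ sub]])
    qed
    have K: "\<exists>u v. K = {u..v} \<and> u \<le> x \<and> x \<le> v \<and> a \<le> u \<and> v \<le> b" if xK: "(x, K) \<in> p" for x K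
    proof -
      obtain u v where "K = {u..v}" using tagged_division_ofD(4)[OF p(1) xK] by auto
      moreover have "x \<in> K" "K \<subseteq> {a..b}" using tagged_division_ofD(2,3)[OF p(1) xK] .
      ultimately show ?thesis by auto
    qed
    have good: "g (Sup K) - g (Inf K) - c * (Sup K - Inf K) \<le> e * (Sup K - Inf K)" if xK: "(x, K) \<in> p - p1" for x K
    proof -
      obtain u v where uv: "K = {u..v}" "u \<le> x" "x \<le> v" "a \<le> u" "v \<le> b" using K xK by blast
      have x: "x \<in> {a..b} - N" using xK uv by (auto simp: p1_def)
      obtain d where d: "d \<le> c" "\<And>y. y \<in> {a..b} \<Longrightarrow> \<bar>y - x\<bar> < \<delta> x \<Longrightarrow> \<bar>g y - g x - (y - x) * d\<bar> \<le> e * \<bar>y - x\<bar>"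
        using \<delta>[OF x] by blast
      have "K \<subseteq> ball x (\<delta> x)" using fineD[OF p(2), of x K] xK x unfolding G_def by auto
      moreover have "u \<in> K" "v \<in> K" using uv by auto
      ultimately have "u \<in> ball x (\<delta> x)" "v \<in> ball x (\<delta> x)" by blast+
      then have "\<bar>u - x\<bar> < \<delta> x" "\<bar>v - x\<bar> < \<delta> x" by (auto simp: dist_real_def)
      then have "\<bar>g u - g x - (u - x) * d\<bar> \<le> e * \<bar>u - x\<bar>" "\<bar>g v - g x - (v - x) * d\<bar> \<le> e * \<bar>v - x\<bar>"
        using d(2)[of u] d(2)[of v] uv by auto
      then have "g v - g u - (v - u) * d \<le> e * (v - u)"
        using uv by (simp add: algebra_simps abs_if split: if_splits)
      moreover have "(v - u) * d \<le> (v - u) * c" using uv d by (intro mult_left_mono) auto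
      moreover have "Sup K = v" "Inf K = u" using uv by auto
      ultimately show ?thesis by (simp add: algebra_simps)
    qed
    have szero: "sum (\<lambda>(x, K). h K) p1 = sum h (snd ` p1)" if "\<And>u. h {u..u} = (0::real)" for h
    proof -
      \<comment> \<open>Two tags can share an interval only if it is degenerate, where h vanishes.
        The empty interval, on which \<open>Inf\<close> and \<open>Sup\<close> are arbitrary, is
        patched to 0 so that the library lemma applies.\<close>
      let ?h = "\<lambda>K. if K = {} then 0 else h K"
      have "sum (\<lambda>(x, K). h K) p1 = sum (\<lambda>(x, K). ?h K) p1"
        using K sub by (intro sum.cong) fastforce+
      also have "\<dots> = sum ?h (snd ` p1)"
      proof (rule sum.over_tagged_division_lemma[OF tp])
        fix u v :: real assume "box u v = {}"
        then consider "cbox u v = {}" | "u = v" by fastforce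
        then show "?h (cbox u v) = 0" using that by cases auto
      qed
      also have "\<dots> = sum h (snd ` p1)"
        using K sub by (intro sum.cong) fastforce+
      finally show ?thesis .
    qed
    have div1: "(snd ` p1) division_of \<Union>(snd ` p1)" using division_of_tagged_division[OF tp] .
    have sub1: "\<Union>(snd ` p1) \<subseteq> {a..b}" using K sub by fastforce
    have subT: "\<Union>(snd ` p1) \<subseteq> T" using fineD[OF p(2)] unfolding p1_def G_def by fastforce
    have len: "(\<Sum>K\<in>snd ` p1. Sup K - Inf K) < d1"
    proof -
      have "(\<Sum>K\<in>snd ` p1. Sup K - Inf K) = (\<Sum>K\<in>snd ` p1. measure lebesgue K)"
        using division_Inf_Sup(5)[OF div1] by (intro sum.cong) auto
      also have "\<dots> = measure lebesgue (\<Union>(snd ` p1))" using content_division[OF div1] .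
      also have "\<dots> < d1"
      proof -
        have m: "\<Union>(snd ` p1) \<in> lmeasurable"
        proof (intro lmeasurable_compact compact_Union)
          show "finite (snd ` p1)" using finite_subset[OF sub fin] by simp
          show "compact S" if "S \<in> snd ` p1" for S using that sub K by fastforce
        qed
        have "emeasure lebesgue (\<Union>(snd ` p1)) \<le> emeasure lebesgue T"
          using subT T by (intro emeasure_mono) auto
        also have "\<dots> < ennreal d1" by (rule TN)
        finally show ?thesis using m d1 by (simp add: emeasure_eq_measure2 ennreal_less_iff)
      qed
      finally show ?thesis .
    qed
    have bad: "(\<Sum>(x,K)\<in>p1. g (Sup K) - g (Inf K) - c * (Sup K - Inf K)) \<le> e + \<bar>c\<bar> * e"
    proof -
      have "(\<Sum>(x,K)\<in>p1. g (Sup K) - g (Inf K) - c * (Sup K - Inf K))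
        = (\<Sum>K\<in>snd ` p1. g (Sup K) - g (Inf K) - c * (Sup K - Inf K))"
        by (rule szero) simp
      also have "\<dots> \<le> (\<Sum>K\<in>snd ` p1. dist (g (Inf K)) (g (Sup K)) + \<bar>c\<bar> * (Sup K - Inf K))"
      proof (rule sum_mono)
        fix K assume "K \<in> snd ` p1"
        then have "Inf K \<le> Sup K" using division_Inf_Sup(1)[OF div1] by blast
        then have "- c * (Sup K - Inf K) \<le> \<bar>c\<bar> * (Sup K - Inf K)" by (intro mult_right_mono) auto
        then show "g (Sup K) - g (Inf K) - c * (Sup K - Inf K) \<le> dist (g (Inf K)) (g (Sup K)) + \<bar>c\<bar> * (Sup K - Inf K)"
          by (auto simp: dist_real_def)
      qed
      also have "\<dots> = (\<Sum>K\<in>snd ` p1. dist (g (Inf K)) (g (Sup K))) + \<bar>c\<bar> * (\<Sum>K\<in>snd ` p1. Sup K - Inf K)"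
        by (simp add: sum.distrib sum_distrib_left)
      also have "\<dots> \<le> e + \<bar>c\<bar> * e"
        using ac'[OF div1 sub1] len by (intro add_mono mult_left_mono) (auto simp: d1_def)
      finally show ?thesis .
    qed
    have tel: "(\<Sum>(x,K)\<in>p. f (Sup K) - f (Inf K)) = f b - f a" for f :: "real \<Rightarrow> real"
      using additive_tagged_division_1[OF ab p(1)] .
    have "g b - g a - c * (b - a) = (\<Sum>(x,K)\<in>p. g (Sup K) - g (Inf K) - c * (Sup K - Inf K))"
      using tel[of "\<lambda>x. g x - c * x"] by (simp add: algebra_simps)
    also have "\<dots> = (\<Sum>(x,K)\<in>p - p1. g (Sup K) - g (Inf K) - c * (Sup K - Inf K))
       + (\<Sum>(x,K)\<in>p1. g (Sup K) - g (Inf K) - c * (Sup K - Inf K))"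
      using sum.subset_diff[OF sub fin] .
    also have "\<dots> \<le> (\<Sum>(x,K)\<in>p - p1. e * (Sup K - Inf K)) + (e + \<bar>c\<bar> * e)"
      using good bad by (intro add_mono sum_mono) auto
    also have "(\<Sum>(x,K)\<in>p - p1. e * (Sup K - Inf K)) \<le> (\<Sum>(x,K)\<in>p. e * (Sup K - Inf K))"
      using fin e K by (intro sum_mono2) fastforce+
    also have "\<dots> = e * (b - a)" using tel[of "\<lambda>x. e * x"] by (simp add: algebra_simps)
    finally show ?thesis by (simp add: algebra_simps)
  qed
  have "g b - g a - c * (b - a) \<le> 0"
  proof (rule ccontr)
    assume "\<not> ?thesis"
    then have pos: "g b - g a - c * (b - a) > 0" by simp
    define k where "k = b - a + 1 + \<bar>c\<bar>"
    have k: "k > 0" using ab by (simp add: k_def)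
    from *[of "(g b - g a - c * (b - a)) / (2 * k)"] pos k show False
      by (simp add: k_def[symmetric])
  qed
  then show ?thesis by simp
qed

subsection \<open>Continuously differentiable functions\<close>

text \<open>The derivative is an explicit argument so that it can be computed rule by rule. In
  finite dimension continuity in x for each fixed direction is enough
  (\<open>C1_joint\<close>).\<close>

definition C1 :: "('a::euclidean_space \<Rightarrow> 'b::euclidean_space) \<Rightarrow> ('a \<Rightarrow> 'a \<Rightarrow> 'b) \<Rightarrow> bool" where
  "C1 f f' \<longleftrightarrow> (\<forall>x. (f has_derivative f' x) (at x)) \<and> (\<forall>h. continuous_on UNIV (\<lambda>x. f' x h))"

lemma C1_D:
  assumes "C1 f f'"
  shows "(f has_derivative f' x) (at x)" "continuous_on UNIV (\<lambda>x. f' x h)" "linear (f' x)" "continuous_on UNIV f"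
  using assms has_derivative_linear unfolding C1_def
  by (auto simp: continuous_on_eq_continuous_within intro: has_derivative_continuous)

lemma linear_Basis_expansion:
  fixes f :: "'a::euclidean_space \<Rightarrow> 'b::real_vector"
  assumes "linear f"
  shows "f h = (\<Sum>b\<in>Basis. (h \<bullet> b) *\<^sub>R f b)"
proof -
  have "f h = f (\<Sum>b\<in>Basis. (h \<bullet> b) *\<^sub>R b)" by (simp add: euclidean_representation)
  then show ?thesis using assms by (simp add: linear_sum linear_scale)
qed

text \<open>A linear map is a finite combination of its values on the basis, with the coordinates of
  \<open>h x\<close> as coefficients.\<close>

lemma C1_joint:
  assumes "C1 f f'" and g: "continuous_on S g" and h: "continuous_on S h"
  shows "continuous_on S (\<lambda>x. f' (g x) (h x))"
proof -
  have "continuous_on S (\<lambda>x. f' (g x) b)" for b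
    using continuous_on_compose2[OF C1_D(2)[OF assms(1)] g] by auto
  then have "continuous_on S (\<lambda>x. \<Sum>b\<in>Basis. (h x \<bullet> b) *\<^sub>R f' (g x) b)"
    by (intro continuous_intros h)
  then show ?thesis
    by (subst linear_Basis_expansion[OF C1_D(3)[OF assms(1)]])
qed

lemma C1_compose:
  assumes f: "C1 f f'" and g: "C1 g g'"
  shows "C1 (\<lambda>x. g (f x)) (\<lambda>x h. g' (f x) (f' x h))"
  unfolding C1_def
proof (intro conjI allI)
  show "((\<lambda>x. g (f x)) has_derivative (\<lambda>h. g' (f x) (f' x h))) (at x)" for x
    using has_derivative_compose[OF C1_D(1)[OF f] C1_D(1)[OF g]] .
  show "continuous_on UNIV (\<lambda>x. g' (f x) (f' x h))" for h
    by (intro C1_joint[OF g] C1_D[OF f])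
qed

lemma C1_linear: "linear f \<Longrightarrow> C1 f (\<lambda>_. f)"
  by (simp add: C1_def linear_imp_has_derivative)

lemma C1_const: "C1 (\<lambda>_. c) (\<lambda>_ _. 0)"
  by (simp add: C1_def)

lemma C1_add: "C1 f f' \<Longrightarrow> C1 g g' \<Longrightarrow> C1 (\<lambda>x. f x + g x) (\<lambda>x h. f' x h + g' x h)"
  by (simp add: C1_def has_derivative_add continuous_on_add)

lemma C1_diff: "C1 f f' \<Longrightarrow> C1 g g' \<Longrightarrow> C1 (\<lambda>x. f x - g x) (\<lambda>x h. f' x h - g' x h)"
  by (simp add: C1_def has_derivative_diff continuous_on_diff)

lemma C1_sum:
  assumes "\<And>i. i \<in> I \<Longrightarrow> C1 (f i) (f' i)"
  shows "C1 (\<lambda>x. \<Sum>i\<in>I. f i x) (\<lambda>x h. \<Sum>i\<in>I. f' i x h)"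
  using assms unfolding C1_def by (auto intro!: has_derivative_sum continuous_on_sum)

lemma C1_mult:
  fixes f g :: "'a::euclidean_space \<Rightarrow> real"
  assumes "C1 f f'" "C1 g g'"
  shows "C1 (\<lambda>x. f x * g x) (\<lambda>x h. f x * g' x h + f' x h * g x)"
  unfolding C1_def
  by (intro conjI allI has_derivative_mult C1_D[OF assms(1)] C1_D[OF assms(2)] continuous_intros)

lemma C1_inner:
  fixes f g :: "'a::euclidean_space \<Rightarrow> 'b::euclidean_space"
  assumes "C1 f f'" "C1 g g'"
  shows "C1 (\<lambda>x. f x \<bullet> g x) (\<lambda>x h. f x \<bullet> g' x h + f' x h \<bullet> g x)"
  unfolding C1_def
  by (intro conjI allI has_derivative_inner C1_D[OF assms(1)] C1_D[OF assms(2)] continuous_intros)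

lemma smooth_on_C1:
  fixes f :: "'a::euclidean_space \<Rightarrow> 'b::euclidean_space"
  assumes "smooth_on UNIV f"
  shows "C1 f (\<lambda>x. frechet_derivative f (at x))"
proof -
  have "Ck_on (Suc 0) UNIV f" using assms by (simp only: smooth_on_def)
  then show ?thesis
    by (auto simp: C1_def differentiable_on_def frechet_derivative_works[symmetric])
qed

lemma C1_lipschitz_on_cball:
  fixes f :: "'a::euclidean_space \<Rightarrow> 'b::euclidean_space"
  assumes f: "C1 f f'"
  shows "\<exists>L. L-lipschitz_on (cball c R) f"
proof -
  have "\<exists>B. \<forall>x\<in>cball c R. norm (f' x b) \<le> B" for b
  proof -
    have "compact ((\<lambda>x. f' x b) ` cball c R)"
      by (intro compact_continuous_image continuous_on_subset[OF C1_D(2)[OF f]]) auto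
    then have "bounded ((\<lambda>x. f' x b) ` cball c R)" by (rule compact_imp_bounded)
    then show ?thesis by (auto simp: bounded_iff)
  qed
  then obtain B where B: "\<And>x b. x \<in> cball c R \<Longrightarrow> norm (f' x b) \<le> B b" by metis
  have on: "onorm (f' x) \<le> \<bar>\<Sum>b\<in>Basis. B b\<bar>" if "x \<in> cball c R" for x
  proof (rule onorm_le)
    fix h
    have "norm (f' x h) = norm (\<Sum>b\<in>Basis. (h \<bullet> b) *\<^sub>R f' x b)"
      using linear_Basis_expansion[OF C1_D(3)[OF f]] by metis
    also have "\<dots> \<le> (\<Sum>b\<in>Basis. \<bar>h \<bullet> b\<bar> * norm (f' x b))" using norm_sum by (metis (no_types, lifting) norm_scaleR sum.cong)
    also have "\<dots> \<le> (\<Sum>b\<in>Basis. norm h * B b)"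
      using B[OF that] by (intro sum_mono mult_mono) (auto simp: Basis_le_norm)
    also have "\<dots> = (\<Sum>b\<in>Basis. B b) * norm h" by (simp add: sum_distrib_left mult.commute)
    also have "\<dots> \<le> \<bar>\<Sum>b\<in>Basis. B b\<bar> * norm h" by (intro mult_right_mono) auto
    finally show "norm (f' x h) \<le> \<bar>\<Sum>b\<in>Basis. B b\<bar> * norm h" .
  qed
  have "\<bar>\<Sum>b\<in>Basis. B b\<bar>-lipschitz_on (cball c R) f"
    using on by (intro bounded_derivative_imp_lipschitz[where f' = f'])
      (auto intro: has_derivative_at_withinI[OF C1_D(1)[OF f]])
  then show ?thesis by blast
qed

subsection \<open>Filippov solutions\<close>

text \<open>A closed half-space that contains all field values near x contains their closed convex
  hull. Of the admissible exceptional null sets the empty one is used.\<close>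

lemma filippov_map_linear_le:
  fixes f :: "'a::euclidean_space \<Rightarrow> real"
  assumes d: "d \<in> filippov_map X t x" and lin: "linear f"
    and le: "\<And>e. e > 0 \<Longrightarrow> \<exists>\<delta>>0. \<forall>x'\<in>ball x \<delta>. f (X t x') \<le> c + e"
  shows "f d \<le> c"
proof (rule field_le_epsilon)
  fix e :: real assume "e > 0"
  then obtain \<delta> where \<delta>: "\<delta> > 0" "\<forall>x'\<in>ball x \<delta>. f (X t x') \<le> c + e" using le by blast
  let ?H = "{y. f y \<le> c + e}"
  have "closed ?H"
    using lin by (intro closed_Collect_le linear_continuous_on continuous_intros) (auto simp: linear_linear)
  moreover have "convex ?H"
    unfolding convex_def using lin
    by (auto simp: linear_add linear_scale intro: convex_bound_le)
  moreover have "X t ` (ball x \<delta> - {}) \<subseteq> ?H" using \<delta> by auto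
  ultimately have "closure (convex hull (X t ` (ball x \<delta> - {}))) \<subseteq> ?H"
    by (metis closure_minimal hull_minimal)
  moreover have "d \<in> closure (convex hull (X t ` (ball x \<delta> - {})))"
    using d \<delta>(1) unfolding filippov_map_def by blast
  ultimately show "f d \<le> c + e" by auto
qed

lemma filippov_solution_AC:
  "filippov_solution X J x \<Longrightarrow> {a..b} \<subseteq> J \<Longrightarrow> a \<le> b \<Longrightarrow> abs_continuous_on a b x"
  unfolding filippov_solution_def by blast

lemma filippov_solution_C1_AC:
  fixes x :: "real \<Rightarrow> 'a::euclidean_space" and \<phi> :: "'a \<Rightarrow> 'b::euclidean_space"
  assumes sol: "filippov_solution X J x" and ab: "a \<le> b" "{a..b} \<subseteq> J" and \<phi>: "C1 \<phi> \<phi>'"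
  shows "abs_continuous_on a b (\<lambda>t. \<phi> (x t))"
proof -
  have ac: "abs_continuous_on a b x" using filippov_solution_AC[OF sol ab(2,1)] .
  have "compact (x ` {a..b})"
    using abs_continuous_on_imp_continuous_on[OF ac] by (intro compact_continuous_image) auto
  then obtain R where "x ` {a..b} \<subseteq> cball 0 R"
    using compact_imp_bounded bounded_iff by (metis mem_cball_0 subsetI)
  moreover obtain L where "L-lipschitz_on (cball 0 R) \<phi>" using C1_lipschitz_on_cball[OF \<phi>] by blast
  ultimately show ?thesis by (intro abs_continuous_on_lipschitz_compose[OF ac])
qed

text \<open>The bridge from the field to trajectories: almost everywhere the velocity lies in the
  Filippov set, so a bound on \<open>\<phi>'\<close> over nearby field values bounds the derivative
  of \<open>\<phi> (x t)\<close>, and absolute continuity integrates it.\<close>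

lemma filippov_solution_increment_le:
  fixes x :: "real \<Rightarrow> 'a::euclidean_space" and \<phi> :: "'a \<Rightarrow> real"
  assumes sol: "filippov_solution X J x" and ab: "a \<le> b" "{a..b} \<subseteq> J" and \<phi>: "C1 \<phi> \<phi>'"
    and le: "\<And>t e. t \<in> {a..b} \<Longrightarrow> e > 0 \<Longrightarrow> \<exists>\<delta>>0. \<forall>x'\<in>ball (x t) \<delta>. \<phi>' (x t) (X t x') \<le> c + e"
  shows "\<phi> (x b) - \<phi> (x a) \<le> c * (b - a)"
proof -
  obtain N where N: "negligible N" and *: "\<And>t. t \<in> J - N \<Longrightarrow>
       \<exists>d \<in> filippov_map X t (x t). (x has_vector_derivative d) (at t within J)"
  proof -
    have "AE t in lebesgue. t \<in> J \<longrightarrow> (\<exists>d \<in> filippov_map X t (x t). (x has_vector_derivative d) (at t within J))"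
      using sol unfolding filippov_solution_def by blast
    then obtain N where "N \<in> null_sets lebesgue" "\<And>t. t \<notin> N \<Longrightarrow> t \<in> J \<Longrightarrow> (\<exists>d \<in> filippov_map X t (x t). (x has_vector_derivative d) (at t within J))"
      by (auto elim!: AE_E3)
    then show ?thesis using that by (auto simp: negligible_iff_null_sets)
  qed
  show ?thesis
  proof (rule abs_continuous_on_increment_le[OF ab(1) filippov_solution_C1_AC[OF sol ab \<phi>] N])
    fix t assume t: "t \<in> {a..b} - N"
    then obtain d where d: "d \<in> filippov_map X t (x t)" "(x has_vector_derivative d) (at t within J)"
      using * ab by blast
    have "(x has_vector_derivative d) (at t within {a..b})"
      using has_vector_derivative_within_subset[OF d(2) ab(2)] .
    then have "((\<lambda>t. \<phi> (x t)) has_vector_derivative \<phi>' (x t) d) (at t within {a..b})"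
      using vector_derivative_diff_chain_within[of x d t "{a..b}" \<phi> "\<phi>' (x t)"]
        has_derivative_at_withinI[OF C1_D(1)[OF \<phi>, of "x t"]] by (simp add: comp_def)
    moreover have "\<phi>' (x t) d \<le> c"
      using filippov_map_linear_le[OF d(1) C1_D(3)[OF \<phi>, of "x t"]] le t by blast
    ultimately show "\<exists>d. ((\<lambda>t. \<phi> (x t)) has_vector_derivative d) (at t within {a..b}) \<and> d \<le> c" by blast
  qed
qed

lemma filippov_solution_continuous_on:
  fixes x :: "real \<Rightarrow> 'a::euclidean_space"
  assumes "filippov_solution X J x" "{a..b} \<subseteq> J"
  shows "continuous_on {a..b} x"
  using abs_continuous_on_imp_continuous_on filippov_solution_AC[OF assms] by (cases "a \<le> b") auto

text \<open>After the last time in Z the function stays above c, so from there it cannot increase;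
  continuity at that time yields the contradiction. The descent hypothesis is in integrated form
  because h need not be differentiable.\<close>

lemma barrier:
  fixes h :: "real \<Rightarrow> real"
  assumes ab: "a \<le> b" and cont: "continuous_on {a..b} h"
    and dec: "\<And>s t. a \<le> s \<Longrightarrow> s \<le> t \<Longrightarrow> t \<le> b \<Longrightarrow> \<forall>\<tau>\<in>{s..t}. h \<tau> > c \<Longrightarrow> h t \<le> h s"
  shows "h b \<le> max (h a) c"
proof (rule ccontr)
  assume "\<not> ?thesis"
  then have hb: "h b > c" "h b > h a" by auto
  define Z where "Z = {t\<in>{a..b}. h t \<le> c}"
  show False
  proof (cases "Z = {}")
    case True
    then have "\<forall>\<tau>\<in>{a..b}. h \<tau> > c" unfolding Z_def by force
    then show False using dec[of a b] ab hb by auto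
  next
    case False
    have "closed Z" unfolding Z_def using cont by (intro continuous_on_closed_Collect_le continuous_intros) auto
    moreover have bdd: "bdd_above Z" unfolding Z_def by (auto intro: bdd_aboveI[of _ b])
    ultimately have s: "Sup Z \<in> Z" using False closed_contains_Sup by blast
    define s where "s = Sup Z"
    have s': "a \<le> s" "s \<le> b" "h s \<le> c" using s unfolding s_def Z_def by auto
    with hb have sb: "s < b" by (cases "s = b") auto
    have gt: "h \<tau> > c" if "\<tau> \<in> {s<..b}" for \<tau>
    proof (rule ccontr)
      assume "\<not> ?thesis"
      then have "\<tau> \<in> Z" using that s' unfolding Z_def by auto
      then have "\<tau> \<le> s" unfolding s_def using bdd by (rule cSup_upper)
      then show False using that by auto
    qed
    have ge: "h b \<le> h t" if "t \<in> {s<..<b}" for t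
      using that s' gt by (intro dec) auto
    have "(h \<longlongrightarrow> h s) (at s within {a..b})" using cont s' by (auto simp: continuous_on_def)
    then have "(h \<longlongrightarrow> h s) (at s within {s<..<b})" by (rule tendsto_within_subset) (use s' in auto)
    moreover have "eventually (\<lambda>t. h b \<le> h t) (at s within {s<..<b})"
      using ge by (auto simp: eventually_at_filter)
    moreover have "at s within {s<..<b} \<noteq> bot" using sb by (simp add: at_within_eq_bot_iff)
    ultimately have "h b \<le> h s" by (metis tendsto_lowerbound)
    then show False using s' hb by auto
  qed
qed

text \<open>Descent at rate k from \<open>h t0\<close> takes time \<open>(h t0 - c) / k\<close> to
  reach c, so h meets the level, and \<open>barrier\<close> keeps it there.\<close>

lemma barrier_eventually:
  fixes h :: "real \<Rightarrow> real"
  assumes k: "k > 0" and cont: "\<And>a b. t0 \<le> a \<Longrightarrow> continuous_on {a..b} h"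
    and dec: "\<And>s t. t0 \<le> s \<Longrightarrow> s \<le> t \<Longrightarrow> \<forall>\<tau>\<in>{s..t}. h \<tau> > c \<Longrightarrow> h t \<le> h s - k * (t - s)"
  shows "\<exists>T\<ge>t0. \<forall>t\<ge>T. h t \<le> c"
proof -
  have "\<exists>t1\<ge>t0. h t1 \<le> c"
  proof (rule ccontr)
    assume "\<not> ?thesis"
    then have gt: "\<And>t. t \<ge> t0 \<Longrightarrow> h t > c" by force
    define t where "t = t0 + (h t0 - c) / k"
    have "t \<ge> t0" using gt[of t0] k by (simp add: t_def)
    then have "h t \<le> h t0 - k * (t - t0)" using gt by (intro dec) auto
    also have "\<dots> = c" using k by (simp add: t_def)
    finally show False using gt[OF \<open>t \<ge> t0\<close>] by simp
  qed
  then obtain t1 where t1: "t1 \<ge> t0" "h t1 \<le> c" by blast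
  have "h t \<le> c" if "t \<ge> t1" for t
  proof -
    have "h t \<le> max (h t1) c"
    proof (rule barrier[OF that cont])
      fix s t assume "t1 \<le> s" "s \<le> t" "\<forall>\<tau>\<in>{s..t}. h \<tau> > c"
      then have "h t \<le> h s - k * (t - s)" using t1 by (intro dec) auto
      also have "\<dots> \<le> h s" using k \<open>s \<le> t\<close> by simp
      finally show "h t \<le> h s" .
    qed (use t1 in auto)
    then show ?thesis using t1 by simp
  qed
  then show ?thesis using t1 by auto
qed

text \<open>Components in which the field is continuous solve their equation classically, at every
  time. This is needed for the leader, whose stability assumption speaks of classical solutions.
  Testing with all functionals of norm at most 1 over short intervals gives the difference
  quotient.\<close>

lemma filippov_solution_projection:
  fixes x :: "real \<Rightarrow> 'a::euclidean_space" and P :: "'a \<Rightarrow> 'b::euclidean_space"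
  assumes sol: "filippov_solution X J x" and J: "is_interval J" and P: "linear P"
    and G: "continuous_on J G"
    and near: "\<And>t. t \<in> J \<Longrightarrow> ((\<lambda>x'. P (X t x')) \<longlongrightarrow> G t) (nhds (x t))"
    and t: "t \<in> J"
  shows "((\<lambda>t. P (x t)) has_vector_derivative G t) (at t within J)"
proof -
  have key: "a \<bullet> (P (x s2) - P (x s1) - (s2 - s1) *\<^sub>R D) \<le> e * (s2 - s1)"
    if s: "s1 \<le> s2" "{s1..s2} \<subseteq> J" "\<And>\<tau>. \<tau> \<in> {s1..s2} \<Longrightarrow> norm (G \<tau> - D) \<le> e" and a: "norm a \<le> 1" for a s1 s2 e D
  proof -
    have lin: "linear (\<lambda>y. a \<bullet> P y)" using P by (auto simp: linear_iff inner_right_distrib)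
    have "a \<bullet> P (x s2) - a \<bullet> P (x s1) \<le> (a \<bullet> D + e) * (s2 - s1)"
    proof (rule filippov_solution_increment_le[OF sol s(1,2) C1_linear[OF lin]])
      fix \<tau> e' :: real assume \<tau>: "\<tau> \<in> {s1..s2}" and e': "e' > 0"
      have "((\<lambda>x'. a \<bullet> P (X \<tau> x')) \<longlongrightarrow> a \<bullet> G \<tau>) (nhds (x \<tau>))"
        using near \<tau> s(2) by (intro tendsto_intros) auto
      then have "\<forall>\<^sub>F x' in nhds (x \<tau>). dist (a \<bullet> P (X \<tau> x')) (a \<bullet> G \<tau>) < e'"
        using e' tendstoD by blast
      then obtain \<delta> where \<delta>: "\<delta> > 0" "\<And>x'. dist x' (x \<tau>) < \<delta> \<Longrightarrow> dist (a \<bullet> P (X \<tau> x')) (a \<bullet> G \<tau>) < e'"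
        unfolding eventually_nhds_metric by blast
      have "a \<bullet> (G \<tau> - D) \<le> 1 * e"
        using norm_cauchy_schwarz[of a "G \<tau> - D"] mult_mono[OF a s(3)[OF \<tau>]] by force
      then have "a \<bullet> G \<tau> \<le> a \<bullet> D + e" by (simp add: inner_diff_right)
      then have "a \<bullet> P (X \<tau> x') \<le> a \<bullet> D + e + e'" if "x' \<in> ball (x \<tau>) \<delta>" for x'
        using \<delta>(2)[of x'] that by (auto simp: dist_real_def dist_commute)
      then show "\<exists>\<delta>>0. \<forall>x'\<in>ball (x \<tau>) \<delta>. a \<bullet> P (X \<tau> x') \<le> a \<bullet> D + e + e'" using \<delta>(1) by blast
    qed
    then show ?thesis by (simp add: inner_diff_right algebra_simps)
  qed
  have key2: "norm (P (x s2) - P (x s1) - (s2 - s1) *\<^sub>R D) \<le> e * (s2 - s1)"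
    if s: "s1 \<le> s2" "{s1..s2} \<subseteq> J" "\<And>\<tau>. \<tau> \<in> {s1..s2} \<Longrightarrow> norm (G \<tau> - D) \<le> e" for s1 s2 e D
  proof -
    \<comment> \<open>The test functional that attains the norm is the normalised increment
      itself.\<close>
    have "sgn r \<bullet> r = norm r" for r :: 'b
      by (cases "r = 0") (auto simp: sgn_div_norm dot_square_norm power2_eq_square)
    then show ?thesis
      using key[OF s, of "sgn (P (x s2) - P (x s1) - (s2 - s1) *\<^sub>R D)"] by (simp add: norm_sgn)
  qed
  show ?thesis
    unfolding has_vector_derivative_def has_derivative_within_alt
  proof (intro conjI allI impI)
    show "bounded_linear (\<lambda>h. h *\<^sub>R G t)" by (rule bounded_linear_scaleR_left)
    fix e :: real assume "e > 0"
    with G t have "\<exists>d>0. \<forall>s\<in>J. dist s t < d \<longrightarrow> dist (G s) (G t) < e" unfolding continuous_on_iff by simp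
    then obtain d where d: "d > 0" "\<And>s. s \<in> J \<Longrightarrow> dist s t < d \<Longrightarrow> dist (G s) (G t) < e" by blast
    have "norm (P (x y) - P (x t) - (y - t) *\<^sub>R G t) \<le> e * norm (y - t)" if y: "y \<in> J" "norm (y - t) < d" for y
    proof (cases "t \<le> y")
      case True
      have sub: "{t..y} \<subseteq> J" using mem_is_interval_1_I[OF J t y(1)] by auto
      have "norm (G \<tau> - G t) \<le> e" if "\<tau> \<in> {t..y}" for \<tau>
        using d(2)[of \<tau>] that sub y by (auto simp: dist_norm intro: less_imp_le)
      from key2[OF True sub this] True show ?thesis by simp
    next
      case False
      then have yt: "y \<le> t" by simp
      have sub: "{y..t} \<subseteq> J" using mem_is_interval_1_I[OF J y(1) t] by auto
      have "norm (G \<tau> - G t) \<le> e" if "\<tau> \<in> {y..t}" for \<tau>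
        using d(2)[of \<tau>] that sub y yt by (auto simp: dist_norm intro: less_imp_le)
      from key2[OF yt sub this] yt have "norm (P (x t) - P (x y) - (t - y) *\<^sub>R G t) \<le> e * norm (y - t)" by simp
      moreover have "P (x y) - P (x t) - (y - t) *\<^sub>R G t = - (P (x t) - P (x y) - (t - y) *\<^sub>R G t)"
        by (simp add: algebra_simps)
      ultimately show ?thesis by (metis norm_minus_cancel)
    qed
    then show "\<exists>d>0. \<forall>y\<in>J. norm (y - t) < d \<longrightarrow> norm (P (x y) - P (x t) - (y - t) *\<^sub>R G t) \<le> e * norm (y - t)"
      using d(1) by blast
  qed
qed

subsection \<open>Lipschitz curves are differentiable almost everywhere\<close>

text \<open>Adding a steep linear function to \<open>f\<close> gives a bi-Lipschitz bijection of the line. The image of Lebesgue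
  measure under its inverse has a density, and the density is the derivative at almost every point.\<close>

lemma lipschitz_imp_indefinite_integral:
  fixes f :: "real \<Rightarrow> real"
  assumes lip: "L-lipschitz_on UNIV f"
  obtains g where "\<And>a b. a \<le> b \<Longrightarrow> (g has_integral (f b - f a)) {a..b}"
proof -
  \<comment> \<open>The summand 1 keeps M positive when L = 0. The difference quotients of F below
    then lie between M and \<open>3 * M\<close>.\<close>
  define M where "M = L + 1"
  have L0: "L \<ge> 0" using lip lipschitz_on_nonneg by blast
  then have M: "M > 0" by (simp add: M_def)
  define F where "F t = f t + 2 * M * t" for t
  have ff: "\<bar>f t - f s\<bar> \<le> M * (t - s)" if "s \<le> t" for s t
  proof -
    have "\<bar>f t - f s\<bar> \<le> L * \<bar>t - s\<bar>" using lipschitz_onD[OF lip, of t s] by (simp add: dist_real_def)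
    also have "\<dots> \<le> M * (t - s)" using that by (simp add: M_def mult_right_mono)
    finally show ?thesis .
  qed
  have Flow: "M * (t - s) \<le> F t - F s" and Fup: "F t - F s \<le> 3 * M * (t - s)" if "s \<le> t" for s t
    using ff[OF that] unfolding F_def by (auto simp: algebra_simps abs_le_iff)
  have Fmono: "F s < F t" if "s < t" for s t
  proof -
    have "0 < M * (t - s)" using M that by simp
    then show ?thesis using Flow[of s t] that by simp
  qed
  have Fiff: "F s \<le> F t \<longleftrightarrow> s \<le> t" for s t using Fmono by (metis leD linorder_le_less_linear order_less_imp_le order_refl le_less)
  have contF: "continuous_on UNIV F" unfolding F_def
    by (intro continuous_intros lipschitz_on_continuous_on[OF lip])
  have surj: "\<exists>t. F t = y" for y
  proof -
    define r where "r = (\<bar>y\<bar> + \<bar>F 0\<bar>) / M"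
    have r: "r \<ge> 0" "M * r = \<bar>y\<bar> + \<bar>F 0\<bar>" using M by (auto simp: r_def)
    have "F (-r) \<le> y" "y \<le> F r" using Flow[of "-r" 0] Flow[of 0 r] r by auto
    then have "\<exists>t\<ge>-r. t \<le> r \<and> F t = y"
      using r by (intro IVT') (auto intro: continuous_on_subset[OF contF])
    then show ?thesis by blast
  qed
  define G where "G = inv_into UNIV F"
  have FG: "F (G y) = y" for y unfolding G_def using surj[of y] by (metis f_inv_into_f rangeI)
  have GF: "G (F t) = t" for t using FG[of "F t"] Fiff by (metis order_antisym order_refl)
  have contG: "continuous_on UNIV G"
  proof (rule lipschitz_on_continuous_on[where L = "1 / M"], rule lipschitz_onI)
    fix y z :: real
    have "dist (G y) (G z) \<le> 1 / M * dist y z" if "G y \<le> G z" for y z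
      using Flow[OF that] that M Fiff[of "G y" "G z"] by (simp add: FG dist_real_def field_simps)
    then show "dist (G y) (G z) \<le> 1 / M * dist y z" by (metis dist_commute linear)
  qed (use M in auto)
  have Gm: "G \<in> borel_measurable borel" using contG by (rule borel_measurable_continuous_onI)
  define \<nu> where "\<nu> = distr lborel borel G"
  have sets\<nu>: "sets \<nu> = sets lborel" by (simp add: \<nu>_def)
  have ivl: "G -` {a..b} = {F a..F b}" for a b
    using FG Fiff by (auto simp: vimage_def) metis+
  have \<nu>ivl: "emeasure \<nu> {a..b} = ennreal (F b - F a)" if "a \<le> b" for a b
    using that Gm Fiff by (simp add: \<nu>_def emeasure_distr ivl)
  \<comment> \<open>The preimage of a null set under G is its image under the Lipschitz map F, hence
    null.\<close>
  have ac: "absolutely_continuous lborel \<nu>"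
    unfolding absolutely_continuous_def
  proof
    fix A :: "real set" assume A: "A \<in> null_sets lborel"
    then have neg: "negligible A"
      using negligible_iff_null_sets null_sets_completionI by blast
    have "negligible (F ` A)"
    proof (rule negligible_locally_Lipschitz_image[OF _ neg])
      fix x assume "x \<in> A"
      have "\<bar>F y - F x\<bar> \<le> 3 * M * \<bar>y - x\<bar>" for y
        using Fup[of x y] Fup[of y x] Fiff[of x y] Fiff[of y x] by (cases "x \<le> y") (auto simp: abs_if)
      then show "\<exists>T B. open T \<and> x \<in> T \<and> (\<forall>y\<in>A \<inter> T. norm (F y - F x) \<le> B * norm (y - x))"
        by (intro exI[of _ UNIV] exI[of _ "3 * M"]) auto
    qed simp
    moreover have "F ` A = G -` A" by (auto simp: GF) (metis FG image_eqI)
    ultimately have "negligible (G -` A)" by simp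
    moreover have "G -` A \<in> sets borel" using A Gm by (metis null_setsD2 measurable_sets sets_lborel space_borel inf_top_right)
    ultimately have "emeasure lborel (G -` A) = 0"
      using negligible_iff_emeasure0[of "G -` A"] by auto
    then show "A \<in> null_sets \<nu>" using A Gm by (auto simp: \<nu>_def null_sets_def emeasure_distr)
  qed
  obtain h where h: "h \<in> borel_measurable lborel" "density lborel h = \<nu>"
    using sigma_finite_measure.Radon_Nikodym[OF sigma_finite_lborel ac sets\<nu>] by blast
  have nn: "(\<integral>\<^sup>+x. h x * indicator {a..b} x \<partial>lborel) = ennreal (F b - F a)" if "a \<le> b" for a b
    using \<nu>ivl[OF that] emeasure_density[OF h(1), of "{a..b}"] unfolding h(2) by simp
  have fin: "AE x in lborel. x \<in> {a..b} \<longrightarrow> h x \<noteq> \<infinity>" for a b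
  proof (cases "a \<le> b")
    case True
    have "AE x in lborel. h x * indicator {a..b} x \<noteq> \<infinity>"
      using nn[OF True] h(1) by (intro nn_integral_PInf_AE) auto
    then show ?thesis by eventually_elim auto
  qed auto
  define g where "g x = enn2real (h x)" for x
  have gint: "(g has_integral (F b - F a)) {a..b}" if ab: "a \<le> b" for a b
  proof -
    have "(\<integral>\<^sup>+x. ennreal (g x * indicator {a..b} x) \<partial>lborel) = (\<integral>\<^sup>+x. h x * indicator {a..b} x \<partial>lborel)"
    proof (rule nn_integral_cong_AE)
      show "AE x in lborel. ennreal (g x * indicator {a..b} x) = h x * indicator {a..b} x"
        using fin[of a b] by eventually_elim (auto simp: g_def indicator_def ennreal_enn2real_if)
    qed
    also have "\<dots> = ennreal (F b - F a)" by (rule nn[OF ab])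
    finally have "((\<lambda>x. g x * indicator {a..b} x) has_integral (F b - F a)) UNIV"
      using h(1) ab Fiff by (intro nn_integral_has_integral) (auto simp: g_def)
    moreover have "(\<lambda>x. g x * indicator {a..b} x) = (\<lambda>x. if x \<in> {a..b} then g x else 0)"
      by (auto simp: indicator_def)
    ultimately show ?thesis by (simp only: has_integral_restrict_UNIV)
  qed
  have "((\<lambda>x. g x - 2 * M) has_integral (f b - f a)) {a..b}" if "a \<le> b" for a b
    using has_integral_diff[OF gint[OF that] has_integral_const_real[of "2 * M" a b]] that
    by (simp add: F_def algebra_simps)
  then show ?thesis by (rule that)
qed

text \<open>Lebesgue differentiation over intervals that start at x. Being one-sided, it is applied
  a second time to a reflected function to obtain left quotients.\<close>

lemma indefinite_integral_right_difference_quotient: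
  fixes f g :: "real \<Rightarrow> real"
  assumes g: "\<And>a b. a \<le> b \<Longrightarrow> (g has_integral (f b - f a)) {a..b}"
  obtains N where "negligible N" "\<And>x e. x \<notin> N \<Longrightarrow> 0 < e \<Longrightarrow> \<exists>d>0. \<forall>h. 0 < h \<and> h < d \<longrightarrow> \<bar>f (x + h) - f x - h * g x\<bar> \<le> e * h"
proof -
  have "g integrable_on cbox a b" for a b
    using g by (cases "a \<le> b") (auto simp: integrable_on_def)
  from integrable_ccontinuous_explicit[OF this]
  obtain N where N: "negligible N" "\<And>x e. x \<notin> N \<Longrightarrow> 0 < e \<Longrightarrow> \<exists>d>0. \<forall>h. 0 < h \<and> h < d \<longrightarrow>
     norm (integral (cbox x (x + h *\<^sub>R One)) g /\<^sub>R h ^ DIM(real) - g x) < e" by blast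
  show ?thesis
  proof (rule that[OF N(1)])
    fix x e :: real assume "x \<notin> N" "0 < e"
    from N(2)[OF this] obtain d where d: "d > 0" "\<And>h. 0 < h \<Longrightarrow> h < d \<Longrightarrow>
     norm (integral (cbox x (x + h *\<^sub>R One)) g /\<^sub>R h ^ DIM(real) - g x) < e" by blast
    have "\<bar>f (x + h) - f x - h * g x\<bar> \<le> e * h" if h: "0 < h" "h < d" for h
    proof -
      have "integral {x..x + h} g = f (x + h) - f x" using g[of x "x + h"] h by (intro integral_unique) auto
      then have "\<bar>(f (x + h) - f x) / h - g x\<bar> < e" using d(2)[OF h] by (simp add: divide_inverse mult.commute)
      moreover have "(f (x + h) - f x) / h - g x = (f (x + h) - f x - h * g x) / h" using h by (simp add: field_simps)
      ultimately have "\<bar>f (x + h) - f x - h * g x\<bar> / h < e" using h by (simp add: abs_divide)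
      then show ?thesis using h by (simp add: field_simps)
    qed
    then show "\<exists>d>0. \<forall>h. 0 < h \<and> h < d \<longrightarrow> \<bar>f (x + h) - f x - h * g x\<bar> \<le> e * h" using d(1) by blast
  qed
qed

lemma lipschitz_differentiable_ae_real:
  fixes f :: "real \<Rightarrow> real"
  assumes lip: "L-lipschitz_on UNIV f"
  obtains N where "negligible N" "\<And>x. x \<notin> N \<Longrightarrow> \<exists>D. (f has_vector_derivative D) (at x)"
proof -
  obtain g where g: "\<And>a b. a \<le> b \<Longrightarrow> (g has_integral (f b - f a)) {a..b}"
    using lipschitz_imp_indefinite_integral[OF lip] by blast
  obtain N1 where N1: "negligible N1" "\<And>x e. x \<notin> N1 \<Longrightarrow> 0 < e \<Longrightarrow> \<exists>d>0. \<forall>h. 0 < h \<and> h < d \<longrightarrow> \<bar>f (x + h) - f x - h * g x\<bar> \<le> e * h"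
    using indefinite_integral_right_difference_quotient[OF g] by blast
  have g': "((\<lambda>x. g (- x)) has_integral ((\<lambda>x. - f (- x)) b - (\<lambda>x. - f (- x)) a)) {a..b}" if "a \<le> b" for a b
    using g[of "-b" "-a"] that has_integral_reflect_real[where f = g and a = "-b" and b = "-a"] by (simp add: algebra_simps)
  obtain N2 where N2: "negligible N2" "\<And>x e. x \<notin> N2 \<Longrightarrow> 0 < e \<Longrightarrow> \<exists>d>0. \<forall>h. 0 < h \<and> h < d \<longrightarrow> \<bar>- f (-(x + h)) - - f (- x) - h * g (- x)\<bar> \<le> e * h"
    using indefinite_integral_right_difference_quotient[OF g'] by blast
  have N3: "negligible (uminus ` N2)"
  proof (rule negligible_locally_Lipschitz_image[OF _ N2(1)])
    show "\<exists>T B. open T \<and> x \<in> T \<and> (\<forall>y\<in>N2 \<inter> T. norm (- y - - x) \<le> B * norm (y - x))" for x :: real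
      by (intro exI[of _ "UNIV :: real set"] exI[of _ "1 :: real"]) auto
  qed simp
  show ?thesis
  proof (rule that[of "N1 \<union> uminus ` N2"])
    show "negligible (N1 \<union> uminus ` N2)" using N1 N3 by (intro negligible_Un)
    fix x assume "x \<notin> N1 \<union> uminus ` N2"
    then have x: "x \<notin> N1" "- x \<notin> N2" by (auto simp: image_iff)
    have "(f has_vector_derivative g x) (at x)"
      unfolding has_vector_derivative_def has_derivative_within_alt
    proof (intro conjI allI impI)
      show "bounded_linear (\<lambda>h. h *\<^sub>R g x)" by (rule bounded_linear_scaleR_left)
      fix e :: real assume e: "e > 0"
      obtain d1 where d1: "d1 > 0" "\<And>h. 0 < h \<Longrightarrow> h < d1 \<Longrightarrow> \<bar>f (x + h) - f x - h * g x\<bar> \<le> e * h" using N1(2)[OF x(1) e] by blast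
      obtain d2 where d2: "d2 > 0" "\<And>h. 0 < h \<Longrightarrow> h < d2 \<Longrightarrow> \<bar>- f (- (- x + h)) - (- f (- (- x))) - h * g (- (- x))\<bar> \<le> e * h" using N2(2)[OF x(2) e] by blast
      have "norm (f y - f x - (y - x) *\<^sub>R g x) \<le> e * norm (y - x)" if y: "norm (y - x) < min d1 d2" for y
      proof -
        consider "y = x" | "y > x" | "y < x" by linarith
        then show ?thesis
        proof cases
          case 2 then show ?thesis using d1(2)[of "y - x"] y by simp
        next
          case 3
          then have "\<bar>f x - f y - (x - y) * g x\<bar> \<le> e * (x - y)" using d2(2)[of "x - y"] y by (simp add: algebra_simps)
          moreover have "f y - f x - (y - x) * g x = - (f x - f y - (x - y) * g x)" by (simp add: algebra_simps)
          ultimately show ?thesis using 3 by (metis abs_minus_cancel abs_minus_commute abs_of_pos diff_gt_0_iff_gt real_norm_def real_scaleR_def)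
        qed simp
      qed
      then show "\<exists>d>0. \<forall>y\<in>UNIV. norm (y - x) < d \<longrightarrow> norm (f y - f x - (y - x) *\<^sub>R g x) \<le> e * norm (y - x)"
        using d1(1) d2(1) by (intro exI[of _ "min d1 d2"]) auto
    qed
    then show "\<exists>D. (f has_vector_derivative D) (at x)" by blast
  qed
qed

lemma lipschitz_differentiable_ae:
  fixes x :: "real \<Rightarrow> 'a::euclidean_space"
  assumes ab: "a \<le> b" and lip: "L-lipschitz_on {a..b} x"
  obtains N where "negligible N" "\<And>t. t \<in> {a<..<b} - N \<Longrightarrow> \<exists>D. (x has_vector_derivative D) (at t)"
proof -
  \<comment> \<open>Clamping the time to \<open>{a..b}\<close> is 1-Lipschitz, so
    \<open>x (c t)\<close> is a Lipschitz extension of x to the whole line.\<close>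
  define c where "c t = min b (max a t)" for t :: real
  have c: "c t \<in> {a..b}" "t \<in> {a..b} \<Longrightarrow> c t = t" for t using ab by (auto simp: c_def)
  have clip: "dist (c s) (c t) \<le> dist s t" for s t by (auto simp: c_def dist_real_def)
  have "\<exists>N. negligible N \<and> (\<forall>t. t \<notin> N \<longrightarrow> (\<exists>D. ((\<lambda>t. x (c t) \<bullet> i) has_vector_derivative D) (at t)))" if "i \<in> Basis" for i
  proof -
    have "L-lipschitz_on UNIV (\<lambda>t. x (c t) \<bullet> i)"
    proof (rule lipschitz_onI)
      fix s t
      have "dist (x (c s) \<bullet> i) (x (c t) \<bullet> i) \<le> dist (x (c s)) (x (c t))"
        using that Basis_le_norm[of i "x (c s) - x (c t)"] by (simp add: dist_norm inner_diff_left)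
      also have "\<dots> \<le> L * dist (c s) (c t)" using lipschitz_onD[OF lip] c by blast
      also have "\<dots> \<le> L * dist s t" using clip lipschitz_on_nonneg[OF lip] by (intro mult_left_mono)
      finally show "dist (x (c s) \<bullet> i) (x (c t) \<bullet> i) \<le> L * dist s t" .
    qed (use lipschitz_on_nonneg[OF lip] in auto)
    then show ?thesis by (rule lipschitz_differentiable_ae_real) blast
  qed
  then obtain N where N: "\<And>i. i \<in> Basis \<Longrightarrow> negligible (N i)"
    "\<And>i t. i \<in> Basis \<Longrightarrow> t \<notin> N i \<Longrightarrow> \<exists>D. ((\<lambda>t. x (c t) \<bullet> i) has_vector_derivative D) (at t)" by metis
  show ?thesis
  proof (rule that[of "\<Union>i\<in>Basis. N i"])
    show "negligible (\<Union>i\<in>Basis. N i)" using N(1) by (intro negligible_Union) auto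
    fix t assume t: "t \<in> {a<..<b} - (\<Union>i\<in>Basis. N i)"
    then have "\<forall>i\<in>Basis. \<exists>D. ((\<lambda>t. x (c t) \<bullet> i) has_vector_derivative D) (at t)" using N(2) by blast
    then obtain D where D: "\<And>i. i \<in> Basis \<Longrightarrow> ((\<lambda>t. x (c t) \<bullet> i) has_vector_derivative D i) (at t)" by metis
    have "((\<lambda>t. \<Sum>i\<in>Basis. (x (c t) \<bullet> i) *\<^sub>R i) has_vector_derivative (\<Sum>i\<in>Basis. D i *\<^sub>R i)) (at t)"
      using D by (intro has_vector_derivative_sum) (auto intro!: derivative_eq_intros simp: has_real_derivative_iff_has_vector_derivative)
    then have "((\<lambda>t. x (c t)) has_vector_derivative (\<Sum>i\<in>Basis. D i *\<^sub>R i)) (at t)"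
      by (simp add: euclidean_representation)
    then have "(x has_vector_derivative (\<Sum>i\<in>Basis. D i *\<^sub>R i)) (at t)"
      by (rule has_vector_derivative_transform_within_open[where S = "{a<..<b}"]) (use t c in auto)
    then show "\<exists>D. (x has_vector_derivative D) (at t)" by blast
  qed
qed

subsection \<open>Limits of Euler polygons\<close>

text \<open>At time s the polygon uses the field at its last grid point, at most h away in time and
  \<open>K * h\<close> in space. A linear lower bound on the field over that neighbourhood therefore
  integrates. This is the form of the equation that survives a limit.\<close>

lemma euler_polygon:
  fixes X :: "real \<Rightarrow> 'a::euclidean_space \<Rightarrow> 'a"
  assumes h: "h > 0" and bound: "\<And>t x. t \<ge> a \<Longrightarrow> norm (X t x) \<le> K"
  obtains x where "x a = xa" "K-lipschitz_on {a..} x"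
    "\<And>c \<beta> u v. a \<le> u \<Longrightarrow> u \<le> v \<Longrightarrow>
       (\<And>t' x' s. s \<in> {u..v} \<Longrightarrow> t' \<ge> a \<Longrightarrow> \<bar>t' - s\<bar> \<le> h \<Longrightarrow> norm (x' - x s) \<le> K * h \<Longrightarrow> \<beta> \<le> c \<bullet> X t' x') \<Longrightarrow>
       \<beta> * (v - u) \<le> c \<bullet> (x v - x u)"
proof -
  \<comment> \<open>The nodes of the polygon; \<open>\<kappa> s\<close> is the index of the last
    grid time not after s, and g is the piecewise constant velocity.\<close>
  define \<xi> where "\<xi> = rec_nat xa (\<lambda>k y. y + h *\<^sub>R X (a + real k * h) y)"
  have \<xi>: "\<xi> 0 = xa" "\<xi> (Suc k) = \<xi> k + h *\<^sub>R X (a + real k * h) (\<xi> k)" for k by (simp_all add: \<xi>_def)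
  define \<kappa> where "\<kappa> s = nat \<lfloor>(s - a) / h\<rfloor>" for s
  define g where "g s = X (a + real (\<kappa> s) * h) (\<xi> (\<kappa> s))" for s
  have K0: "K \<ge> 0" using bound[of a 0] norm_ge_zero[of "X a 0"] by linarith
  have gb: "norm (g s) \<le> K" for s unfolding g_def using h by (intro bound) auto
  have "(\<lambda>s. \<kappa> s) \<in> borel \<rightarrow>\<^sub>M count_space UNIV" unfolding \<kappa>_def by measurable
  then have gm: "g \<in> borel_measurable borel" unfolding g_def
    by (rule measurable_compose[where f = \<kappa> and g = "\<lambda>k. X (a + real k * h) (\<xi> k)"]) auto
  have gi: "g integrable_on {u..v}" for u v
  proof -
    have "set_integrable lborel {u..v} g"
      unfolding set_integrable_def
    proof (rule Bochner_Integration.integrable_bound[of _ "\<lambda>s. indicator {u..v} s *\<^sub>R K"])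
      show "integrable lborel (\<lambda>s. indicator {u..v} s *\<^sub>R K)"
        using borel_integrable_compact[of "{u..v}" "\<lambda>_. K"] by simp
    qed (use gm in \<open>auto simp: indicator_def intro: order_trans[OF gb abs_ge_self]\<close>)
    then show ?thesis by (rule set_borel_integral_eq_integral(1))
  qed
  define x where "x t = xa + integral {a..t} g" for t
  have xd: "x v - x u = integral {u..v} g" if "a \<le> u" "u \<le> v" for u v
  proof -
    have "integral {a..v} g = integral {a..u} g + integral {u..v} g"
      using Henstock_Kurzweil_Integration.integral_combine[of a u v g] that gi by simp
    then show ?thesis by (simp add: x_def)
  qed
  have lip: "K-lipschitz_on {a..} x"
  proof (rule lipschitz_onI[OF _ K0])
    have *: "dist (x u) (x v) \<le> K * dist u v" if "a \<le> u" "u \<le> v" for u v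
    proof -
      have "norm (integral {u..v} g) \<le> integral {u..v} (\<lambda>_. K)"
        using gi gb by (intro Henstock_Kurzweil_Integration.integral_norm_bound_integral) auto
      then show ?thesis using that by (simp add: xd[OF that, symmetric] dist_norm norm_minus_commute mult.commute)
    qed
    show "dist (x u) (x v) \<le> K * dist u v" if "u \<in> {a..}" "v \<in> {a..}" for u v
      using *[of u v] *[of v u] that by (cases "u \<le> v") (auto simp: dist_commute)
  qed
  have \<kappa>: "real (\<kappa> s) * h \<le> s - a" "s - a < (real (\<kappa> s) + 1) * h" if "a \<le> s" for s
  proof -
    have *: "real (\<kappa> s) = of_int \<lfloor>(s - a) / h\<rfloor>" using that h by (simp add: \<kappa>_def)
    have "real (\<kappa> s) \<le> (s - a) / h" "(s - a) / h < real (\<kappa> s) + 1" unfolding * by linarith+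
    then show "real (\<kappa> s) * h \<le> s - a" "s - a < (real (\<kappa> s) + 1) * h" using h by (auto simp: field_simps)
  qed
  have x\<xi>: "x (a + real k * h) = \<xi> k" for k
  proof (induction k)
    case 0 show ?case by (simp add: x_def \<xi>)
  next
    case (Suc k)
    let ?u = "a + real k * h" and ?v = "a + real (Suc k) * h"
    have "((\<lambda>_. X ?u (\<xi> k)) has_integral (?v - ?u) *\<^sub>R X ?u (\<xi> k)) {?u..?v}"
      using has_integral_const_real[of "X ?u (\<xi> k)" ?u ?v] h by (simp add: algebra_simps)
    then have "(g has_integral (?v - ?u) *\<^sub>R X ?u (\<xi> k)) {?u..?v}"
    proof (rule has_integral_spike_finite[of "{?v}", rotated 2])
      fix s assume s: "s \<in> {?u..?v} - {?v}"
      then have as: "a \<le> s" using h by (auto intro: order_trans[of a ?u])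
      have "real (\<kappa> s) * h < (real k + 1) * h" "real k * h < (real (\<kappa> s) + 1) * h" using \<kappa>[OF as] s by (auto simp: algebra_simps)
      then have "real (\<kappa> s) < real k + 1" "real k < real (\<kappa> s) + 1" using h mult_less_cancel_right_pos by blast+
      then have "\<kappa> s = k" by linarith
      then show "g s = X ?u (\<xi> k)" by (simp add: g_def)
    qed simp
    then have "integral {?u..?v} g = h *\<^sub>R X ?u (\<xi> k)" by (simp add: integral_unique algebra_simps)
    moreover have "x ?v - x ?u = integral {?u..?v} g" using h by (intro xd) auto
    ultimately show ?case using Suc.IH \<xi>(2)[of k] by (metis diff_add_cancel add.commute)
  qed
  show ?thesis
  proof (rule that[OF _ lip])
    show "x a = xa" by (simp add: x_def)
    fix c :: 'a and \<beta> u v assume uv: "a \<le> u" "u \<le> v"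
      and *: "\<And>t' x' s. s \<in> {u..v} \<Longrightarrow> t' \<ge> a \<Longrightarrow> \<bar>t' - s\<bar> \<le> h \<Longrightarrow> norm (x' - x s) \<le> K * h \<Longrightarrow> \<beta> \<le> c \<bullet> X t' x'"
    have low: "\<beta> \<le> c \<bullet> g s" if s: "s \<in> {u..v}" for s
    proof -
      have as: "a \<le> s" using s uv by auto
      let ?t = "a + real (\<kappa> s) * h"
      have t: "?t \<ge> a" "\<bar>?t - s\<bar> \<le> h" using \<kappa>[OF as] h by (auto simp: algebra_simps)
      have "dist (x ?t) (x s) \<le> K * dist ?t s" using lipschitz_onD[OF lip] t as by auto
      also have "\<dots> \<le> K * h" using t K0 by (intro mult_left_mono) (auto simp: dist_real_def)
      finally have "norm (\<xi> (\<kappa> s) - x s) \<le> K * h" by (simp add: x\<xi> dist_norm)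
      from *[OF s t this] show ?thesis by (simp add: g_def)
    qed
    have gu: "(g has_integral (x v - x u)) {u..v}" using xd[OF uv] gi[of u v] by (simp add: has_integral_integral)
    have 1: "((\<lambda>s. c \<bullet> g s) has_integral (c \<bullet> (x v - x u))) {u..v}"
      using has_integral_linear[OF gu bounded_linear_inner_right[of c]] by (simp add: comp_def)
    have 2: "((\<lambda>_. \<beta>) has_integral (\<beta> * (v - u))) {u..v}"
      using has_integral_const_real[of \<beta> u v] uv by (simp add: mult.commute)
    show "\<beta> * (v - u) \<le> c \<bullet> (x v - x u)" by (rule has_integral_le[OF 2 1 low])
  qed
qed

text \<open>Arzela-Ascoli for polygons with step 1 / (n + 1). The velocities need not converge, so
  the equation is kept in dual form: a closed half-space that contains the field near
  \<open>(t, x t)\<close> contains the derivative of the limit at t.\<close>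

lemma euler_limit:
  fixes X :: "real \<Rightarrow> 'a::euclidean_space \<Rightarrow> 'a"
  assumes ab: "a < b" and bound: "\<And>t x. t \<ge> a \<Longrightarrow> norm (X t x) \<le> K"
  obtains x where "x a = xa" "K-lipschitz_on {a..b} x"
    "\<And>t d c \<beta> \<delta>. t \<in> {a<..<b} \<Longrightarrow> (x has_vector_derivative d) (at t) \<Longrightarrow> \<delta> > 0 \<Longrightarrow>
      (\<And>t' x'. t' \<ge> a \<Longrightarrow> \<bar>t' - t\<bar> < \<delta> \<Longrightarrow> norm (x' - x t) < \<delta> \<Longrightarrow> \<beta> \<le> c \<bullet> X t' x') \<Longrightarrow> \<beta> \<le> c \<bullet> d"
proof -
  define h where "h n = 1 / real (Suc n)" for n
  have h: "h n > 0" for n by (simp add: h_def)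
  have h0: "h \<longlonglongrightarrow> 0" unfolding h_def by (rule LIMSEQ_Suc[OF lim_1_over_n])
  have K0: "K \<ge> 0" using bound[of a 0] norm_ge_zero[of "X a 0"] by linarith
  define Q where "Q n x \<longleftrightarrow> x a = xa \<and> K-lipschitz_on {a..} x \<and>
    (\<forall>c \<beta> u v. a \<le> u \<longrightarrow> u \<le> v \<longrightarrow>
       (\<forall>t' x' s. s \<in> {u..v} \<longrightarrow> t' \<ge> a \<longrightarrow> \<bar>t' - s\<bar> \<le> h n \<longrightarrow> norm (x' - x s) \<le> K * h n \<longrightarrow> \<beta> \<le> c \<bullet> X t' x') \<longrightarrow>
       \<beta> * (v - u) \<le> c \<bullet> (x v - x u))" for n x
  have "\<exists>x. Q n x" for n
    unfolding Q_def by (rule euler_polygon[of "h n" a X K xa, OF h bound]) blast+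
  then obtain P where Q: "\<And>n. Q n (P n)" by metis
  have P: "P n a = xa" "K-lipschitz_on {a..} (P n)" for n using Q[of n] unfolding Q_def by blast+
  have P3: "\<beta> * (v - u) \<le> c \<bullet> (P n v - P n u)" if "a \<le> u" "u \<le> v"
     "\<And>t' x' s. s \<in> {u..v} \<Longrightarrow> t' \<ge> a \<Longrightarrow> \<bar>t' - s\<bar> \<le> h n \<Longrightarrow> norm (x' - P n s) \<le> K * h n \<Longrightarrow> \<beta> \<le> c \<bullet> X t' x'" for n c \<beta> u v
    using Q[of n] that unfolding Q_def by blast
  have lip: "norm (P n s - P n t) \<le> K * \<bar>s - t\<bar>" if "s \<ge> a" "t \<ge> a" for n s t
    using lipschitz_onD[OF P(2), of s t n] that by (simp add: dist_norm dist_real_def)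
  obtain x k where xk: "strict_mono (k :: nat \<Rightarrow> nat)"
     "\<And>e. 0 < e \<Longrightarrow> \<exists>N. \<forall>n s. n \<ge> N \<and> s \<in> {a..b} \<longrightarrow> norm (P (k n) s - x s) < e"
  proof (rule Arzela_Ascoli[of "{a..b}" P "norm xa + K * (b - a)"])
    show "norm (P n s) \<le> norm xa + K * (b - a)" if "s \<in> {a..b}" for n s
    proof -
      have "norm (P n s) \<le> norm xa + norm (P n s - P n a)" using norm_triangle_sub[of "P n s" "P n a"] P(1) by simp
      also have "norm (P n s - P n a) \<le> K * \<bar>s - a\<bar>" using that by (intro lip) auto
      also have "\<dots> \<le> K * (b - a)" using that K0 by (intro mult_left_mono) auto
      finally show ?thesis by simp
    qed
    show "\<exists>d>0. \<forall>n t. t \<in> {a..b} \<and> norm (s - t) < d \<longrightarrow> norm (P n s - P n t) < e" if s: "s \<in> {a..b}" and e: "0 < e" for s e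
    proof (intro exI[of _ "e / (K + 1)"] conjI allI impI)
      show "e / (K + 1) > 0" using e K0 by simp
      fix n t assume t: "t \<in> {a..b} \<and> norm (s - t) < e / (K + 1)"
      have "norm (P n s - P n t) \<le> K * \<bar>s - t\<bar>" using s t by (intro lip) auto
      also have "\<dots> \<le> K * (e / (K + 1))" using t K0 by (intro mult_left_mono) auto
      also have "\<dots> < e" using K0 e by (simp add: field_simps)
      finally show "norm (P n s - P n t) < e" .
    qed
  qed auto
  have lim: "(\<lambda>n. P (k n) s) \<longlonglongrightarrow> x s" if "s \<in> {a..b}" for s
    unfolding LIMSEQ_iff using xk(2) that by meson
  have hk: "(\<lambda>n. h (k n)) \<longlonglongrightarrow> 0" using LIMSEQ_subseq_LIMSEQ[OF h0 xk(1)] by (simp add: comp_def)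
  have lipx: "norm (x s - x t) \<le> K * \<bar>s - t\<bar>" if "s \<in> {a..b}" "t \<in> {a..b}" for s t
    using that lip by (intro LIMSEQ_le_const2[OF tendsto_norm[OF tendsto_diff[OF lim lim]]]) auto
  show ?thesis
  proof (rule that)
    show "x a = xa" using lim[of a] P(1) ab by (simp add: LIMSEQ_const_iff)
    show "K-lipschitz_on {a..b} x" using lipx K0 by (intro lipschitz_onI) (auto simp: dist_norm)
    fix t \<delta> \<beta> :: real and c d :: 'a
    assume t: "t \<in> {a<..<b}" and d: "(x has_vector_derivative d) (at t)" and \<delta>: "\<delta> > 0"
      and near: "\<And>t' x'. t' \<ge> a \<Longrightarrow> \<bar>t' - t\<bar> < \<delta> \<Longrightarrow> norm (x' - x t) < \<delta> \<Longrightarrow> \<beta> \<le> c \<bullet> X t' x'"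
    \<comment> \<open>The distance from \<open>x t\<close> to a point used by the polygon has three
      parts: the grid error \<open>K * h\<close>, the uniform error of the polygon, and the motion
      of the limit, at most \<open>K * \<eta>\<close>. Each gets a third of
      \<open>\<delta>\<close>.\<close>
    define \<eta> where "\<eta> = min (b - t) (\<delta> / (3 * (K + 1)))"
    have \<eta>: "\<eta> > 0" "\<eta> \<le> b - t" using t \<delta> K0 by (auto simp: \<eta>_def)
    have "(K + 1) * \<eta> \<le> (K + 1) * (\<delta> / (3 * (K + 1)))" using K0 by (intro mult_left_mono) (auto simp: \<eta>_def)
    also have "\<dots> = \<delta> / 3" using K0 by (simp add: field_simps)
    finally have K\<eta>: "K * \<eta> + \<eta> \<le> \<delta> / 3" by (simp add: algebra_simps)
    then have \<eta>3: "\<eta> \<le> \<delta> / 3" "K * \<eta> \<le> \<delta> / 3" using K0 \<eta>(1) mult_nonneg_nonneg[of K \<eta>] by linarith+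
    have inc: "\<beta> * (v - t) \<le> c \<bullet> (x v - x t)" if v: "t < v" "v < t + \<eta>" for v
    proof -
      have "(\<lambda>n. (K + 1) * h (k n)) \<longlonglongrightarrow> (K + 1) * 0" using hk by (intro tendsto_intros)
      then have "\<forall>\<^sub>F n in sequentially. (K + 1) * h (k n) < \<delta> / 3"
        using \<delta> by (intro order_tendstoD(2)) auto
      moreover have "\<forall>\<^sub>F n in sequentially. \<forall>s\<in>{a..b}. norm (P (k n) s - x s) < \<delta> / 3"
        unfolding eventually_sequentially using xk(2)[of "\<delta> / 3"] \<delta> by (metis zero_less_divide_iff zero_less_numeral)
      ultimately have "\<forall>\<^sub>F n in sequentially. \<beta> * (v - t) \<le> c \<bullet> (P (k n) v - P (k n) t)"
      proof eventually_elim
        case (elim n)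
        have Kh: "K * h (k n) + h (k n) < \<delta> / 3" using elim(1) by (simp add: algebra_simps)
        have Kh0: "K * h (k n) \<ge> 0" using K0 h[of "k n"] by simp
        show ?case
        proof (rule P3)
          fix t' x' s assume s: "s \<in> {t..v}" and t': "a \<le> t'" "\<bar>t' - s\<bar> \<le> h (k n)" and x': "norm (x' - P (k n) s) \<le> K * h (k n)"
          have sab: "s \<in> {a..b}" "t \<in> {a..b}" using s t v \<eta> by auto
          have "\<bar>t' - t\<bar> < \<delta>" using s v t' \<eta>3 Kh Kh0 \<delta> by auto
          moreover have "norm (x' - x t) < \<delta>"
          proof -
            have "norm (x' - x t) \<le> norm (x' - P (k n) s) + norm (P (k n) s - x s) + norm (x s - x t)"
              using norm_triangle_ineq[of "x' - P (k n) s" "P (k n) s - x s"] norm_triangle_ineq[of "x' - x s" "x s - x t"] by simp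
            moreover have "norm (x s - x t) \<le> K * \<eta>"
            proof -
              have "norm (x s - x t) \<le> K * \<bar>s - t\<bar>" using sab by (rule lipx)
              also have "\<dots> \<le> K * \<eta>" using s v K0 by (intro mult_left_mono) auto
              finally show ?thesis .
            qed
            moreover have "norm (P (k n) s - x s) < \<delta> / 3" using elim(2) sab by blast
            ultimately show ?thesis using x' Kh h[of "k n"] \<eta>3 by linarith
          qed
          ultimately show "\<beta> \<le> c \<bullet> X t' x'" using t' by (intro near)
        qed (use t v in auto)
      qed
      moreover have "(\<lambda>n. c \<bullet> (P (k n) v - P (k n) t)) \<longlonglongrightarrow> c \<bullet> (x v - x t)"
        using t v \<eta> by (intro tendsto_intros lim) auto
      ultimately show ?thesis
        by (intro tendsto_lowerbound[of _ "c \<bullet> (x v - x t)" sequentially]) auto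
    qed
    \<comment> \<open>Otherwise \<open>c \<bullet> x v - \<beta> * v\<close> would strictly drop
      just to the right of t, against \<open>inc\<close>.\<close>
    show "\<beta> \<le> c \<bullet> d"
    proof (rule ccontr)
      assume "\<not> ?thesis"
      then have neg: "c \<bullet> d - \<beta> < 0" by simp
      have "((\<lambda>v. c \<bullet> x v) has_vector_derivative (c \<bullet> d)) (at t)"
        using bounded_linear.has_vector_derivative[OF bounded_linear_inner_right d] .
      then have "((\<lambda>v. c \<bullet> x v) has_real_derivative (c \<bullet> d)) (at t)"
        by (simp add: has_real_derivative_iff_has_vector_derivative)
      then have "((\<lambda>v. c \<bullet> x v - \<beta> * v) has_real_derivative (c \<bullet> d - \<beta>)) (at t)"
        by (auto intro!: derivative_eq_intros)
      from DERIV_neg_dec_right[OF this neg]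
      obtain r where r: "r > 0" "\<And>w. 0 < w \<Longrightarrow> w < r \<Longrightarrow> c \<bullet> x (t + w) - \<beta> * (t + w) < c \<bullet> x t - \<beta> * t" by blast
      define w where "w = min r \<eta> / 2"
      have w: "0 < w" "w < r" "w < \<eta>" using r \<eta> by (auto simp: w_def)
      have "\<beta> * (t + w - t) \<le> c \<bullet> (x (t + w) - x t)" using w by (intro inc) auto
      then show False using r(2)[OF w(1,2)] by (simp add: inner_diff_right algebra_simps)
    qed
  qed
qed

subsection \<open>Existence of Filippov solutions\<close>

text \<open>Boundary points form a null set, so only two-sided derivatives in the interior have to
  be checked. This makes solutions on closed, half-open and unbounded intervals
  interchangeable.\<close>

lemma filippov_solutionI:
  assumes J: "negligible (J - interior J)"
    and ac: "\<And>a b. a \<le> b \<Longrightarrow> {a..b} \<subseteq> J \<Longrightarrow> abs_continuous_on a b x"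
    and N: "negligible N" and der: "\<And>t. t \<in> interior J - N \<Longrightarrow> \<exists>d\<in>filippov_map X t (x t). (x has_vector_derivative d) (at t)"
  shows "filippov_solution X J x"
proof -
  have "negligible (N \<union> (J - interior J))" using N J by (rule negligible_Un)
  then have "N \<union> (J - interior J) \<in> null_sets lebesgue" by (simp add: negligible_iff_null_sets)
  then have "AE t in lebesgue. t \<notin> N \<union> (J - interior J)" by (rule AE_not_in)
  then have "AE t in lebesgue. t \<in> J \<longrightarrow> (\<exists>d \<in> filippov_map X t (x t). (x has_vector_derivative d) (at t within J))"
  proof eventually_elim
    case (elim t)
    then show ?case using der[of t] by (metis DiffI UnCI at_within_interior)
  qed
  then show ?thesis using ac unfolding filippov_solution_def by blast
qed

lemma filippov_solutionE:
  assumes "filippov_solution X J x"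
  obtains N where "negligible N" "\<And>t. t \<in> interior J - N \<Longrightarrow> \<exists>d\<in>filippov_map X t (x t). (x has_vector_derivative d) (at t)"
proof -
  have "AE t in lebesgue. t \<in> J \<longrightarrow> (\<exists>d \<in> filippov_map X t (x t). (x has_vector_derivative d) (at t within J))"
    using assms unfolding filippov_solution_def by blast
  then obtain N where N: "N \<in> null_sets lebesgue" "\<And>t. t \<notin> N \<Longrightarrow> t \<in> J \<Longrightarrow> (\<exists>d \<in> filippov_map X t (x t). (x has_vector_derivative d) (at t within J))"
    by (auto elim!: AE_E3)
  show ?thesis
  proof (rule that)
    show "negligible N" using N by (simp add: negligible_iff_null_sets)
    fix t assume "t \<in> interior J - N"
    then show "\<exists>d\<in>filippov_map X t (x t). (x has_vector_derivative d) (at t)"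
      using N(2)[of t] interior_subset by (metis DiffE at_within_interior subsetD)
  qed
qed

lemma filippov_solution_subset:
  assumes sol: "filippov_solution X J x" and I: "I \<subseteq> J" "negligible (I - interior I)" and eq: "\<And>t. t \<in> I \<Longrightarrow> y t = x t"
  shows "filippov_solution X I y"
proof -
  obtain N where N: "negligible N" "\<And>t. t \<in> interior J - N \<Longrightarrow> \<exists>d\<in>filippov_map X t (x t). (x has_vector_derivative d) (at t)"
    using filippov_solutionE[OF sol] by blast
  show ?thesis
  proof (rule filippov_solutionI[OF I(2) _ N(1)])
    fix a b :: real assume ab: "a \<le> b" "{a..b} \<subseteq> I"
    then have "abs_continuous_on a b x" using I filippov_solution_AC[OF sol] by blast
    then show "abs_continuous_on a b y" using eq ab abs_continuous_on_cong[of a b y x] by blast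
  next
    fix t assume t: "t \<in> interior I - N"
    then have "t \<in> interior J - N" using interior_mono[OF I(1)] by blast
    then obtain d where d: "d \<in> filippov_map X t (x t)" "(x has_vector_derivative d) (at t)" using N(2) by blast
    have "(y has_vector_derivative d) (at t)"
      by (rule has_vector_derivative_transform_within_open[OF d(2), of "interior I"]) (use t eq in \<open>auto simp: subsetD[OF interior_subset]\<close>)
    moreover have "y t = x t" using t eq interior_subset by blast
    ultimately show "\<exists>d\<in>filippov_map X t (y t). (y has_vector_derivative d) (at t)" using d(1) by auto
  qed
qed

lemma negligible_interval_boundary:
  "negligible ({a..b} - interior {a..b})" "negligible ({a..<b} - interior {a..<b})" "negligible ({a..} - interior {a..})"
  for a b :: real
proof -
  have "{a..b} - interior {a..b} \<subseteq> {a, b}" "{a..<b} - interior {a..<b} \<subseteq> {a}" "{a..} - interior {a..} \<subseteq> {a}"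
    by (auto simp: interior_atLeastAtMost_real interior_atLeastLessThan interior_Ici[of "a - 1"])
  then show "negligible ({a..b} - interior {a..b})" "negligible ({a..<b} - interior {a..<b})" "negligible ({a..} - interior {a..})"
    by (meson negligible_finite finite.emptyI finite_insert negligible_subset)+
qed

lemma filippov_map_closed_convex: "closed (filippov_map X t x)" "convex (filippov_map X t x)"
  unfolding filippov_map_def by (auto intro!: closed_INT convex_INT convex_closure convex_convex_hull)

text \<open>Testing with the increment c itself gives
  \<open>norm c * norm c \<le> norm c * (K * (t - s))\<close>. The field bound is required up to
  \<open>R + 1\<close> because the Filippov set at radius R sees a neighbourhood.\<close>

lemma filippov_solution_lipschitz:
  fixes x :: "real \<Rightarrow> 'a::euclidean_space"
  assumes sol: "filippov_solution X J x" and J: "is_interval J" "J \<noteq> {}" and bnd: "\<And>t. t \<in> J \<Longrightarrow> norm (x t) \<le> R"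
    and K: "\<And>t y. t \<in> J \<Longrightarrow> norm y \<le> R + 1 \<Longrightarrow> norm (X t y) \<le> K"
  shows "K-lipschitz_on J x"
proof -
  obtain s where s: "s \<in> J" using J by blast
  have "norm (0::'a) \<le> R + 1" using order_trans[OF norm_ge_zero bnd[OF s]] by simp
  then have K0: "K \<ge> 0" using order_trans[OF norm_ge_zero K[OF s]] by blast
  have *: "norm (x t - x s) \<le> K * (t - s)" if st: "s \<in> J" "t \<in> J" "s \<le> t" for s t
  proof -
    define c where "c = x t - x s"
    have sub: "{s..t} \<subseteq> J" using mem_is_interval_1_I[OF J(1) st(1,2)] by auto
    have "c \<bullet> x t - c \<bullet> x s \<le> (norm c * K) * (t - s)"
    proof (rule filippov_solution_increment_le[OF sol st(3) sub C1_linear])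
      show "linear (\<lambda>y. c \<bullet> y)" by (simp add: bounded_linear.linear bounded_linear_inner_right)
      fix \<tau> e :: real assume \<tau>: "\<tau> \<in> {s..t}" and e: "e > 0"
      show "\<exists>\<delta>>0. \<forall>y\<in>ball (x \<tau>) \<delta>. c \<bullet> X \<tau> y \<le> norm c * K + e"
      proof (intro exI[of _ 1] conjI ballI)
        fix y assume "y \<in> ball (x \<tau>) 1"
        then have "norm y \<le> norm (x \<tau>) + 1" using norm_triangle_sub[of y "x \<tau>"] by (auto simp: dist_norm norm_minus_commute)
        also have "\<dots> \<le> R + 1" using bnd \<tau> sub by auto
        finally have "norm (X \<tau> y) \<le> K" using K \<tau> sub by blast
        then have "norm c * norm (X \<tau> y) \<le> norm c * K" by (intro mult_left_mono) auto
        then show "c \<bullet> X \<tau> y \<le> norm c * K + e" using norm_cauchy_schwarz[of c "X \<tau> y"] e by linarith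
      qed simp
    qed
    moreover have "c \<bullet> x t - c \<bullet> x s = norm c * norm c"
      by (simp add: c_def inner_diff_right[symmetric] power2_norm_eq_inner[symmetric] power2_eq_square)
    ultimately have "norm c * norm c \<le> norm c * (K * (t - s))" by (simp add: mult.assoc)
    then show ?thesis using st K0 by (cases "c = 0") (auto simp: c_def)
  qed
  show ?thesis using K0
  proof (rule lipschitz_onI[rotated])
    fix s t assume "s \<in> J" "t \<in> J"
    then show "dist (x s) (x t) \<le> K * dist s t"
      using *[of s t] *[of t s] by (cases "s \<le> t") (auto simp: dist_norm norm_minus_commute)
  qed
qed

definition locally_bounded_field :: "(real \<Rightarrow> 'a::euclidean_space \<Rightarrow> 'a) \<Rightarrow> bool" where
  "locally_bounded_field X \<longleftrightarrow> (\<forall>T R. \<exists>K. \<forall>t\<in>{0..T}. \<forall>x\<in>cball 0 R. norm (X t x) \<le> K)"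

text \<open>\<open>filippov_map\<close> freezes the time and ignores null sets, whereas an Euler
  polygon may meet every nearby value of the field, also on a switching surface. All these values
  are required to be close to the Filippov set.\<close>

definition filippov_usc :: "(real \<Rightarrow> 'a::euclidean_space \<Rightarrow> 'a) \<Rightarrow> bool" where
  "filippov_usc X \<longleftrightarrow> (\<forall>t\<ge>0. \<forall>x. \<forall>e>0. \<exists>\<delta>>0. \<forall>t'\<ge>0. \<forall>x'. \<bar>t' - t\<bar> < \<delta> \<longrightarrow> norm (x' - x) < \<delta> \<longrightarrow>
     (\<exists>y\<in>filippov_map X t x. norm (X t' x' - y) \<le> e))"

text \<open>The limit of Euler polygons of a truncated field solves the equation until its norm
  reaches \<open>R + 1\<close>. Up to that time it continues x to a solution, so the a priori bound
  R excludes that the time occurs.\<close>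

lemma filippov_extend:
  fixes X :: "real \<Rightarrow> 'a::euclidean_space \<Rightarrow> 'a"
  assumes lb: "locally_bounded_field X" and usc: "filippov_usc X"
    and sol: "filippov_solution X {0..a} x" and ab: "0 \<le> a" "a < b"
    and apriori: "\<And>T y. 0 \<le> T \<Longrightarrow> T \<le> b \<Longrightarrow> filippov_solution X {0..T} y \<Longrightarrow> y 0 = x 0 \<Longrightarrow> \<forall>t\<in>{0..T}. norm (y t) \<le> R"
  shows "\<exists>y. filippov_solution X {0..b} y \<and> (\<forall>t\<in>{0..a}. y t = x t)"
proof -
  obtain K where K: "\<And>t y. t \<in> {0..b} \<Longrightarrow> norm y \<le> R + 1 \<Longrightarrow> norm (X t y) \<le> K"
    using lb unfolding locally_bounded_field_def by (metis mem_cball_0)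
  have xR: "\<And>t. t \<in> {0..a} \<Longrightarrow> norm (x t) \<le> R" using apriori[of a x] sol ab by auto
  have "norm (0::'a) \<le> R + 1" using order_trans[OF norm_ge_zero xR[of 0]] ab by auto
  then have K0: "K \<ge> 0" using order_trans[OF norm_ge_zero K[of 0 0]] ab by auto
  \<comment> \<open>The truncation makes the field globally bounded, as \<open>euler_limit\<close>
    requires, and does not alter it near points of norm below \<open>R + 1\<close> at times before
    b.\<close>
  define Y where "Y t y = (if norm y \<le> R + 1 \<and> t \<le> b then X t y else 0)" for t y
  have Yb: "norm (Y t y) \<le> K" if "t \<ge> a" for t y using that K K0 ab by (auto simp: Y_def)
  obtain y where y: "y a = x a" "K-lipschitz_on {a..b} y"
    "\<And>t d c \<beta> \<delta>. t \<in> {a<..<b} \<Longrightarrow> (y has_vector_derivative d) (at t) \<Longrightarrow> \<delta> > 0 \<Longrightarrow>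
      (\<And>t' x'. t' \<ge> a \<Longrightarrow> \<bar>t' - t\<bar> < \<delta> \<Longrightarrow> norm (x' - y t) < \<delta> \<Longrightarrow> \<beta> \<le> c \<bullet> Y t' x') \<Longrightarrow> \<beta> \<le> c \<bullet> d"
    using euler_limit[of a b Y K "x a", OF ab(2) Yb] by blast
  obtain N where N: "negligible N" "\<And>t. t \<in> {a<..<b} - N \<Longrightarrow> \<exists>D. (y has_vector_derivative D) (at t)"
    using lipschitz_differentiable_ae[OF less_imp_le[OF ab(2)] y(2)] by blast
  \<comment> \<open>If d were outside the closed convex set, a hyperplane would separate it
    strictly. Nearby field values respect the hyperplane up to \<open>norm c * e\<close>, hence so
    does d, and e is chosen so that this error is at most half of the gap.\<close>
  have inmap: "d \<in> filippov_map X t (y t)" if t: "t \<in> {a<..<b}" "norm (y t) < R + 1" and d: "(y has_vector_derivative d) (at t)" for t d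
  proof (rule ccontr)
    assume "d \<notin> filippov_map X t (y t)"
    then obtain c \<beta> where c: "c \<bullet> d < \<beta>" "\<And>z. z \<in> filippov_map X t (y t) \<Longrightarrow> \<beta> < c \<bullet> z"
      using separating_hyperplane_closed_point[OF filippov_map_closed_convex(2,1)] by metis
    define e where "e = (\<beta> - c \<bullet> d) / (2 * (norm c + 1))"
    have ne: "norm c + 1 > 0" using norm_ge_zero[of c] by linarith
    then have e: "e > 0" using c by (simp add: e_def)
    have "\<exists>\<delta>>0. \<forall>t'\<ge>0. \<forall>x'. \<bar>t' - t\<bar> < \<delta> \<longrightarrow> norm (x' - y t) < \<delta> \<longrightarrow> (\<exists>z\<in>filippov_map X t (y t). norm (X t' x' - z) \<le> e)"
      using usc[unfolded filippov_usc_def, rule_format, of t e "y t"] t ab e by auto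
    then obtain \<delta> where \<delta>: "\<delta> > 0" "\<And>t' x'. t' \<ge> 0 \<Longrightarrow> \<bar>t' - t\<bar> < \<delta> \<Longrightarrow> norm (x' - y t) < \<delta> \<Longrightarrow>
       \<exists>z\<in>filippov_map X t (y t). norm (X t' x' - z) \<le> e" by blast
    define \<delta>' where "\<delta>' = min \<delta> (min (b - t) (R + 1 - norm (y t)))"
    have \<delta>': "\<delta>' > 0" using \<delta> t by (auto simp: \<delta>'_def)
    have "\<beta> - norm c * e \<le> c \<bullet> d"
    proof (rule y(3)[OF t(1) d \<delta>'])
      fix t' x' assume t': "a \<le> t'" "\<bar>t' - t\<bar> < \<delta>'" and x': "norm (x' - y t) < \<delta>'"
      have "norm x' \<le> R + 1" using x' norm_triangle_sub[of x' "y t"] by (auto simp: \<delta>'_def)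
      then have eq: "Y t' x' = X t' x'" using t' by (auto simp: Y_def \<delta>'_def)
      obtain z where z: "z \<in> filippov_map X t (y t)" "norm (X t' x' - z) \<le> e"
        using \<delta>(2)[of t' x'] t' x' ab by (auto simp: \<delta>'_def)
      have "norm c * norm (X t' x' - z) \<le> norm c * e" using z(2) by (intro mult_left_mono) auto
      then have "c \<bullet> (z - X t' x') \<le> norm c * e"
        using norm_cauchy_schwarz[of c "z - X t' x'"] by (simp add: norm_minus_commute)
      then show "\<beta> - norm c * e \<le> c \<bullet> Y t' x'" using c(2)[OF z(1)] by (simp add: eq inner_diff_right)
    qed
    moreover have "norm c * e \<le> (norm c + 1) * e" using e by (intro mult_right_mono) auto
    moreover have "(norm c + 1) * e = (\<beta> - c \<bullet> d) / 2"
    proof -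
      have "n * (r / (2 * n)) = r / 2" if "n > 0" for n r :: real using that by simp
      from this[OF ne] show ?thesis unfolding e_def .
    qed
    ultimately show False using c(1) by simp
  qed
  define z where "z t = (if t \<le> a then x t else y t)" for t
  have zy: "z t = y t" if "t \<ge> a" for t using that y(1) by (cases "t = a") (auto simp: z_def)
  have zx: "z t = x t" if "t \<le> a" for t using that by (simp add: z_def)
  have lipx: "K-lipschitz_on {0..a} x"
    using ab K by (intro filippov_solution_lipschitz[OF sol _ _ xR]) (auto intro: is_interval_cc)
  obtain N' where N': "negligible N'" "\<And>t. t \<in> interior {0..a} - N' \<Longrightarrow> \<exists>d\<in>filippov_map X t (x t). (x has_vector_derivative d) (at t)"
    using filippov_solutionE[OF sol] by blast
  \<comment> \<open>The bound on y is asked only before T, so that T may be the first time at which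
    y reaches radius \<open>R + 1\<close>.\<close>
  have zsol: "filippov_solution X {0..T} z" if T: "a < T" "T \<le> b" and small: "\<And>t. t \<in> {a<..<T} \<Longrightarrow> norm (y t) < R + 1" for T
  proof (rule filippov_solutionI[OF negligible_interval_boundary(1), where N = "N \<union> N' \<union> {a}"])
    have "K-lipschitz_on {a..T} y" using T by (intro lipschitz_on_subset[OF y(2)]) auto
    from lipschitz_on_concat[OF lipx this] have "K-lipschitz_on {0..T} z" using y(1) by (simp add: z_def[abs_def])
    then show "abs_continuous_on c d z" if "c \<le> d" "{c..d} \<subseteq> {0..T}" for c d
      using that lipschitz_on_imp_abs_continuous_on lipschitz_on_subset by blast
    show "negligible (N \<union> N' \<union> {a})" using N N' by (intro negligible_Un) auto
    fix t assume "t \<in> interior {0..T} - (N \<union> N' \<union> {a})"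
    then have t: "0 < t" "t < T" "t \<notin> N" "t \<notin> N'" "t \<noteq> a" by (auto simp: interior_atLeastAtMost_real)
    show "\<exists>d\<in>filippov_map X t (z t). (z has_vector_derivative d) (at t)"
    proof (cases "t < a")
      case True
      then obtain d where d: "d \<in> filippov_map X t (x t)" "(x has_vector_derivative d) (at t)"
        using N'(2)[of t] t by (auto simp: interior_atLeastAtMost_real)
      have "(z has_vector_derivative d) (at t)"
        by (rule has_vector_derivative_transform_within_open[OF d(2), of "{..<a}"]) (use True zx in auto)
      then show ?thesis using d(1) True zx by auto
    next
      case False
      then have ta: "t \<in> {a<..<T}" "t \<in> {a<..<b} - N" using t T by auto
      then obtain d where d: "(y has_vector_derivative d) (at t)" using N(2) by blast
      have "d \<in> filippov_map X t (y t)" using inmap[of t d] ta small d by auto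
      moreover have "(z has_vector_derivative d) (at t)"
        by (rule has_vector_derivative_transform_within_open[OF d, of "{a<..}"]) (use ta zy in auto)
      ultimately show ?thesis using ta zy by (metis greaterThanLessThan_iff less_imp_le)
    qed
  qed
  have ysmall: "norm (y t) < R + 1" if t: "t \<in> {a..b}" for t
  proof (rule ccontr)
    assume big: "\<not> ?thesis"
    define Z where "Z = {s\<in>{a..b}. R + 1 \<le> norm (y s)}"
    have conty: "continuous_on {a..b} y" using lipschitz_on_continuous_on[OF y(2)] .
    have "closed Z" unfolding Z_def
      by (intro continuous_on_closed_Collect_le continuous_intros conty closed_atLeastAtMost)
    moreover have bdd: "bdd_below Z" by (auto simp: Z_def intro: bdd_belowI[of _ a])
    moreover have "Z \<noteq> {}" using big t by (auto simp: Z_def)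
    ultimately have "Inf Z \<in> Z" using closed_contains_Inf by blast
    then have T: "a \<le> Inf Z" "Inf Z \<le> b" "R + 1 \<le> norm (y (Inf Z))" by (auto simp: Z_def)
    have "norm (y a) \<le> R" using xR[of a] ab y(1) by auto
    with T have aT: "a < Inf Z" by (cases "Inf Z = a") auto
    have "norm (y s) < R + 1" if "s \<in> {a<..<Inf Z}" for s
    proof (rule ccontr)
      assume "\<not> ?thesis"
      then have "s \<in> Z" using that T by (auto simp: Z_def)
      then have "Inf Z \<le> s" using bdd by (rule cInf_lower)
      then show False using that by auto
    qed
    from zsol[OF aT T(2) this] have "\<forall>t\<in>{0..Inf Z}. norm (z t) \<le> R"
      using T ab zx[of 0] by (intro apriori) auto
    then have "norm (z (Inf Z)) \<le> R" using aT ab by (auto dest!: bspec[of _ _ "Inf Z"])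
    then have "norm (y (Inf Z)) \<le> R" using aT zy[of "Inf Z"] by simp
    then show False using T by simp
  qed
  have "filippov_solution X {0..b} z" using ysmall ab by (intro zsol) auto
  then show ?thesis using zx by auto
qed

text \<open>Existence iterates \<open>filippov_extend\<close> by unit time steps and glues. A
  solution on \<open>{0..<T}\<close> is bounded, hence Lipschitz, hence extends continuously to T,
  and is continued from there.\<close>

theorem filippov_well_definedI:
  fixes X :: "real \<Rightarrow> 'a::euclidean_space \<Rightarrow> 'a"
  assumes lb: "locally_bounded_field X" and usc: "filippov_usc X"
    and apriori: "\<And>b. \<exists>R. \<forall>T y. 0 \<le> T \<longrightarrow> T \<le> b \<longrightarrow> filippov_solution X {0..T} y \<longrightarrow> y 0 = x0 \<longrightarrow> (\<forall>t\<in>{0..T}. norm (y t) \<le> R)"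
  shows "filippov_well_defined X x0"
proof -
  have step: "\<exists>y. filippov_solution X {0..a + 1} y \<and> (\<forall>t\<in>{0..a}. y t = x t)"
    if "filippov_solution X {0..a} x" "0 \<le> a" "x 0 = x0" for a x
  proof -
    obtain R where "\<And>T y. 0 \<le> T \<Longrightarrow> T \<le> a + 1 \<Longrightarrow> filippov_solution X {0..T} y \<Longrightarrow> y 0 = x0 \<Longrightarrow> \<forall>t\<in>{0..T}. norm (y t) \<le> R"
      using apriori[of "a + 1"] by blast
    then show ?thesis using that by (intro filippov_extend[OF lb usc]) auto
  qed
  have glob: "\<exists>y. filippov_solution X {0..} y \<and> (\<forall>t\<in>{0..a}. y t = x t)"
    if x: "filippov_solution X {0..a} x" "0 \<le> a" "x 0 = x0" for a x
  proof -
    have "\<exists>f. \<forall>n. (filippov_solution X {0..a + real n} (f n) \<and> f n 0 = x0 \<and> (\<forall>t\<in>{0..a}. f n t = x t)) \<and> (\<forall>t\<in>{0..a + real n}. f (Suc n) t = f n t)"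
    proof (rule dependent_nat_choice)
      show "\<exists>y. filippov_solution X {0..a + real 0} y \<and> y 0 = x0 \<and> (\<forall>t\<in>{0..a}. y t = x t)" using x by auto
      fix y n assume y: "filippov_solution X {0..a + real n} y \<and> y 0 = x0 \<and> (\<forall>t\<in>{0..a}. y t = x t)"
      then obtain y' where "filippov_solution X {0..a + real n + 1} y'" "\<forall>t\<in>{0..a + real n}. y' t = y t"
        using step[of "a + real n" y] x by auto
      then show "\<exists>y'. (filippov_solution X {0..a + real (Suc n)} y' \<and> y' 0 = x0 \<and> (\<forall>t\<in>{0..a}. y' t = x t)) \<and> (\<forall>t\<in>{0..a + real n}. y' t = y t)"
        using y x(2) by (intro exI[of _ y']) (auto simp: algebra_simps)
    qed
    then obtain f where f: "\<And>n. filippov_solution X {0..a + real n} (f n)" "\<And>n t. t \<in> {0..a} \<Longrightarrow> f n t = x t"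
      "\<And>n t. t \<in> {0..a + real n} \<Longrightarrow> f (Suc n) t = f n t" by blast
    have fm: "f (n + k) t = f n t" if "t \<in> {0..a + real n}" for n k t
      by (induction k) (use that f(3) in auto)
    define y where "y t = f (nat \<lceil>t\<rceil>) t" for t
    have yf: "y t = f n t" if "t \<in> {0..a + real n}" for t n
    proof -
      have "t \<in> {0..a + real (nat \<lceil>t\<rceil>)}" using that x(2) le_of_int_ceiling[of t] by (auto intro: add_increasing)
      then have "f (nat \<lceil>t\<rceil> + n) t = f (nat \<lceil>t\<rceil>) t" by (rule fm)
      moreover have "f (n + nat \<lceil>t\<rceil>) t = f n t" using that by (rule fm)
      ultimately show ?thesis by (simp add: y_def add.commute)
    qed
    have "\<exists>N. negligible N \<and> (\<forall>t. t \<in> interior {0..a + real n} - N \<longrightarrow> (\<exists>d\<in>filippov_map X t (f n t). (f n has_vector_derivative d) (at t)))" for n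
      using filippov_solutionE[OF f(1)[of n]] by metis
    then obtain N where N: "\<And>n. negligible (N n)" "\<And>n t. t \<in> interior {0..a + real n} - N n \<Longrightarrow> \<exists>d\<in>filippov_map X t (f n t). (f n has_vector_derivative d) (at t)"
      by metis
    have "filippov_solution X {0..} y"
    proof (rule filippov_solutionI[OF negligible_interval_boundary(3), where N = "\<Union>n. N n"])
      show "negligible (\<Union>n. N n)" using N(1) by (intro negligible_countable_Union) auto
      fix c d :: real assume cd: "c \<le> d" "{c..d} \<subseteq> {0..}"
      define n where "n = nat \<lceil>d\<rceil>"
      have n: "{c..d} \<subseteq> {0..a + real n}" using cd x(2) by (auto simp: n_def) linarith
      then have "abs_continuous_on c d (f n)" using filippov_solution_AC[OF f(1)] cd by blast
      then show "abs_continuous_on c d y" using abs_continuous_on_cong[of c d y "f n"] yf n by blast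
    next
      fix t assume t: "t \<in> interior {0..} - (\<Union>n. N n)"
      then have t0: "t > 0" by (auto simp: interior_Ici[of "-1"])
      define n where "n = nat \<lceil>t\<rceil> + 1"
      have tn: "t < a + real n" using t0 x(2) unfolding n_def by linarith
      obtain d where d: "d \<in> filippov_map X t (f n t)" "(f n has_vector_derivative d) (at t)"
        using N(2)[of t n] t t0 tn by (auto simp: interior_atLeastAtMost_real)
      have "(y has_vector_derivative d) (at t)"
        by (rule has_vector_derivative_transform_within_open[OF d(2), of "{0<..<a + real n}"]) (use t0 tn yf[of _ n] in auto)
      then show "\<exists>d\<in>filippov_map X t (y t). (y has_vector_derivative d) (at t)" using d(1) yf[of t n] t0 tn by auto
    qed
    moreover have "\<forall>t\<in>{0..a}. y t = x t" using yf[of _ 0] f(2)[of _ 0] by auto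
    ultimately show ?thesis by blast
  qed
  show ?thesis
    unfolding filippov_well_defined_def
  proof (intro conjI allI impI)
    \<comment> \<open>On an interval without interior points every curve is a solution; this one
      starts the continuation.\<close>
    have "filippov_solution X {0..0} (\<lambda>_. x0)"
      by (rule filippov_solutionI[OF negligible_interval_boundary(1) _ negligible_empty])
        (auto simp: interior_atLeastAtMost_real abs_continuous_on_def)
    from glob[OF this] show "\<exists>x. filippov_solution X {0..} x \<and> x 0 = x0" by fastforce
    fix T :: real and x assume T: "T > 0" and x: "filippov_solution X {0..<T} x \<and> x 0 = x0"
    obtain R where R: "\<And>S y. 0 \<le> S \<Longrightarrow> S \<le> T \<Longrightarrow> filippov_solution X {0..S} y \<Longrightarrow> y 0 = x0 \<Longrightarrow> \<forall>t\<in>{0..S}. norm (y t) \<le> R"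
      using apriori[of T] by blast
    have xR: "norm (x t) \<le> R" if t: "t \<in> {0..<T}" for t
    proof -
      have "filippov_solution X {0..t} x"
        using t by (intro filippov_solution_subset[OF conjunct1[OF x] _ negligible_interval_boundary(1)]) auto
      then show ?thesis using R[of t x] t x by auto
    qed
    obtain K where K: "\<And>t y. t \<in> {0..T} \<Longrightarrow> norm y \<le> R + 1 \<Longrightarrow> norm (X t y) \<le> K"
      using lb unfolding locally_bounded_field_def by (metis mem_cball_0)
    have lip: "K-lipschitz_on {0..<T} x"
      using T K x xR by (intro filippov_solution_lipschitz[of X _ x R]) (auto simp: is_interval_1)
    have cl: "closure {0..<T} = {0..T}" using T by (simp add: closure_atLeastLessThan)
    obtain g where g: "uniformly_continuous_on {0..T} g" "\<And>t. t \<in> {0..<T} \<Longrightarrow> x t = g t"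
      using uniformly_continuous_on_extension_on_closure[OF lipschitz_on_uniformly_continuous[OF lip]] cl by metis
    have "K-lipschitz_on {0..<T} g" using lip g(2) by (metis lipschitz_on_transform)
    then have lipg: "K-lipschitz_on {0..T} g"
      using lipschitz_on_closure[of K "{0..<T}" g] g(1) cl uniformly_continuous_imp_continuous by metis
    obtain N where N: "negligible N" "\<And>t. t \<in> interior {0..<T} - N \<Longrightarrow> \<exists>d\<in>filippov_map X t (x t). (x has_vector_derivative d) (at t)"
      using filippov_solutionE[of X "{0..<T}" x] x by blast
    have "filippov_solution X {0..T} g"
    proof (rule filippov_solutionI[OF negligible_interval_boundary(1) _ N(1)])
      show "abs_continuous_on c d g" if "c \<le> d" "{c..d} \<subseteq> {0..T}" for c d
        using that lipg lipschitz_on_imp_abs_continuous_on lipschitz_on_subset by blast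
      fix t assume "t \<in> interior {0..T} - N"
      then have t: "t \<in> {0<..<T}" "t \<in> interior {0..<T} - N" by (auto simp: interior_atLeastAtMost_real interior_atLeastLessThan)
      then obtain d where d: "d \<in> filippov_map X t (x t)" "(x has_vector_derivative d) (at t)" using N(2) by blast
      have "(g has_vector_derivative d) (at t)"
        by (rule has_vector_derivative_transform_within_open[OF d(2), of "{0<..<T}"]) (use t g in auto)
      then show "\<exists>d\<in>filippov_map X t (g t). (g has_vector_derivative d) (at t)" using d(1) g(2)[of t] t by auto
    qed
    moreover have "g 0 = x0" using g(2)[of 0] x T by auto
    ultimately obtain y where "filippov_solution X {0..} y" "\<forall>t\<in>{0..T}. y t = g t"
      using glob[of T g] T by auto
    then show "\<exists>x'. filippov_solution X {0..} x' \<and> (\<forall>t\<in>{0..<T}. x' t = x t)" using g(2) by (intro exI[of _ y]) auto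
  qed
qed

subsection \<open>Fields with sign discontinuities\<close>

text \<open>The shape of the closed loop: F is the field without its switching terms,
  \<open>h i\<close> is the i-th virtual error, and \<open>B i\<close> is the constant direction in
  which its sign acts.\<close>

locale sign_field =
  fixes X :: "real \<Rightarrow> 'a::euclidean_space \<Rightarrow> 'a" and F :: "real \<Rightarrow> 'a \<Rightarrow> 'a"
    and h :: "'i::finite \<Rightarrow> 'a \<Rightarrow> real" and B :: "'i \<Rightarrow> 'a"
  assumes X: "\<And>t x. t \<ge> 0 \<Longrightarrow> X t x = F t x + (\<Sum>i\<in>UNIV. sgn (h i x) *\<^sub>R B i)"
    and contF: "continuous_on ({0..} \<times> UNIV) (\<lambda>(t, x). F t x)"
    and conth: "\<And>i. continuous_on UNIV (h i)"
begin

lemma contF1: "t \<ge> 0 \<Longrightarrow> isCont (F t) x"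
proof -
  assume t: "t \<ge> 0"
  have "continuous_on UNIV (\<lambda>x. (\<lambda>(t, x). F t x) (t, x))"
    by (rule continuous_on_compose2[OF contF]) (use t in \<open>auto intro!: continuous_intros\<close>)
  then show ?thesis by (simp add: continuous_on_eq_continuous_within)
qed

lemma h_sgn_eventually: "\<forall>\<^sub>F x' in nhds x. \<forall>i. h i x \<noteq> 0 \<longrightarrow> sgn (h i x') = sgn (h i x)"
proof (rule eventually_all_finite, goal_cases)
  case (1 i)
  have lim: "(h i \<longlongrightarrow> h i x) (nhds x)"
    using conth[of i] by (simp add: continuous_on_eq_continuous_within isCont_def tendsto_at_iff_tendsto_nhds)
  consider "h i x = 0" | "h i x > 0" | "h i x < 0" by linarith
  then show ?case
  proof cases
    case 2 then show ?thesis using order_tendstoD(1)[OF lim 2] by (auto elim: eventually_mono)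
  next
    case 3 then show ?thesis using order_tendstoD(2)[OF lim 3] by (auto elim: eventually_mono)
  qed auto
qed

text \<open>Signs of nonzero \<open>h i\<close> are locally constant, and those of vanishing
  \<open>h i\<close> are multiplied by zero. So \<open>y \<mapsto> \<phi>' (x t) (X t y)\<close> is
  continuous at \<open>x t\<close>, and the inequality at that one point spreads to a neighbourhood
  with arbitrarily small loss.\<close>

lemma filippov_sign_increment_le:
  assumes sol: "filippov_solution X J x" and ab: "a \<le> b" "{a..b} \<subseteq> J" "0 \<le> a" and \<phi>: "C1 \<phi> \<phi>'"
    and le: "\<And>t. t \<in> {a..b} \<Longrightarrow> \<phi>' (x t) (X t (x t)) \<le> c"
    and zero: "\<And>t i. t \<in> {a..b} \<Longrightarrow> h i (x t) = 0 \<Longrightarrow> \<phi>' (x t) (B i) = 0"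
  shows "\<phi> (x b) - \<phi> (x a) \<le> c * (b - a)"
proof (rule filippov_solution_increment_le[OF sol ab(1,2) \<phi>])
  fix t e :: real assume t: "t \<in> {a..b}" and e: "e > 0"
  then have t0: "t \<ge> 0" using ab by auto
  have lin: "linear (\<phi>' (x t))" by (rule C1_D(3)[OF \<phi>])
  then have bl: "bounded_linear (\<phi>' (x t))" by (simp add: linear_linear)
  have eq: "\<phi>' (x t) (X t y) = \<phi>' (x t) (F t y) + (\<Sum>i\<in>UNIV. sgn (h i y) * \<phi>' (x t) (B i))" for y
    by (simp add: X[OF t0] linear_add[OF lin] linear_sum[OF lin] linear_scale[OF lin])
  have "((\<lambda>y. \<phi>' (x t) (F t y)) \<longlongrightarrow> \<phi>' (x t) (F t (x t))) (nhds (x t))"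
    using contF1[OF t0, of "x t"] by (intro bounded_linear.tendsto[OF bl]) (simp add: isCont_def tendsto_at_iff_tendsto_nhds)
  then have "\<forall>\<^sub>F y in nhds (x t). dist (\<phi>' (x t) (F t y)) (\<phi>' (x t) (F t (x t))) < e" using e by (rule tendstoD)
  moreover note h_sgn_eventually[of "x t"]
  ultimately have "\<forall>\<^sub>F y in nhds (x t). \<phi>' (x t) (X t y) \<le> c + e"
  proof eventually_elim
    case (elim y)
    have "(\<Sum>i\<in>UNIV. sgn (h i y) * \<phi>' (x t) (B i)) = (\<Sum>i\<in>UNIV. sgn (h i (x t)) * \<phi>' (x t) (B i))"
      by (intro sum.cong refl) (use elim(2) zero[OF t] in \<open>metis mult_zero_right\<close>)
    then show ?case using elim(1) le[OF t] by (simp add: eq dist_real_def)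
  qed
  then show "\<exists>\<delta>>0. \<forall>y\<in>ball (x t) \<delta>. \<phi>' (x t) (X t y) \<le> c + e"
    by (auto simp: eventually_nhds_metric dist_commute)
qed

lemma locally_bounded: "locally_bounded_field X"
  unfolding locally_bounded_field_def
proof (intro allI)
  fix T R :: real
  have "compact ((\<lambda>(t, x). F t x) ` ({0..T} \<times> cball 0 R))"
    by (intro compact_continuous_image continuous_on_subset[OF contF] compact_Times) auto
  then obtain K where K: "\<And>y. y \<in> (\<lambda>(t, x). F t x) ` ({0..T} \<times> cball 0 R) \<Longrightarrow> norm y \<le> K"
    using compact_imp_bounded bounded_iff by metis
  have "norm (X t x) \<le> K + (\<Sum>i\<in>UNIV. norm (B i))" if "t \<in> {0..T}" "x \<in> cball 0 R" for t x
  proof -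
    have "norm (X t x) \<le> norm (F t x) + norm (\<Sum>i\<in>UNIV. sgn (h i x) *\<^sub>R B i)"
      using that by (simp add: X norm_triangle_ineq)
    also have "norm (F t x) \<le> K" using that by (intro K) auto
    also have "norm (\<Sum>i\<in>UNIV. sgn (h i x) *\<^sub>R B i) \<le> (\<Sum>i\<in>UNIV. norm (B i))"
      by (intro sum_norm_le) (auto simp: sgn_if)
    finally show ?thesis by simp
  qed
  then show "\<exists>K. \<forall>t\<in>{0..T}. \<forall>x\<in>cball 0 R. norm (X t x) \<le> K" by blast
qed

text \<open>A pattern without zeros is an open condition. If it occurs arbitrarily near x it occurs
  on a nonempty open set, which no null set exhausts.\<close>

lemma sign_vertex_in_filippov_map:
  assumes t: "t \<ge> 0" and rich: "\<And>\<delta>. \<delta> > 0 \<Longrightarrow> \<exists>x'\<in>ball x \<delta>. \<forall>i. sgn (h i x') = \<sigma> i" and \<sigma>: "\<And>i. \<sigma> i \<in> {-1, 1}"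
  shows "F t x + (\<Sum>i\<in>UNIV. \<sigma> i *\<^sub>R B i) \<in> filippov_map X t x"
  unfolding filippov_map_def
proof (intro INT_I)
  fix \<delta> :: real and N :: "'a set" assume \<delta>: "\<delta> \<in> {0<..}" and "N \<in> {N. negligible N}"
  then have N: "negligible N" by simp
  have "F t x + (\<Sum>i\<in>UNIV. \<sigma> i *\<^sub>R B i) \<in> closure (X t ` (ball x \<delta> - N))"
    unfolding closure_approachable
  proof (intro allI impI)
    fix e :: real assume "e > 0"
    then obtain \<delta>1 where \<delta>1: "\<delta>1 > 0" "\<And>x'. dist x' x < \<delta>1 \<Longrightarrow> dist (F t x') (F t x) < e"
      using contF1[OF t, of x] by (auto simp: continuous_at_eps_delta)
    define U where "U = ball x (min \<delta> \<delta>1) \<inter> (\<Inter>i. {x'. 0 < \<sigma> i * h i x'})"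
    have "open U" unfolding U_def
      by (intro open_Int open_INT ballI open_Collect_less continuous_intros conth open_ball finite)
    moreover have "U \<noteq> {}"
    proof -
      obtain x' where x': "x' \<in> ball x (min \<delta> \<delta>1)" "\<And>i. sgn (h i x') = \<sigma> i"
        using rich[of "min \<delta> \<delta>1"] \<delta> \<delta>1 by auto
      have "0 < \<sigma> i * h i x'" for i
      proof -
        have "\<sigma> i * h i x' = \<bar>h i x'\<bar>" by (simp add: x'(2)[symmetric] abs_sgn mult.commute)
        moreover have "h i x' \<noteq> 0" using x'(2)[of i] \<sigma>[of i] by auto
        ultimately show ?thesis by simp
      qed
      then show ?thesis using x'(1) unfolding U_def by blast
    qed
    ultimately have "\<not> U \<subseteq> N" using N open_not_negligible negligible_subset by blast
    then obtain x2 where x2: "x2 \<in> U" "x2 \<notin> N" by blast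
    have "sgn (h i x2) = \<sigma> i" for i
    proof -
      have "0 < \<sigma> i * h i x2" using x2(1) unfolding U_def by blast
      then show ?thesis using \<sigma>[of i] by (auto simp: sgn_if zero_less_mult_iff)
    qed
    then have "X t x2 = F t x2 + (\<Sum>i\<in>UNIV. \<sigma> i *\<^sub>R B i)" by (simp add: X[OF t])
    then have "dist (X t x2) (F t x + (\<Sum>i\<in>UNIV. \<sigma> i *\<^sub>R B i)) < e"
      using \<delta>1(2)[of x2] x2(1) by (auto simp: U_def dist_commute)
    moreover have "x2 \<in> ball x \<delta> - N" using x2 by (auto simp: U_def)
    ultimately show "\<exists>y\<in>X t ` (ball x \<delta> - N). dist y (F t x + (\<Sum>i\<in>UNIV. \<sigma> i *\<^sub>R B i)) < e" by blast
  qed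
  then show "F t x + (\<Sum>i\<in>UNIV. \<sigma> i *\<^sub>R B i) \<in> closure (convex hull (X t ` (ball x \<delta> - N)))"
    using closure_mono[OF hull_subset] by blast
qed

text \<open>A box is the convex hull of its vertices. The induction is on the set of coordinates
  allowed strictly inside [-1, 1]; one such coordinate is a convex combination of its two end
  values.\<close>

lemma sign_box_in_filippov_map:
  assumes t: "t \<ge> 0"
    and rich: "\<And>\<delta> \<sigma>. \<delta> > 0 \<Longrightarrow> (\<And>i. \<sigma> i \<in> {-1, 1}) \<Longrightarrow> (\<And>i. h i x \<noteq> 0 \<Longrightarrow> \<sigma> i = sgn (h i x)) \<Longrightarrow> \<exists>x'\<in>ball x \<delta>. \<forall>i. sgn (h i x') = \<sigma> i"
    and s: "\<And>i. s i \<in> {-1..1}" "\<And>i. h i x \<noteq> 0 \<Longrightarrow> s i = sgn (h i x)"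
  shows "F t x + (\<Sum>i\<in>UNIV. s i *\<^sub>R B i) \<in> filippov_map X t x"
proof -
  have "\<forall>s. (\<forall>i\<in>I. s i \<in> {-1..1}) \<longrightarrow> (\<forall>i. i \<notin> I \<longrightarrow> s i \<in> {-1, 1}) \<longrightarrow> (\<forall>i. h i x \<noteq> 0 \<longrightarrow> s i = sgn (h i x)) \<longrightarrow>
     F t x + (\<Sum>i\<in>UNIV. s i *\<^sub>R B i) \<in> filippov_map X t x" if "finite I" for I
    using that
  proof (induction I)
    case empty
    then show ?case using sign_vertex_in_filippov_map[OF t] rich by auto
  next
    case (insert j I)
    show ?case
    proof (intro allI impI)
      fix s assume s: "\<forall>i\<in>insert j I. s i \<in> {-1..1::real}" "\<forall>i. i \<notin> insert j I \<longrightarrow> s i \<in> {-1, 1}" "\<forall>i. h i x \<noteq> 0 \<longrightarrow> s i = sgn (h i x)"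
      show "F t x + (\<Sum>i\<in>UNIV. s i *\<^sub>R B i) \<in> filippov_map X t x"
      proof (cases "h j x = 0")
        case False
        then have "s j \<in> {-1, 1}" using s(3) by (auto simp: sgn_if)
        then show ?thesis using insert.IH s by (metis insert_iff)
      next
        case True
        define P where "P c = F t x + (\<Sum>i\<in>UNIV. (s(j := c)) i *\<^sub>R B i)" for c
        have P: "P c \<in> filippov_map X t x" if "c \<in> {-1, 1}" for c
          unfolding P_def by (rule insert.IH[rule_format]) (use s insert.hyps(2) True that in \<open>auto split: if_splits\<close>)
        define u where "u = (1 + s j) / 2"
        have u: "0 \<le> u" "0 \<le> 1 - u" using s(1) by (auto simp: u_def)
        have "s i = u * (s(j := 1)) i + (1 - u) * (s(j := - 1)) i" for i by (auto simp: u_def field_simps)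
        then have "(\<Sum>i\<in>UNIV. s i *\<^sub>R B i) = (\<Sum>i\<in>UNIV. u *\<^sub>R ((s(j := 1)) i *\<^sub>R B i) + (1 - u) *\<^sub>R ((s(j := - 1)) i *\<^sub>R B i))"
          by (metis (no_types, lifting) scaleR_add_left scaleR_scaleR)
        then have "F t x + (\<Sum>i\<in>UNIV. s i *\<^sub>R B i) = u *\<^sub>R P 1 + (1 - u) *\<^sub>R P (-1)"
          by (simp add: P_def sum.distrib scaleR_sum_right scaleR_add_right) (simp add: algebra_simps)
        also have "\<dots> \<in> filippov_map X t x"
          using convexD[OF filippov_map_closed_convex(2) P[of 1] P[of "-1"] u] by simp
        finally show ?thesis .
      qed
    qed
  qed
  from this[OF finite] s show ?thesis by blast
qed

text \<open>Near x the signs at x' agree with the nonzero signs at x and otherwise lie in [-1, 1],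
  the value 0 included, so they form a point of the box at x. Only the continuous part F has
  moved.\<close>

lemma filippov_uscI:
  assumes rich: "\<And>x \<delta> \<sigma>. \<delta> > 0 \<Longrightarrow> (\<And>i. \<sigma> i \<in> {-1, 1}) \<Longrightarrow> (\<And>i. h i x \<noteq> 0 \<Longrightarrow> \<sigma> i = sgn (h i x)) \<Longrightarrow> \<exists>x'\<in>ball x \<delta>. \<forall>i. sgn (h i x') = \<sigma> i"
  shows "filippov_usc X"
  unfolding filippov_usc_def
proof (intro allI impI)
  fix t e :: real and x assume t: "0 \<le> t" and e: "0 < e"
  have "\<exists>d>0. \<forall>p\<in>{0..} \<times> UNIV. dist p (t, x) < d \<longrightarrow> dist ((\<lambda>(t, x). F t x) p) ((\<lambda>(t, x). F t x) (t, x)) < e"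
    using contF[unfolded continuous_on_iff, rule_format, of "(t, x)" e] t e by auto
  then obtain d where d: "d > 0" "\<And>t' x'. t' \<ge> 0 \<Longrightarrow> dist (t', x') (t, x) < d \<Longrightarrow> dist (F t' x') (F t x) < e" by auto
  obtain d2 where d2: "d2 > 0" "\<And>x' i. dist x' x < d2 \<Longrightarrow> h i x \<noteq> 0 \<Longrightarrow> sgn (h i x') = sgn (h i x)"
    using h_sgn_eventually[of x] unfolding eventually_nhds_metric by blast
  show "\<exists>\<delta>>0. \<forall>t'\<ge>0. \<forall>x'. \<bar>t' - t\<bar> < \<delta> \<longrightarrow> norm (x' - x) < \<delta> \<longrightarrow> (\<exists>y\<in>filippov_map X t x. norm (X t' x' - y) \<le> e)"
  proof (intro exI[of _ "min (d / 2) d2"] conjI allI impI)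
    show "min (d / 2) d2 > 0" using d d2 by simp
    fix t' x' assume t': "0 \<le> t'" "\<bar>t' - t\<bar> < min (d / 2) d2" and x': "norm (x' - x) < min (d / 2) d2"
    have "dist (t', x') (t, x) \<le> dist t' t + dist x' x"
      unfolding dist_Pair_Pair by (rule sqrt_sum_squares_le_sum) auto
    also have "\<dots> < d" using t' x' by (simp add: dist_norm)
    finally have "norm (F t' x' - F t x) < e" using d(2) t' by (simp add: dist_norm)
    moreover have "F t x + (\<Sum>i\<in>UNIV. sgn (h i x') *\<^sub>R B i) \<in> filippov_map X t x"
      using d2(2)[of x'] x' by (intro sign_box_in_filippov_map[OF t rich]) (auto simp: dist_norm sgn_if)
    ultimately show "\<exists>y\<in>filippov_map X t x. norm (X t' x' - y) \<le> e"
      using t' by (intro bexI[of _ "F t x + (\<Sum>i\<in>UNIV. sgn (h i x') *\<^sub>R B i)"]) (auto simp: X)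
  qed
qed

end

subsection \<open>Smooth functions above locally bounded requirements\<close>

text \<open>The factor a and the summand b make the class closed under differentiation in a
  direction h: the derivative replaces a by \<open>a * h\<close>, b by 0 and c by
  \<open>diffs c\<close>.\<close>

lemma Ck_on_powser:
  fixes c :: "nat \<Rightarrow> real"
  assumes "\<And>x. summable (\<lambda>n. c n * x ^ n)"
  shows "Ck_on k UNIV (\<lambda>x. a * (\<Sum>n. c n * x ^ n) + b)"
  using assms
proof (induction k arbitrary: c a b)
  case 0
  have "DERIV (\<lambda>x. a * (\<Sum>n. c n * x ^ n) + b) x :> a * (\<Sum>n. diffs c n * x ^ n)" for x
    by (auto intro!: derivative_eq_intros termdiffs_strong_converges_everywhere 0)
  then show ?case by (auto intro!: continuous_at_imp_continuous_on DERIV_isCont)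
next
  case (Suc k)
  have D: "DERIV (\<lambda>x. a * (\<Sum>n. c n * x ^ n) + b) x :> a * (\<Sum>n. diffs c n * x ^ n)" for x
    by (auto intro!: derivative_eq_intros termdiffs_strong_converges_everywhere Suc.prems)
  have fd: "frechet_derivative (\<lambda>x. a * (\<Sum>n. c n * x ^ n) + b) (at x) h = (a * h) * (\<Sum>n. diffs c n * x ^ n) + 0" for x h
  proof -
    have "((\<lambda>x. a * (\<Sum>n. c n * x ^ n) + b) has_derivative (*) (a * (\<Sum>n. diffs c n * x ^ n))) (at x)"
      using D by (simp add: has_field_derivative_def)
    from fun_cong[OF frechet_derivative_at[OF this], of h] show ?thesis by (simp add: algebra_simps)
  qed
  have "summable (\<lambda>n. diffs c n * x ^ n)" for x by (rule termdiff_converges_all) (rule Suc.prems)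
  then have "Ck_on k UNIV (\<lambda>x. (a * h) * (\<Sum>n. diffs c n * x ^ n) + 0)" for h by (rule Suc.IH)
  moreover have "(\<lambda>x. a * (\<Sum>n. c n * x ^ n) + b) differentiable_on UNIV"
    using D by (auto simp: differentiable_on_def real_differentiable_def field_differentiable_def intro: field_differentiable_imp_differentiable)
  ultimately show ?case unfolding Ck_on.simps fd by blast
qed

text \<open>The series \<open>\<Sum>j. b (j + 1) (s / (j + 1)) ^ (2 m j)\<close> exceeds \<open>b (j + 1)\<close> for \<open>\<bar>s\<bar> \<ge> j + 1\<close>,
  and it converges everywhere when \<open>m\<close> grows fast enough.\<close>

lemma smooth_dominating:
  fixes A :: "real \<Rightarrow> real set"
  assumes A: "\<And>R. \<exists>b. \<forall>s y. \<bar>s\<bar> \<le> R \<longrightarrow> y \<in> A s \<longrightarrow> y \<le> b"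
  obtains \<rho> where "smooth_on UNIV \<rho>" "\<And>s. 1 \<le> \<rho> s" "\<And>s y. y \<in> A s \<Longrightarrow> y \<le> \<rho> s"
proof -
  have "\<forall>j. \<exists>b\<ge>0. \<forall>s y. \<bar>s\<bar> \<le> real j + 1 \<longrightarrow> y \<in> A s \<longrightarrow> y \<le> b"
  proof
    fix j :: nat
    obtain b where "\<forall>s y. \<bar>s\<bar> \<le> real j + 1 \<longrightarrow> y \<in> A s \<longrightarrow> y \<le> b" using A by blast
    then show "\<exists>b\<ge>0. \<forall>s y. \<bar>s\<bar> \<le> real j + 1 \<longrightarrow> y \<in> A s \<longrightarrow> y \<le> b" by (intro exI[of _ "max b 0"]) force
  qed
  then obtain b where b: "\<And>j. b j \<ge> 0" "\<And>j s y. \<bar>s\<bar> \<le> real j + 1 \<Longrightarrow> y \<in> A s \<Longrightarrow> y \<le> b j" by metis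
  \<comment> \<open>As \<open>b (Suc j) \<le> m j \<le> 2 ^ m j\<close>, half of the exponent
    \<open>2 * m j\<close> absorbs the coefficient and the other half gives geometric decay.
    Summation makes the exponents distinct, so the series is a power series; evenness makes its
    terms nonnegative.\<close>
  define m where "m j = (\<Sum>i\<le>j. nat \<lceil>b (Suc i)\<rceil> + i + 1)" for j
  have m_Suc: "m (Suc j) = m j + (nat \<lceil>b (Suc (Suc j))\<rceil> + Suc j + 1)" for j by (simp add: m_def)
  have msm: "strict_mono (\<lambda>j. 2 * m j)" by (rule strict_monoI_Suc) (simp add: m_Suc)
  have mb: "real (m j) \<ge> b (Suc j)" "m j \<ge> j" for j
  proof -
    have "nat \<lceil>b (Suc j)\<rceil> + j + 1 \<le> m j" unfolding m_def by (rule member_le_sum) auto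
    then show "real (m j) \<ge> b (Suc j)" "m j \<ge> j" by linarith+
  qed
  define trm where "trm s j = b (Suc j) * (s / real (Suc j)) ^ (2 * m j)" for s j
  define c where "c n = (if n \<in> range (\<lambda>j. 2 * m j) then (let j = inv_into UNIV (\<lambda>j. 2 * m j) n in b (Suc j) / real (Suc j) ^ n) else 0)" for n
  have cm: "c (2 * m j) * s ^ (2 * m j) = trm s j" for s j
  proof -
    have "inv_into UNIV (\<lambda>j. 2 * m j) (2 * m j) = j" by (rule inv_f_f[OF strict_mono_imp_inj_on[OF msm]])
    then show ?thesis by (simp add: c_def trm_def Let_def power_divide)
  qed
  have c0: "c n * s ^ n = 0" if "n \<notin> range (\<lambda>j. 2 * m j)" for n s using that by (simp add: c_def)
  have trm_nonneg: "trm s j \<ge> 0" for s j by (simp add: trm_def b power_even_eq)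
  have summ: "summable (trm s)" for s
  proof (rule summable_comparison_test_ev)
    show "summable (\<lambda>j. (1 / 2 :: real) ^ j)" by (intro summable_geometric) simp
    show "\<forall>\<^sub>F j in sequentially. norm (trm s j) \<le> (1 / 2) ^ j"
      unfolding eventually_sequentially
    proof (intro exI[of _ "nat \<lceil>2 * \<bar>s\<bar>\<rceil>"] allI impI)
      fix j assume "nat \<lceil>2 * \<bar>s\<bar>\<rceil> \<le> j"
      then have "2 * \<bar>s\<bar> \<le> real (Suc j)" by linarith
      then have "\<bar>s / real (Suc j)\<bar> \<le> 1 / 2" by (simp add: field_simps)
      then have "\<bar>s / real (Suc j)\<bar> ^ (2 * m j) \<le> (1 / 2) ^ (2 * m j)" by (intro power_mono) auto
      then have "norm (trm s j) \<le> b (Suc j) * (1 / 2) ^ (2 * m j)"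
        unfolding trm_def by (simp add: abs_mult power_abs b mult_left_mono)
      also have "\<dots> \<le> 2 ^ m j * (1 / 2) ^ (2 * m j)"
      proof (intro mult_right_mono)
        have "b (Suc j) \<le> real (m j)" by (rule mb)
        also have "\<dots> \<le> 2 ^ m j" using of_nat_less_two_power[of "m j", where 'a = real] by simp
        finally show "b (Suc j) \<le> 2 ^ m j" .
      qed simp
      also have "\<dots> = (1 / 2) ^ m j" by (simp add: mult_2 power_add power_one_over)
      also have "\<dots> \<le> (1 / 2) ^ j" using mb(2) by (intro power_decreasing) auto
      finally show "norm (trm s j) \<le> (1 / 2) ^ j" .
    qed
  qed
  have summc: "summable (\<lambda>n. c n * s ^ n)" for s
    using summ[of s] summable_mono_reindex[OF msm, of "\<lambda>n. c n * s ^ n"] c0 by (simp add: cm)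
  have sumeq: "(\<Sum>n. c n * s ^ n) = (\<Sum>j. trm s j)" for s
    using suminf_mono_reindex[OF msm, of "\<lambda>n. c n * s ^ n"] c0 by (simp add: cm)
  define \<rho> where "\<rho> s = 1 * (\<Sum>n. c n * s ^ n) + (b 0 + 1)" for s
  have \<rho>: "\<rho> s = (\<Sum>j. trm s j) + b 0 + 1" for s by (simp add: \<rho>_def sumeq)
  have pos: "(\<Sum>j. trm s j) \<ge> 0" for s using summ trm_nonneg by (intro suminf_nonneg)
  show ?thesis
  proof (rule that)
    show "smooth_on UNIV \<rho>" unfolding smooth_on_def \<rho>_def[abs_def] using Ck_on_powser[OF summc] by blast
    show "1 \<le> \<rho> s" for s using pos[of s] b(1)[of 0] by (simp add: \<rho>)
    fix s y assume y: "y \<in> A s"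
    \<comment> \<open>\<open>b j\<close> bounds the requirement for
      \<open>\<bar>s\<bar> \<le> j + 1\<close>, and the term with index j - 1 already exceeds
      \<open>b j\<close> because \<open>\<bar>s\<bar> \<ge> j\<close>.\<close>
    define j where "j = nat \<lfloor>\<bar>s\<bar>\<rfloor>"
    have j: "real j \<le> \<bar>s\<bar>" "\<bar>s\<bar> \<le> real j + 1" unfolding j_def by linarith+
    have yb: "y \<le> b j" using b(2)[OF j(2) y] .
    show "y \<le> \<rho> s"
    proof (cases j)
      case 0 then show ?thesis using yb pos[of s] by (simp add: \<rho>)
    next
      case (Suc k)
      have "1 \<le> \<bar>s / real (Suc k)\<bar>" using j(1) Suc by (simp add: field_simps)
      then have "1 \<le> \<bar>s / real (Suc k)\<bar> ^ (2 * m k)" by (rule one_le_power)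
      then have "1 \<le> (s / real (Suc k)) ^ (2 * m k)" by (metis abs_power2 power2_abs power_mult)
      then have "b (Suc k) * 1 \<le> trm s k" unfolding trm_def by (intro mult_left_mono b)
      also have "\<dots> \<le> (\<Sum>j. trm s j)" using sum_le_suminf[OF summ, of "{k}" s] trm_nonneg by simp
      finally show ?thesis using yb Suc b(1)[of 0] by (simp add: \<rho>)
    qed
  qed
qed

lemma smooth_on_real_continuous:
  assumes "smooth_on UNIV (f :: 'a::real_normed_vector \<Rightarrow> 'b::real_normed_vector)"
  shows "continuous_on UNIV f"
  using assms by (metis smooth_on_def Ck_on.simps(1))

lemma C1_antiderivative:
  fixes \<rho> :: "real \<Rightarrow> real"
  assumes cont: "continuous_on UNIV \<rho>"
  obtains \<theta> where "C1 \<theta> (\<lambda>s h. h * \<rho> s)" "\<theta> 0 = 0"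
proof -
  define \<theta> where "\<theta> u = (LBINT y=0..u. \<rho> y)" for u :: real
  have D: "(\<theta> has_vector_derivative \<rho> s) (at s)" for s
  proof -
    let ?a = "- \<bar>s\<bar> - 1" and ?b = "\<bar>s\<bar> + 1"
    have "((\<lambda>u. LBINT y=0..u. \<rho> y) has_vector_derivative \<rho> s) (at s within {?a..?b})"
      using interval_integral_FTC2[of ?a 0 ?b \<rho> s] continuous_on_subset[OF cont] by (auto simp: zero_ereal_def)
    moreover have "at s within {?a..?b} = at s" by (rule at_within_interior) (auto simp: interior_atLeastAtMost_real)
    ultimately show ?thesis by (simp add: \<theta>_def[abs_def])
  qed
  show ?thesis
  proof (rule that)
    show "C1 \<theta> (\<lambda>s h. h * \<rho> s)"
      unfolding C1_def using D by (auto simp: has_vector_derivative_def intro!: continuous_intros cont)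
    show "\<theta> 0 = 0" by (simp add: \<theta>_def zero_ereal_def[symmetric])
  qed
qed

subsection \<open>Explicitly sized matrices acting on truncated vectors\<close>

lemma coord_pos_less: "coord_pos (k :: 'k::{finite,linorder}) < CARD('k)"
  unfolding coord_pos_def by (rule psubset_card_mono) auto

lemma coord_pos_strict: "i < j \<Longrightarrow> coord_pos i < coord_pos (j :: 'k::{finite,linorder})"
  unfolding coord_pos_def by (rule psubset_card_mono) auto

lemma coord_pos_inj: "inj (coord_pos :: 'k::{finite,linorder} \<Rightarrow> nat)"
proof (rule injI)
  fix i j :: 'k assume "coord_pos i = coord_pos j"
  then show "i = j" using coord_pos_strict[of i j] coord_pos_strict[of j i] by (cases i j rule: linorder_cases) auto
qed

lemma coord_pos_range: "range (coord_pos :: 'k::{finite,linorder} \<Rightarrow> nat) = {..<CARD('k)}"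
  using coord_pos_less by (intro card_subset_eq) (auto simp: card_image[OF coord_pos_inj])

lemma coord_pos_bij_betw:
  assumes "n \<le> CARD('k::{finite,linorder})"
  shows "bij_betw (coord_pos :: 'k \<Rightarrow> nat) {k. coord_pos k < n} {..<n}"
proof (rule bij_betw_imageI)
  show "inj_on coord_pos {k::'k. coord_pos k < n}" using coord_pos_inj by (rule inj_on_subset) simp
  show "coord_pos ` {k::'k. coord_pos k < n} = {..<n}"
  proof (intro equalityI subsetI)
    fix a assume "a \<in> {..<n}"
    then have "a \<in> range (coord_pos :: 'k \<Rightarrow> nat)" using assms coord_pos_range by auto
    then show "a \<in> coord_pos ` {k::'k. coord_pos k < n}" using \<open>a \<in> {..<n}\<close> by auto
  qed auto
qed

lemma sum_coord_pos:
  assumes "n \<le> CARD('k::{finite,linorder})"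
  shows "(\<Sum>k | coord_pos (k :: 'k) < n. f (coord_pos k)) = (\<Sum>a<n. f a)"
  using sum.reindex_bij_betw[OF coord_pos_bij_betw[OF assms], of f] .

lemma mat_app_nth:
  "(mat_app B x :: real^'a::{finite,linorder}) $ k =
     (if coord_pos k < dim_row B then \<Sum>j | coord_pos j < dim_col B. B $$ (coord_pos k, coord_pos j) * x $ j else 0)"
  by (simp add: mat_app_def)

lemma linear_mat_app: "linear (mat_app B :: real^'b::{finite,linorder} \<Rightarrow> real^'a::{finite,linorder})"
  by (rule linearI) (auto simp: Finite_Cartesian_Product.vec_eq_iff mat_app_nth sum.distrib sum_distrib_left algebra_simps)

lemma linear_row_app: "linear (row_app B)"
  unfolding row_app_def[abs_def] by (rule linearI) (simp_all add: linear_add[OF linear_mat_app] linear_scale[OF linear_mat_app])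

lemma linear_col_app: "linear (col_app B :: real \<Rightarrow> real^'a::{finite,linorder})"
proof -
  have "linear (\<lambda>u. (\<chi> _. u) :: real^1)" by (rule linearI) (simp_all add: Finite_Cartesian_Product.vec_eq_iff)
  from linear_compose[OF this linear_mat_app[of B]] show ?thesis by (simp add: comp_def col_app_def[abs_def])
qed

lemma linear_coord_proj: "linear (coord_proj n)"
  by (rule linearI) (auto simp: Finite_Cartesian_Product.vec_eq_iff coord_proj_def)

lemma coord_proj_in_coord_space: "coord_proj n x \<in> coord_space n"
  by (auto simp: coord_proj_def coord_space_def)

lemma coord_proj_ident: "x \<in> coord_space n \<Longrightarrow> coord_proj n x = x"
  by (auto simp: coord_proj_def coord_space_def Finite_Cartesian_Product.vec_eq_iff)

lemma coord_space_add: "x \<in> coord_space n \<Longrightarrow> y \<in> coord_space n \<Longrightarrow> x + y \<in> coord_space n"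
  by (auto simp: coord_space_def)

lemma coord_space_diff: "x \<in> coord_space n \<Longrightarrow> y \<in> coord_space n \<Longrightarrow> x - y \<in> coord_space n"
  by (auto simp: coord_space_def)

lemma coord_space_scaleR: "x \<in> coord_space n \<Longrightarrow> c *\<^sub>R x \<in> coord_space n"
  by (auto simp: coord_space_def)

lemma mat_app_in_coord_space: "dim_row B = n \<Longrightarrow> mat_app B x \<in> coord_space n"
  by (auto simp: mat_app_nth coord_space_def)

lemma col_app_in_coord_space: "dim_row B = n \<Longrightarrow> col_app B u \<in> coord_space n"
  by (simp add: col_app_def mat_app_in_coord_space)

lemma mat_app_coord_proj: "dim_col B = n \<Longrightarrow> mat_app B (coord_proj n x) = mat_app B x"
  by (auto simp: Finite_Cartesian_Product.vec_eq_iff mat_app_nth coord_proj_def intro!: sum.cong)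

lemma coord_pos_one: "coord_pos (k::1) = 0"
proof -
  have "{j. j < k} = {}" by (metis (mono_tags) Collect_empty_eq less_irrefl num1_eq1)
  then show ?thesis by (simp add: coord_pos_def)
qed

lemma row_app_eq:
  assumes "dim_row B = 1"
  shows "row_app B x = (\<Sum>j | coord_pos j < dim_col B. B $$ (0, coord_pos j) * x $ j)"
  using assms by (simp add: row_app_def mat_app_nth coord_pos_one)

lemma row_app_coord_proj: "dim_col B = n \<Longrightarrow> row_app B (coord_proj n x) = row_app B x"
  by (simp add: row_app_def mat_app_coord_proj)

text \<open>The intermediate dimension c must fit into 'b; otherwise the inner application would cut
  off summands.\<close>

lemma mat_app_mult:
  assumes A: "A \<in> carrier_mat r c" and B: "B \<in> carrier_mat c d" and c: "c \<le> CARD('b::{finite,linorder})"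
  shows "(mat_app (A * B) x :: real^'a::{finite,linorder}) = mat_app A (mat_app B x :: real^'b::{finite,linorder})"
proof -
  have "(mat_app (A * B) x :: real^'a::{finite,linorder}) $ k = (mat_app A (mat_app B x :: real^'b::{finite,linorder})) $ k" for k
  proof (cases "coord_pos k < r")
    case True
    have "(mat_app A (mat_app B x :: real^'b::{finite,linorder})) $ k =
      (\<Sum>l | coord_pos (l::'b) < c. A $$ (coord_pos k, coord_pos l) * (\<Sum>j | coord_pos j < d. B $$ (coord_pos l, coord_pos j) * x $ j))"
      using True A B by (auto simp: mat_app_nth intro!: sum.cong)
    also have "\<dots> = (\<Sum>b<c. A $$ (coord_pos k, b) * (\<Sum>j | coord_pos j < d. B $$ (b, coord_pos j) * x $ j))"
      by (rule sum_coord_pos[OF c])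
    also have "\<dots> = (\<Sum>j | coord_pos j < d. (\<Sum>b<c. A $$ (coord_pos k, b) * B $$ (b, coord_pos j)) * x $ j)"
      by (simp add: sum_distrib_left sum_distrib_right mult.assoc) (rule sum.swap)
    also have "\<dots> = (\<Sum>j | coord_pos j < d. (A * B) $$ (coord_pos k, coord_pos j) * x $ j)"
      using True A B by (intro sum.cong refl) (auto simp: times_mat_def scalar_prod_def lessThan_atLeast0)
    also have "\<dots> = (mat_app (A * B) x :: real^'a::{finite,linorder}) $ k" using True A B by (simp add: mat_app_nth)
    finally show ?thesis by simp
  qed (use A in \<open>simp add: mat_app_nth\<close>)
  then show ?thesis by (simp add: Finite_Cartesian_Product.vec_eq_iff)
qed

lemma mat_app_add:
  assumes "A \<in> carrier_mat r c" "B \<in> carrier_mat r c"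
  shows "(mat_app (A + B) x :: real^'a::{finite,linorder}) = mat_app A x + mat_app B x"
proof -
  have "(mat_app (A + B) x :: real^'a::{finite,linorder}) $ k = (mat_app A x + mat_app B x) $ k" for k
  proof (cases "coord_pos k < r")
    case True
    have "(\<Sum>j | coord_pos j < c. (A + B) $$ (coord_pos k, coord_pos j) * x $ j)
      = (\<Sum>j | coord_pos j < c. A $$ (coord_pos k, coord_pos j) * x $ j + B $$ (coord_pos k, coord_pos j) * x $ j)"
      using True assms by (intro sum.cong refl) (auto simp: distrib_right)
    then show ?thesis using True assms by (simp add: mat_app_nth sum.distrib)
  qed (use assms in \<open>simp add: mat_app_nth\<close>)
  then show ?thesis by (simp add: Finite_Cartesian_Product.vec_eq_iff)
qed

lemma mat_app_smult:
  shows "mat_app (a \<cdot>\<^sub>m A) x = a *\<^sub>R mat_app A x"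
  by (auto simp: Finite_Cartesian_Product.vec_eq_iff mat_app_nth sum_distrib_left algebra_simps intro!: sum.cong)

lemma mat_app_one: "mat_app (1\<^sub>m n) x = coord_proj n x"
proof -
  have "(\<Sum>j | coord_pos j < n. (1\<^sub>m n) $$ (coord_pos k, coord_pos j) * x $ j) = x $ k" if "coord_pos k < n" for k
  proof -
    have "(\<Sum>j | coord_pos j < n. (1\<^sub>m n) $$ (coord_pos k, coord_pos j) * x $ j) = (\<Sum>j | coord_pos j < n. if j = k then x $ j else 0)"
      using that coord_pos_inj by (intro sum.cong refl) (auto dest: injD)
    also have "\<dots> = x $ k" using that by simp
    finally show ?thesis .
  qed
  then show ?thesis by (auto simp: Finite_Cartesian_Product.vec_eq_iff mat_app_nth coord_proj_def)
qed

text \<open>Crude, but uniform: a common bound on the entries of all powers of a matrix gives a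
  common bound on their norms.\<close>

lemma norm_mat_app_le:
  assumes B: "\<And>a b. a < dim_row B \<Longrightarrow> b < dim_col B \<Longrightarrow> \<bar>B $$ (a, b)\<bar> \<le> c" and c: "c \<ge> 0"
  shows "norm (mat_app B x :: real^'a::{finite,linorder}) \<le> real CARD('a) * real CARD('b) * c * norm (x :: real^'b::{finite,linorder})"
proof -
  have "\<bar>(mat_app B x :: real^'a::{finite,linorder}) $ k\<bar> \<le> real CARD('b) * (c * norm x)" for k
  proof (cases "coord_pos k < dim_row B")
    case True
    then have "\<bar>(mat_app B x :: real^'a::{finite,linorder}) $ k\<bar> \<le> (\<Sum>j | coord_pos j < dim_col B. \<bar>B $$ (coord_pos k, coord_pos j) * x $ j\<bar>)"
      by (simp add: mat_app_nth sum_abs)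
    also have "\<dots> \<le> (\<Sum>j | coord_pos (j::'b) < dim_col B. c * norm x)"
      using True B c by (intro sum_mono) (auto simp: abs_mult component_le_norm_cart intro!: mult_mono)
    also have "\<dots> \<le> (\<Sum>j\<in>(UNIV::'b set). c * norm x)"
      using c by (intro sum_mono2) auto
    finally show ?thesis by simp
  qed (use c in \<open>simp add: mat_app_nth\<close>)
  then have "(\<Sum>k\<in>UNIV. \<bar>(mat_app B x :: real^'a::{finite,linorder}) $ k\<bar>) \<le> (\<Sum>k\<in>(UNIV::'a set). real CARD('b) * (c * norm x))"
    by (intro sum_mono) auto
  then show ?thesis using norm_le_l1_cart[of "mat_app B x :: real^'a::{finite,linorder}"] by (simp add: mult.assoc)
qed

lemma map_mat_of_real_pow:
  assumes "B \<in> carrier_mat n n"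
  shows "map_mat complex_of_real (B ^\<^sub>m k) = map_mat complex_of_real B ^\<^sub>m k"
proof (induction k)
  case 0 then show ?case using assms by (auto simp: one_mat_def)
next
  case (Suc k)
  then show ?case using assms by (simp add: of_real_hom.mat_hom_mult[of _ n n _ n])
qed

subsection \<open>A quadratic Lyapunov function of a Hurwitz matrix\<close>

text \<open>For small \<open>\<epsilon>\<close> and \<open>s\<close> slightly above 1, all eigenvalues of \<open>s (I + \<epsilon> B)\<close> lie in the open unit disc, so its
  powers are bounded and those of \<open>I + \<epsilon> B\<close> decay geometrically.\<close>

lemma hurwitz_euler_step_contracts:
  fixes B :: "real mat"
  assumes B: "B \<in> carrier_mat n n" and hur: "hurwitz B"
  obtains \<epsilon> s c where "\<epsilon> > 0" "s > 1"
    "\<And>k a b. a < n \<Longrightarrow> b < n \<Longrightarrow> \<bar>((s \<cdot>\<^sub>m (1\<^sub>m n + \<epsilon> \<cdot>\<^sub>m B)) ^\<^sub>m k) $$ (a, b)\<bar> \<le> c"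
proof (cases "n = 0")
  case True
  then show ?thesis by (intro that[of 1 2]) auto
next
  case False
  then have n: "n > 0" by simp
  let ?B = "map_mat complex_of_real B"
  have B': "?B \<in> carrier_mat n n" using B by simp
  define E where "E = spectrum ?B"
  have E: "finite E" "\<And>z. z \<in> E \<Longrightarrow> Re z < 0"
    using card_finite_spectrum[OF B'] hur unfolding E_def hurwitz_def is_eigenvalue_def spectrum_def by auto
  define \<mu> where "\<mu> = Min (insert (1/2) ((\<lambda>z. - Re z) ` E))"
  have \<mu>: "\<mu> > 0" "\<mu> \<le> 1/2" "\<And>z. z \<in> E \<Longrightarrow> Re z \<le> - \<mu>"
  proof -
    show "\<mu> > 0" using E by (auto simp: \<mu>_def)
    show "\<mu> \<le> 1/2" unfolding \<mu>_def using E(1) by (intro Min_le) auto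
    fix z assume "z \<in> E"
    then have "\<mu> \<le> - Re z" using E(1) unfolding \<mu>_def by (intro Min_le) auto
    then show "Re z \<le> - \<mu>" by simp
  qed
  define R where "R = (\<Sum>z\<in>E. norm z ^ 2)"
  have R: "R \<ge> 0" "\<And>z. z \<in> E \<Longrightarrow> norm z ^ 2 \<le> R"
    unfolding R_def using E(1) by (auto intro!: sum_nonneg member_le_sum)
  \<comment> \<open>For an eigenvalue \<open>\<lambda>\<close> of B this gives \<open>norm (1 +
    \<epsilon> * \<lambda>) ^ 2 \<le> 1 - 2 * \<epsilon> * \<mu> + \<epsilon> ^ 2 * R \<le> 1 -
    \<epsilon> * \<mu>\<close>. With \<open>x = \<epsilon> * \<mu>\<close> and
    \<open>s ^ 2 = 1 + x\<close> the scaled square is at most \<open>(1 + x) * (1 - x)\<close>,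
    below 1.\<close>
  define \<epsilon> where "\<epsilon> = \<mu> / (R + 1)"
  have \<epsilon>: "\<epsilon> > 0" "\<epsilon> * R \<le> \<mu>" "\<epsilon> \<le> \<mu>" using \<mu>(1) R(1) by (auto simp: \<epsilon>_def field_simps)
  define x where "x = \<epsilon> * \<mu>"
  have x: "x > 0" "x < 1"
  proof -
    show "x > 0" using \<epsilon> \<mu> by (simp add: x_def)
    have "x \<le> \<mu> * \<mu>" unfolding x_def using \<epsilon> \<mu> by (intro mult_right_mono) auto
    also have "\<dots> \<le> 1/2 * (1/2)" using \<mu> by (intro mult_mono) auto
    finally show "x < 1" by simp
  qed
  define s where "s = sqrt (1 + x)"
  have s: "s > 1" "s^2 = 1 + x" using x by (auto simp: s_def)
  define A where "A = s \<cdot>\<^sub>m (1\<^sub>m n + \<epsilon> \<cdot>\<^sub>m B)"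
  let ?A = "map_mat complex_of_real A"
  have A: "A \<in> carrier_mat n n" "?A \<in> carrier_mat n n" using B by (auto simp: A_def)
  have Aeq: "?A = complex_of_real s \<cdot>\<^sub>m (1\<^sub>m n + complex_of_real \<epsilon> \<cdot>\<^sub>m ?B)"
    using B by (intro eq_matI) (auto simp: A_def)
  have zlt: "norm z < 1" if z: "z \<in> spectrum ?A" for z
  proof -
    from z obtain v where v: "v \<in> carrier_vec n" "v \<noteq> 0\<^sub>v n" "?A *\<^sub>v v = z \<cdot>\<^sub>v v"
      using A unfolding spectrum_def eigenvalue_def eigenvector_def by auto
    have eq: "complex_of_real s * (vec_index v i + complex_of_real \<epsilon> * vec_index (?B *\<^sub>v v) i) = z * vec_index v i" if i: "i < n" for i
    proof -
      have "vec_index (?A *\<^sub>v v) i = (\<Sum>j<n. complex_of_real s * ((if j = i then vec_index v j else 0) + complex_of_real \<epsilon> * (?B $$ (i, j) * vec_index v j)))"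
        using i v(1) B unfolding Aeq by (auto simp: scalar_prod_def lessThan_atLeast0 algebra_simps intro!: sum.cong)
      also have "\<dots> = complex_of_real s * (vec_index v i + complex_of_real \<epsilon> * (\<Sum>j<n. ?B $$ (i, j) * vec_index v j))"
        using i by (simp add: sum_distrib_left[symmetric] sum.distrib)
      also have "(\<Sum>j<n. ?B $$ (i, j) * vec_index v j) = vec_index (?B *\<^sub>v v) i"
        using i v(1) B by (auto simp: scalar_prod_def lessThan_atLeast0)
      finally show ?thesis using v(1) i by (simp add: v(3))
    qed
    \<comment> \<open>Inverts the affine map from eigenvalues of B to those of A; the eigenvector
      stays the same.\<close>
    define ev where "ev = (z / s - 1) / \<epsilon>"
    have zl: "z = s * (1 + \<epsilon> * ev)" using s \<epsilon> by (simp add: ev_def field_simps)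
    have "?B *\<^sub>v v = ev \<cdot>\<^sub>v v"
    proof (rule eq_vecI)
      fix i assume "i < dim_vec (ev \<cdot>\<^sub>v v)"
      then have i: "i < n" using v(1) by simp
      have "s * (vec_index v i + \<epsilon> * vec_index (?B *\<^sub>v v) i) = s * (vec_index v i + \<epsilon> * (ev * vec_index v i))"
        using eq[OF i] unfolding zl by (simp add: algebra_simps)
      then show "vec_index (?B *\<^sub>v v) i = vec_index (ev \<cdot>\<^sub>v v) i" using s \<epsilon> i v(1) by simp
    qed (use v B' in auto)
    then have "ev \<in> E" using v B' unfolding E_def spectrum_def eigenvalue_def eigenvector_def by auto
    then have l: "Re ev \<le> - \<mu>" "norm ev ^ 2 \<le> R" using \<mu> R by auto
    have "norm (1 + \<epsilon> * ev) ^ 2 = 1 + 2 * \<epsilon> * Re ev + \<epsilon> * (\<epsilon> * norm ev ^ 2)"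
      by (simp only: cmod_power2) (simp add: power2_eq_square algebra_simps)
    also have "\<dots> \<le> 1 + 2 * \<epsilon> * (- \<mu>) + \<epsilon> * (\<epsilon> * R)"
      using l \<epsilon>(1) by (intro add_mono mult_left_mono) auto
    also have "\<dots> \<le> 1 + 2 * \<epsilon> * (- \<mu>) + \<epsilon> * \<mu>" using \<epsilon> by (intro add_mono mult_left_mono) auto
    finally have "norm (1 + \<epsilon> * ev) ^ 2 \<le> 1 - x" by (simp add: x_def)
    then have "s^2 * norm (1 + \<epsilon> * ev) ^ 2 \<le> (1 + x) * (1 - x)" using s x by (intro mult_mono) auto
    also have "\<dots> < 1" using x by (simp add: algebra_simps)
    finally have "norm z ^ 2 < 1" using s by (simp add: zl norm_mult power_mult_distrib)
    then show ?thesis by (simp add: power_less_one_iff)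
  qed
  have "spectral_radius ?A < 1" using spectral_radius_mem_max(1)[OF A(2) n] zlt by auto
  then obtain c where c: "\<And>k. norm_bound (?A ^\<^sub>m k) c"
    using spectral_radius_jnf_norm_bound_less_1_upper_triangular[OF A(2)] by blast
  show ?thesis
  proof (rule that[OF \<epsilon>(1) s(1)])
    fix k a b assume ab: "a < n" "b < n"
    have "norm ((?A ^\<^sub>m k) $$ (a, b)) \<le> c"
      using c[of k] ab A unfolding norm_bound_def by auto
    moreover have "(?A ^\<^sub>m k) $$ (a, b) = complex_of_real ((A ^\<^sub>m k) $$ (a, b))"
      using ab A(1) by (simp add: map_mat_of_real_pow[OF A(1), symmetric])
    ultimately show "\<bar>((s \<cdot>\<^sub>m (1\<^sub>m n + \<epsilon> \<cdot>\<^sub>m B)) ^\<^sub>m k) $$ (a, b)\<bar> \<le> c" by (simp add: A_def)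
  qed
qed

lemma mat_app_pow:
  fixes x :: "real^'o::{finite,linorder}"
  assumes A: "A \<in> carrier_mat n n" and n: "n \<le> CARD('o)" and x: "x \<in> coord_space n"
  shows "mat_app (A ^\<^sub>m k) x = ((mat_app A ^^ k) x :: real^'o::{finite,linorder})"
  using x
proof (induction k arbitrary: x)
  case 0 then show ?case using A by (simp add: mat_app_one coord_proj_ident)
next
  case (Suc k)
  have "(mat_app (A ^\<^sub>m Suc k) x :: real^'o::{finite,linorder}) = mat_app (A ^\<^sub>m k) (mat_app A x :: real^'o::{finite,linorder})"
    using A n by (simp add: mat_app_mult[of _ n n _ n])
  also have "\<dots> = (mat_app A ^^ k) (mat_app A x :: real^'o::{finite,linorder})" using A by (intro Suc.IH mat_app_in_coord_space) auto
  finally show ?case by (simp add: funpow_swap1)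
qed

text \<open>If \<open>L = I + \<epsilon> B\<close> satisfies \<open>\<parallel>L ^ K x\<parallel>\<^sup>2 \<le> \<parallel>x\<parallel>\<^sup>2 / 2\<close>, then \<open>Q x = \<Sum>k<K. \<parallel>L ^ k x\<parallel>\<^sup>2\<close> decreases along \<open>L\<close>, and
  \<open>Q (L x) - Q x = \<epsilon> Q' x (B x) + \<epsilon>\<^sup>2 Q (B x)\<close> transfers this to the flow of \<open>B\<close>.\<close>

lemma hurwitz_quadratic:
  assumes B: "B \<in> carrier_mat n n" and hur: "hurwitz B" and n: "n \<le> CARD('o::{finite,linorder})"
  obtains Q :: "real^'o::{finite,linorder} \<Rightarrow> real" and Q' c C where "C1 Q Q'" "c > 0" "C \<ge> 0" "\<And>x. c * (norm x)\<^sup>2 \<le> Q x"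
    "\<And>x b. x \<in> coord_space n \<Longrightarrow> Q' x (mat_app B x + b) \<le> - 2 * (norm x)\<^sup>2 + C * (norm b)\<^sup>2"
proof -
  obtain \<epsilon> s c0 where \<epsilon>: "\<epsilon> > 0" and s: "s > 1" and
    c0: "\<And>k a b. a < n \<Longrightarrow> b < n \<Longrightarrow> \<bar>((s \<cdot>\<^sub>m (1\<^sub>m n + \<epsilon> \<cdot>\<^sub>m B)) ^\<^sub>m k) $$ (a, b)\<bar> \<le> c0"
    using hurwitz_euler_step_contracts[OF B hur] by metis
  define c1 where "c1 = max c0 0"
  define A where "A = s \<cdot>\<^sub>m (1\<^sub>m n + \<epsilon> \<cdot>\<^sub>m B)"
  have A: "A \<in> carrier_mat n n" using B by (simp add: A_def)
  define L where "L x = x + \<epsilon> *\<^sub>R mat_app B x" for x :: "real^'o::{finite,linorder}"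
  have linL: "linear L" unfolding L_def[abs_def]
    by (intro linear_compose_add linear_compose_scale_right linear_mat_app linear_id[unfolded id_def])
  have linLk: "linear (L ^^ k)" for k
    by (induction k) (auto intro: linear_compose[OF _ linL, unfolded comp_def] simp: linear_id[unfolded id_def])
  have Lcs: "L x \<in> coord_space n" if "x \<in> coord_space n" for x
    unfolding L_def using that B by (intro coord_space_add coord_space_scaleR mat_app_in_coord_space) auto
  have Lkcs: "(L ^^ k) x \<in> coord_space n" if "x \<in> coord_space n" for k x
    by (induction k) (use that Lcs in auto)
  have AL: "mat_app A x = s *\<^sub>R L x" if "x \<in> coord_space n" for x
    using B that by (simp add: A_def mat_app_smult mat_app_add[of _ n n] mat_app_one coord_proj_ident L_def)
  have ALk: "mat_app (A ^\<^sub>m k) x = (s ^ k) *\<^sub>R (L ^^ k) x" if "x \<in> coord_space n" for k x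
    unfolding mat_app_pow[OF A n that]
  proof (induction k)
    case (Suc k)
    then show ?case using AL[OF coord_space_scaleR[OF Lkcs[OF that]], of "s ^ k" k]
      by (simp add: linear_scale[OF linL])
  qed simp
  define N where "N = real CARD('o) * real CARD('o) * c1"
  have N: "N \<ge> 0" by (simp add: N_def c1_def)
  have Lk: "norm ((L ^^ k) x) \<le> N / s ^ k * norm x" if "x \<in> coord_space n" for k x
  proof -
    have "norm (mat_app (A ^\<^sub>m k) x :: real^'o::{finite,linorder}) \<le> N * norm x"
      unfolding N_def
    proof (rule norm_mat_app_le)
      have Ak: "A ^\<^sub>m k \<in> carrier_mat n n" using A by simp
      fix a b assume "a < dim_row (A ^\<^sub>m k)" "b < dim_col (A ^\<^sub>m k)"
      then have "a < n" "b < n" using Ak by auto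
      then show "\<bar>(A ^\<^sub>m k) $$ (a, b)\<bar> \<le> c1"
        unfolding c1_def using c0[of a b k, folded A_def] by (simp add: le_max_iff_disj)
    qed (simp add: c1_def)
    then show ?thesis using s by (simp add: ALk[OF that] field_simps)
  qed
  \<comment> \<open>This K makes \<open>N / s ^ K\<close> at most 1/2. It also cannot be 0, so the
    sum defining P contains the term k = 0 and dominates the square of the norm.\<close>
  obtain K where K: "2 * (N + 1) < s ^ K" using real_arch_pow[OF s] by blast
  have half: "(norm ((L ^^ K) x))\<^sup>2 \<le> (norm x)\<^sup>2 / 2" if "x \<in> coord_space n" for x
  proof -
    have "N / s ^ K \<le> 1 / 2" using K N by (simp add: field_simps)
    then have "N / s ^ K * norm x \<le> 1 / 2 * norm x" by (rule mult_right_mono) simp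
    then have "norm ((L ^^ K) x) \<le> 1 / 2 * norm x" by (rule order_trans[OF Lk[OF that, of K]])
    then have "(norm ((L ^^ K) x))\<^sup>2 \<le> (1 / 2 * norm x)\<^sup>2" by (intro power_mono) auto
    also have "\<dots> \<le> (norm x)\<^sup>2 / 2" by (simp add: power2_eq_square)
    finally show ?thesis .
  qed
  have "K \<noteq> 0" using K N by (cases K) auto
  then have K0: "0 < K" by simp
  define P where "P x y = (\<Sum>k<K. (L ^^ k) x \<bullet> (L ^^ k) y)" for x y
  have Padd: "P x (y + z) = P x y + P x z" "P (y + z) x = P y x + P z x" "P x (a *\<^sub>R y) = a * P x y" "P (a *\<^sub>R y) x = a * P y x" for x y z a
    by (simp_all add: P_def linear_add[OF linLk] linear_scale[OF linLk] inner_add_left inner_add_right sum.distrib sum_distrib_left)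
  have Psym: "P x y = P y x" for x y by (simp add: P_def inner_commute)
  have Pge: "P x x \<ge> (norm x)\<^sup>2" for x
  proof -
    have "(L ^^ 0) x \<bullet> (L ^^ 0) x \<le> P x x" unfolding P_def using K0 by (intro member_le_sum) auto
    then show ?thesis by (simp add: power2_norm_eq_inner)
  qed
  have bdd: "\<exists>C\<ge>0. \<forall>x y. \<bar>P x y\<bar> \<le> C * norm x * norm y"
  proof -
    have "\<exists>C. \<forall>x. norm ((L ^^ k) x) \<le> norm x * C" for k
      by (rule bounded_linear.bounded[OF linear_conv_bounded_linear[THEN iffD1, OF linLk[of k]]])
    then obtain C where C: "\<And>k x. norm ((L ^^ k) x) \<le> norm x * C k" by metis
    have "\<bar>P x y\<bar> \<le> (\<Sum>k<K. (C k)\<^sup>2) * norm x * norm y" for x y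
    proof -
      have "\<bar>P x y\<bar> \<le> (\<Sum>k<K. \<bar>(L ^^ k) x \<bullet> (L ^^ k) y\<bar>)" unfolding P_def by (rule sum_abs)
      also have "\<dots> \<le> (\<Sum>k<K. norm ((L ^^ k) x) * norm ((L ^^ k) y))" by (intro sum_mono Cauchy_Schwarz_ineq2)
      also have "\<dots> \<le> (\<Sum>k<K. (norm x * C k) * (norm y * C k))"
        using C by (intro sum_mono mult_mono) (auto intro: order_trans[OF norm_ge_zero])
      also have "\<dots> = (\<Sum>k<K. (C k)\<^sup>2) * norm x * norm y"
        by (simp add: sum_distrib_left sum_distrib_right power2_eq_square mult_ac)
      finally show ?thesis .
    qed
    then show ?thesis by (intro exI[of _ "\<Sum>k<K. (C k)\<^sup>2"]) (auto intro: sum_nonneg)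
  qed
  then obtain C where C: "C \<ge> 0" "\<And>x y. \<bar>P x y\<bar> \<le> C * norm x * norm y" by blast
  \<comment> \<open>The sum telescopes along L, leaving the last square minus the first, at most
    half of the negated first. Expanding \<open>P (L x) (L x)\<close> and dropping its nonnegative
    quadratic term in \<epsilon> isolates the derivative along B.\<close>
  have PB: "2 * \<epsilon> * P x (mat_app B x) \<le> - (norm x)\<^sup>2 / 2" if x: "x \<in> coord_space n" for x
  proof -
    have "P (L x) (L x) = (\<Sum>k<K. (L ^^ Suc k) x \<bullet> (L ^^ Suc k) x)"
      unfolding P_def by (simp add: funpow_swap1)
    moreover have "(\<Sum>k<K. (L ^^ Suc k) x \<bullet> (L ^^ Suc k) x) - P x x = (L ^^ K) x \<bullet> (L ^^ K) x - x \<bullet> x"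
      using sum_lessThan_telescope[of "\<lambda>k. (L ^^ k) x \<bullet> (L ^^ k) x" K] by (simp add: P_def sum_subtractf)
    ultimately have "P (L x) (L x) - P x x \<le> - (norm x)\<^sup>2 / 2"
      using half[OF x] by (simp add: power2_norm_eq_inner)
    moreover have "P (L x) (L x) = P x x + 2 * \<epsilon> * P x (mat_app B x) + \<epsilon> * \<epsilon> * P (mat_app B x) (mat_app B x)"
      using Psym[of "mat_app B x" x] by (simp add: L_def Padd algebra_simps)
    moreover have "\<epsilon> * \<epsilon> * P (mat_app B x) (mat_app B x) \<ge> 0"
      using Pge[of "mat_app B x"] \<epsilon> by (intro mult_nonneg_nonneg) (auto intro: order_trans[OF zero_le_power2])
    ultimately show ?thesis by linarith
  qed
  \<comment> \<open>The factor 8 turns \<open>PB\<close> into a decay of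
    \<open>4 * (norm x)\<^sup>2\<close>; one half of it pays for the cross term with b, the other
    half is the decay asserted.\<close>
  define Q where "Q x = 8 * \<epsilon> * P x x" for x
  define Q' where "Q' x h = 16 * \<epsilon> * P x h" for x h
  have "C1 (\<lambda>x. (L ^^ k) x \<bullet> (L ^^ k) x) (\<lambda>x h. (L ^^ k) x \<bullet> (L ^^ k) h + (L ^^ k) h \<bullet> (L ^^ k) x)" for k
    by (intro C1_inner C1_linear linLk)
  then have "C1 (\<lambda>x. P x x) (\<lambda>x h. \<Sum>k<K. (L ^^ k) x \<bullet> (L ^^ k) h + (L ^^ k) h \<bullet> (L ^^ k) x)"
    unfolding P_def by (intro C1_sum)
  moreover have "(\<lambda>x h. \<Sum>k<K. (L ^^ k) x \<bullet> (L ^^ k) h + (L ^^ k) h \<bullet> (L ^^ k) x) = (\<lambda>x h. 2 * P x h)"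
    by (simp add: P_def sum.distrib inner_commute sum_distrib_left)
  ultimately have "C1 (\<lambda>x. P x x) (\<lambda>x h. 2 * P x h)" by simp
  from C1_mult[OF C1_const[of "8 * \<epsilon>"] this] have "C1 Q (\<lambda>x h. 8 * \<epsilon> * (2 * P x h) + 0 * P x x)"
    unfolding Q_def[abs_def] .
  moreover have "(\<lambda>x h. 8 * \<epsilon> * (2 * P x h) + 0 * P x x) = Q'" by (simp add: Q'_def fun_eq_iff)
  ultimately have Q1: "C1 Q Q'" by simp
  show ?thesis
  proof (rule that[OF Q1])
    show "8 * \<epsilon> > 0" using \<epsilon> by simp
    show "8 * \<epsilon> * (norm x)\<^sup>2 \<le> Q x" for x unfolding Q_def using \<epsilon> Pge by (intro mult_left_mono) auto
    let ?C = "32 * \<epsilon>\<^sup>2 * C\<^sup>2"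
    show "?C \<ge> 0" by simp
    fix x b :: "real^'o::{finite,linorder}" assume x: "x \<in> coord_space n"
    have "16 * \<epsilon> * P x b \<le> 16 * \<epsilon> * (C * norm x * norm b)"
      using C(2)[of x b] \<epsilon> by (intro mult_left_mono) auto
    also have "\<dots> \<le> 2 * (norm x)\<^sup>2 + ?C * (norm b)\<^sup>2"
    proof -
      have "0 \<le> 2 * (norm x - 4 * \<epsilon> * C * norm b)\<^sup>2" by simp
      then show ?thesis by (simp add: power2_eq_square algebra_simps)
    qed
    finally have "16 * \<epsilon> * P x b \<le> 2 * (norm x)\<^sup>2 + ?C * (norm b)\<^sup>2" .
    moreover have "16 * \<epsilon> * P x (mat_app B x) \<le> - 4 * (norm x)\<^sup>2" using PB[OF x] by simp
    ultimately show "Q' x (mat_app B x + b) \<le> - 2 * (norm x)\<^sup>2 + ?C * (norm b)\<^sup>2"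
      unfolding Q'_def Padd(1) distrib_left by linarith
  qed
qed

subsection \<open>The internal model\<close>

text \<open>Cayley--Hamilton: comparing coefficients in \<open>(x I - B) adj (x I - B) = \<chi> I\<close> and summing against the powers of \<open>B\<close>
  telescopes.\<close>

lemma annihilates_char_poly:
  assumes B: "B \<in> carrier_mat n n"
  shows "annihilates (char_poly B) B"
proof -
  define cp where "cp = char_poly B"
  define P where "P = char_poly_matrix B"
  have P: "P \<in> carrier_mat n n" using B by (simp add: P_def)
  define J where "J = adj_mat P"
  have J: "J \<in> carrier_mat n n" "P * J = cp \<cdot>\<^sub>m 1\<^sub>m n" using adj_mat[OF P] by (auto simp: J_def cp_def P_def char_poly_def)
  \<comment> \<open>One entry of the identity \<open>P * J = cp \<cdot>\<^sub>m 1\<^sub>m n\<close>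
    of polynomial matrices; \<open>pCons 0\<close> multiplies by the indeterminate.\<close>
  have ent: "pCons 0 (J $$ (a, b)) - (\<Sum>c<n. Polynomial.smult (B $$ (a, c)) (J $$ (c, b))) = (if a = b then cp else 0)" if ab: "a < n" "b < n" for a b
  proof -
    have "(P * J) $$ (a, b) = (\<Sum>c<n. P $$ (a, c) * J $$ (c, b))"
      using ab P J(1) by (simp add: scalar_prod_def lessThan_atLeast0)
    also have "\<dots> = (\<Sum>c<n. (if c = a then pCons 0 (J $$ (c, b)) else 0) - Polynomial.smult (B $$ (a, c)) (J $$ (c, b)))"
      using ab B by (intro sum.cong refl) (auto simp: P_def char_poly_matrix_def algebra_simps)
    also have "\<dots> = pCons 0 (J $$ (a, b)) - (\<Sum>c<n. Polynomial.smult (B $$ (a, c)) (J $$ (c, b)))"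
      using ab by (simp add: sum_subtractf)
    finally show ?thesis unfolding J(2) using ab by (cases "a = b") auto
  qed
  define N where "N = Suc (degree cp + (\<Sum>a<n. \<Sum>b<n. degree (J $$ (a, b))))"
  have JN: "coeff (J $$ (a, b)) k = 0" if "a < n" "b < n" "N \<le> k" for a b k
  proof (rule coeff_eq_0)
    have "degree (J $$ (a, b)) \<le> (\<Sum>b<n. degree (J $$ (a, b)))" using that by (intro member_le_sum) auto
    also have "\<dots> \<le> (\<Sum>a<n. \<Sum>b<n. degree (J $$ (a, b)))" using that by (intro member_le_sum) auto
    finally show "degree (J $$ (a, b)) < k" using that by (simp add: N_def)
  qed
  show ?thesis
    unfolding annihilates_def
  proof (intro allI impI)
    fix a b assume "a < dim_row B" "b < dim_row B"
    then have ab: "a < n" "b < n" using B by auto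
    \<comment> \<open>The telescoping quantity. It vanishes at 0 because \<open>pCons 0\<close> has
      no constant coefficient, and at \<open>Suc N\<close> because N exceeds all degrees in the
      adjugate.\<close>
    define T where "T k = (\<Sum>d<n. (B ^\<^sub>m k) $$ (a, d) * coeff (pCons 0 (J $$ (d, b))) k)" for k
    have step: "coeff cp k * (B ^\<^sub>m k) $$ (a, b) = T k - T (Suc k)" for k
    proof -
      have "T k - T (Suc k) = (\<Sum>d<n. (B ^\<^sub>m k) $$ (a, d) * coeff (pCons 0 (J $$ (d, b))) k) - (\<Sum>c<n. (B ^\<^sub>m Suc k) $$ (a, c) * coeff (J $$ (c, b)) k)"
        by (simp add: T_def)
      also have "(\<Sum>c<n. (B ^\<^sub>m Suc k) $$ (a, c) * coeff (J $$ (c, b)) k) = (\<Sum>c<n. (\<Sum>d<n. (B ^\<^sub>m k) $$ (a, d) * B $$ (d, c)) * coeff (J $$ (c, b)) k)"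
      proof (intro sum.cong refl)
        fix c assume "c \<in> {..<n}"
        then have "(B ^\<^sub>m Suc k) $$ (a, c) = (\<Sum>d<n. (B ^\<^sub>m k) $$ (a, d) * B $$ (d, c))"
          using ab B by (auto simp: scalar_prod_def lessThan_atLeast0)
        then show "(B ^\<^sub>m Suc k) $$ (a, c) * coeff (J $$ (c, b)) k = (\<Sum>d<n. (B ^\<^sub>m k) $$ (a, d) * B $$ (d, c)) * coeff (J $$ (c, b)) k" by simp
      qed
      also have "\<dots> = (\<Sum>d<n. (B ^\<^sub>m k) $$ (a, d) * (\<Sum>c<n. B $$ (d, c) * coeff (J $$ (c, b)) k))"
        by (simp add: sum_distrib_left sum_distrib_right mult.assoc) (rule sum.swap)
      also have "(\<Sum>d<n. (B ^\<^sub>m k) $$ (a, d) * coeff (pCons 0 (J $$ (d, b))) k) - \<dots>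
        = (\<Sum>d<n. (B ^\<^sub>m k) $$ (a, d) * coeff (pCons 0 (J $$ (d, b)) - (\<Sum>c<n. Polynomial.smult (B $$ (d, c)) (J $$ (c, b)))) k)"
        by (simp add: sum_subtractf[symmetric] right_diff_distrib coeff_sum)
      also have "\<dots> = (\<Sum>d<n. (B ^\<^sub>m k) $$ (a, d) * (if d = b then coeff cp k else 0))"
        using ab by (intro sum.cong refl) (simp add: ent)
      also have "\<dots> = coeff cp k * (B ^\<^sub>m k) $$ (a, b)" using ab by (simp add: if_distrib mult.commute cong: if_cong)
      finally show ?thesis by simp
    qed
    have "(\<Sum>k\<le>degree cp. coeff cp k * (B ^\<^sub>m k) $$ (a, b)) = (\<Sum>k<Suc N. coeff cp k * (B ^\<^sub>m k) $$ (a, b))"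
      by (rule sum.mono_neutral_left) (auto simp: N_def coeff_eq_0)
    also have "\<dots> = (\<Sum>k<Suc N. T k - T (Suc k))" by (simp only: step)
    also have "\<dots> = T 0 - T (Suc N)" by (rule sum_lessThan_telescope')
    also have "\<dots> = 0" using ab by (simp add: T_def JN)
    finally show "(\<Sum>k\<le>degree (char_poly B). coeff (char_poly B) k * (B ^\<^sub>m k) $$ (a, b)) = 0" by (simp add: cp_def)
  qed
qed

lemma degree_minimal_poly_le:
  assumes B: "B \<in> carrier_mat n n" and m: "is_minimal_poly B m"
  shows "degree m \<le> n"
proof -
  have "degree (char_poly B) = n" "char_poly B \<noteq> 0" using degree_monic_char_poly[OF B] by auto
  then show ?thesis using m annihilates_char_poly[OF B] unfolding is_minimal_poly_def by auto
qed

text \<open>The vector of the disturbance \<open>D \<omega>\<close> and its successive time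
  derivatives along the generator S, as many as the degree n of the minimal polynomial: the steady
  state of the internal model.\<close>

definition immersion :: "real mat \<Rightarrow> real mat \<Rightarrow> nat \<Rightarrow> real^'o::{finite,linorder} \<Rightarrow> real^'o::{finite,linorder}" where
  "immersion S D n \<omega> = (\<chi> k. if coord_pos k < n then row_app (D * S ^\<^sub>m coord_pos k) \<omega> else 0)"

lemma linear_immersion: "linear (immersion S D n)"
  by (rule linearI) (auto simp: Finite_Cartesian_Product.vec_eq_iff immersion_def linear_add[OF linear_row_app] linear_scale[OF linear_row_app])

lemma immersion_in_coord_space: "immersion S D n \<omega> \<in> coord_space n"
  by (auto simp: immersion_def coord_space_def)

lemma row_app_mult:
  assumes "A \<in> carrier_mat 1 c" "B \<in> carrier_mat c d" "c \<le> CARD('b::{finite,linorder})"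
  shows "row_app (A * B) x = row_app A (mat_app B x :: real^'b::{finite,linorder})"
  by (simp add: row_app_def mat_app_mult[OF assms])

context
  fixes S D :: "real mat" and n :: nat and m :: "real poly"
  assumes S: "S \<in> carrier_mat n n" and D: "D \<in> carrier_mat 1 n" and m: "is_minimal_poly S m"
    and n: "n \<le> CARD('o::{finite,linorder})"
begin

text \<open>The identity m(S) = 0 read between D and \<open>\<omega>\<close>, solved for its leading
  term since m is monic.\<close>

lemma minimal_poly_recurrence:
  fixes \<omega> :: "real^'o::{finite,linorder}"
  shows "row_app (D * S ^\<^sub>m degree m) \<omega> = (\<Sum>k<degree m. - coeff m k * row_app (D * S ^\<^sub>m k) \<omega>)"
proof -
  have row: "row_app (D * S ^\<^sub>m k) \<omega> = (\<Sum>j | coord_pos j < n. (\<Sum>c<n. D $$ (0, c) * (S ^\<^sub>m k) $$ (c, coord_pos j)) * \<omega> $ j)" for k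
  proof -
    have "(D * S ^\<^sub>m k) $$ (0, b) = (\<Sum>c<n. D $$ (0, c) * (S ^\<^sub>m k) $$ (c, b))" if "b < n" for b
      using that S D by (auto simp: times_mat_def scalar_prod_def lessThan_atLeast0)
    then have "(\<Sum>j | coord_pos j < n. (D * S ^\<^sub>m k) $$ (0, coord_pos j) * \<omega> $ j)
       = (\<Sum>j | coord_pos j < n. (\<Sum>c<n. D $$ (0, c) * (S ^\<^sub>m k) $$ (c, coord_pos j)) * \<omega> $ j)"
      by (intro sum.cong refl) simp
    moreover have "row_app (D * S ^\<^sub>m k) \<omega> = (\<Sum>j | coord_pos j < n. (D * S ^\<^sub>m k) $$ (0, coord_pos j) * \<omega> $ j)"
      using S D row_app_eq[of "D * S ^\<^sub>m k" \<omega>] by simp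
    ultimately show ?thesis by simp
  qed
  have ann: "(\<Sum>k\<le>degree m. coeff m k * (S ^\<^sub>m k) $$ (a, b)) = 0" if "a < n" "b < n" for a b
    using m S that unfolding is_minimal_poly_def annihilates_def by auto
  have "(\<Sum>k\<le>degree m. coeff m k * row_app (D * S ^\<^sub>m k) \<omega>)
    = (\<Sum>k\<le>degree m. \<Sum>j | coord_pos j < n. \<Sum>c<n. D $$ (0, c) * \<omega> $ j * (coeff m k * (S ^\<^sub>m k) $$ (c, coord_pos j)))"
    unfolding row sum_distrib_left sum_distrib_right by (intro sum.cong refl) (simp add: mult_ac)
  also have "\<dots> = (\<Sum>j | coord_pos j < n. \<Sum>k\<le>degree m. \<Sum>c<n. D $$ (0, c) * \<omega> $ j * (coeff m k * (S ^\<^sub>m k) $$ (c, coord_pos j)))"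
    by (rule sum.swap)
  also have "\<dots> = (\<Sum>j | coord_pos j < n. \<Sum>c<n. \<Sum>k\<le>degree m. D $$ (0, c) * \<omega> $ j * (coeff m k * (S ^\<^sub>m k) $$ (c, coord_pos j)))"
    by (rule sum.cong[OF refl], rule sum.swap)
  also have "\<dots> = 0" by (simp add: sum_distrib_left[symmetric] ann)
  finally have "(\<Sum>k<Suc (degree m). coeff m k * row_app (D * S ^\<^sub>m k) \<omega>) = 0" by (simp only: lessThan_Suc_atMost)
  then show ?thesis using m by (simp add: is_minimal_poly_def sum_negf)
qed

lemma degree_le_card: "degree m \<le> CARD('o)"
  using degree_minimal_poly_le[OF S m] n by simp

text \<open>Differentiation shifts the vector of derivatives by one place, as the superdiagonal of
  the companion matrix does; the recurrence closes the last row.\<close>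

lemma immersion_dynamics:
  fixes \<omega> :: "real^'o::{finite,linorder}"
  shows "immersion S D (degree m) (mat_app S \<omega> :: real^'o::{finite,linorder}) = mat_app (Phi_mat m) (immersion S D (degree m) \<omega>)"
proof -
  define t where "t b = row_app (D * S ^\<^sub>m b) \<omega>" for b
  have shift: "row_app (D * S ^\<^sub>m b) (mat_app S \<omega> :: real^'o::{finite,linorder}) = t (Suc b)" for b
  proof -
    have "D * S ^\<^sub>m Suc b = (D * S ^\<^sub>m b) * S" using S D by (simp add: assoc_mult_mat[of _ 1 n _ n _ n])
    then show ?thesis unfolding t_def using S D n by (simp add: row_app_mult[of _ n _ n])
  qed
  have "(mat_app (Phi_mat m) (immersion S D (degree m) \<omega>) :: real^'o::{finite,linorder}) $ k = (if coord_pos k < degree m then t (Suc (coord_pos k)) else 0)" for k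
  proof (cases "coord_pos k < degree m")
    case True
    have "(mat_app (Phi_mat m) (immersion S D (degree m) \<omega>) :: real^'o::{finite,linorder}) $ k
       = (\<Sum>j | coord_pos (j::'o) < degree m. Phi_mat m $$ (coord_pos k, coord_pos j) * t (coord_pos j))"
      using True by (auto simp: mat_app_nth Phi_mat_def immersion_def t_def intro!: sum.cong)
    also have "\<dots> = (\<Sum>b<degree m. Phi_mat m $$ (coord_pos k, b) * t b)" by (rule sum_coord_pos[OF degree_le_card])
    also have "\<dots> = t (Suc (coord_pos k))"
    proof (cases "Suc (coord_pos k) < degree m")
      case True
      have "(\<Sum>b<degree m. Phi_mat m $$ (coord_pos k, b) * t b) = (\<Sum>b<degree m. if b = Suc (coord_pos k) then t b else 0)"
        using True by (intro sum.cong refl) (auto simp: Phi_mat_def)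
      then show ?thesis using True by simp
    next
      case False
      then have last: "Suc (coord_pos k) = degree m" using \<open>coord_pos k < degree m\<close> by simp
      have "(\<Sum>b<degree m. Phi_mat m $$ (coord_pos k, b) * t b) = (\<Sum>b<degree m. - coeff m b * t b)"
        using last by (intro sum.cong refl) (auto simp: Phi_mat_def)
      then show ?thesis using minimal_poly_recurrence[of \<omega>] by (simp add: last t_def)
    qed
    finally show ?thesis using True by simp
  qed (simp add: mat_app_nth Phi_mat_def)
  then show ?thesis by (simp add: Finite_Cartesian_Product.vec_eq_iff immersion_def shift)
qed

lemma immersion_output:
  fixes \<omega> :: "real^'o::{finite,linorder}"
  shows "row_app (Psi_mat m) (immersion S D (degree m) \<omega>) = row_app D \<omega>"
proof -
  define t where "t b = row_app (D * S ^\<^sub>m b) \<omega>" for b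
  have "row_app (Psi_mat m) (immersion S D (degree m) \<omega>) = (\<Sum>j | coord_pos (j::'o) < degree m. Psi_mat m $$ (0, coord_pos j) * t (coord_pos j))"
    by (subst row_app_eq) (auto simp: Psi_mat_def immersion_def t_def intro!: sum.cong)
  also have "\<dots> = (\<Sum>b<degree m. Psi_mat m $$ (0, b) * t b)" by (rule sum_coord_pos[OF degree_le_card])
  also have "\<dots> = (\<Sum>b<degree m. if b = 0 then t b else 0)" by (intro sum.cong refl) (auto simp: Psi_mat_def)
  also have "\<dots> = (if 0 < degree m then t 0 else 0)" by simp
  also have "\<dots> = t 0"
  \<comment> \<open>In degree 0 there is no first coordinate to read off; the recurrence with its
    empty sum then says that the disturbance is 0.\<close>
  proof (cases "degree m = 0")
    case True
    then show ?thesis using minimal_poly_recurrence[of \<omega>] by (simp add: t_def)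
  qed simp
  also have "\<dots> = row_app D \<omega>" using S D by (simp add: t_def)
  finally show ?thesis .
qed

end

lemma mat_app_F_mat:
  assumes G: "G \<in> carrier_mat (degree m) 1"
  shows "mat_app (F_mat m G) x = mat_app (Phi_mat m) x + (col_app G (row_app (Psi_mat m) x) :: real^'a::{finite,linorder})"
proof -
  have Phi: "Phi_mat m \<in> carrier_mat (degree m) (degree m)" and Psi: "Psi_mat m \<in> carrier_mat 1 (degree m)"
    by (auto simp: Phi_mat_def Psi_mat_def)
  have "mat_app (G * Psi_mat m) x = (mat_app G (mat_app (Psi_mat m) x :: real^1) :: real^'a::{finite,linorder})"
    by (rule mat_app_mult[OF G Psi]) simp
  moreover have "(mat_app (Psi_mat m) x :: real^1) = (\<chi> _. row_app (Psi_mat m) x)"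
    by (simp add: row_app_def Finite_Cartesian_Product.vec_eq_iff forall_1)
  ultimately show ?thesis using G Phi Psi by (simp add: F_mat_def mat_app_add[of _ "degree m" "degree m"] col_app_def)
qed

subsection \<open>The follower network\<close>

definition grounded_laplacian :: "('i option \<Rightarrow> 'i option \<Rightarrow> real) \<Rightarrow> real^'i \<Rightarrow> real^'i::finite" where
  "grounded_laplacian A e = (\<chi> i. (\<Sum>j\<in>UNIV. A (Some i) (Some j) * (e $ i - e $ j)) + A (Some i) None * e $ i)"

text \<open>Subtracting the leader's output from every node leaves the differences unchanged and
  makes the leader's own error 0.\<close>

lemma e_virtual_eq_laplacian:
  "e_virtual A (node_output r \<mu> v y) i = grounded_laplacian A (\<chi> i. y $ i - r v \<mu>) $ i"
proof -
  have "(\<Sum>j\<in>UNIV. h j) = h None + (\<Sum>j\<in>UNIV. h (Some j))" for h :: "'a option \<Rightarrow> real"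
    by (simp add: UNIV_option_conv sum.reindex)
  then show ?thesis by (simp add: e_virtual_def grounded_laplacian_def)
qed

lemma linear_grounded_laplacian: "linear (grounded_laplacian A)"
  by (rule linearI)
    (simp_all add: Finite_Cartesian_Product.vec_eq_iff grounded_laplacian_def sum.distrib[symmetric] sum_distrib_left algebra_simps)

locale undirected_followers =
  fixes E :: "('i::finite option \<times> 'i option) set" and A :: "'i option \<Rightarrow> 'i option \<Rightarrow> real"
  assumes digraph: "weighted_digraph E A" and connectivity: "graph_connectivity E A"
begin

abbreviation "L \<equiv> grounded_laplacian A"

lemma A_nonneg: "0 \<le> A c d" and A_sym: "A (Some i) (Some j) = A (Some j) (Some i)"
  using digraph connectivity by (auto simp: weighted_digraph_def graph_connectivity_def)

text \<open>The weights towards the leader sit on the diagonal, so symmetry among the followers is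
  all that enters.\<close>

lemma laplacian_sym: "L e \<bullet> d = e \<bullet> L d"
proof -
  have L: "L e \<bullet> d = (\<Sum>i\<in>UNIV. \<Sum>j\<in>UNIV. A (Some i) (Some j) * (e $ i * d $ i)) - (\<Sum>i\<in>UNIV. \<Sum>j\<in>UNIV. A (Some i) (Some j) * (e $ j * d $ i))
     + (\<Sum>i\<in>UNIV. A (Some i) None * (e $ i * d $ i))" for e d :: "real^'i"
    by (simp add: inner_vec_def grounded_laplacian_def sum.distrib sum_subtractf sum_distrib_left sum_distrib_right algebra_simps)
  have "(\<Sum>i\<in>UNIV. \<Sum>j\<in>UNIV. A (Some i) (Some j) * (e $ j * d $ i)) = (\<Sum>i\<in>UNIV. \<Sum>j\<in>UNIV. A (Some i) (Some j) * (d $ j * e $ i))"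
    by (subst sum.swap) (simp add: A_sym mult.commute)
  then show ?thesis unfolding inner_commute[of e "L d"] L by (simp add: mult.commute)
qed

lemma laplacian_quadratic_form:
  "L e \<bullet> e = (\<Sum>i\<in>UNIV. \<Sum>j\<in>UNIV. A (Some i) (Some j) * (e $ i - e $ j)\<^sup>2) / 2 + (\<Sum>i\<in>UNIV. A (Some i) None * (e $ i)\<^sup>2)"
proof -
  let ?S = "\<Sum>i\<in>UNIV. \<Sum>j\<in>UNIV. A (Some i) (Some j) * (e $ i - e $ j) * e $ i"
  have "(\<Sum>i\<in>UNIV. \<Sum>j\<in>UNIV. A (Some i) (Some j) * (e $ i - e $ j) * e $ j) = (\<Sum>i\<in>UNIV. \<Sum>j\<in>UNIV. - (A (Some i) (Some j) * (e $ i - e $ j) * e $ i))"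
  proof (subst sum.swap, intro sum.cong refl)
    show "A (Some j) (Some i) * (e $ j - e $ i) * e $ i = - (A (Some i) (Some j) * (e $ i - e $ j) * e $ i)" for i j
      by (subst A_sym) (simp add: algebra_simps)
  qed
  then have sw: "(\<Sum>i\<in>UNIV. \<Sum>j\<in>UNIV. A (Some i) (Some j) * (e $ i - e $ j) * e $ j) = - ?S"
    by (simp add: sum_negf)
  have "A (Some i) (Some j) * (e $ i - e $ j)\<^sup>2 = A (Some i) (Some j) * (e $ i - e $ j) * e $ i - A (Some i) (Some j) * (e $ i - e $ j) * e $ j" for i j
    by (simp add: power2_eq_square algebra_simps)
  then have "(\<Sum>i\<in>UNIV. \<Sum>j\<in>UNIV. A (Some i) (Some j) * (e $ i - e $ j)\<^sup>2) = ?S - - ?S"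
    by (simp only: sum_subtractf sw)
  then show ?thesis
    by (simp add: inner_vec_def grounded_laplacian_def distrib_right sum.distrib sum_distrib_right power2_eq_square mult.assoc)
qed

lemma laplacian_form_nonneg: "0 \<le> L e \<bullet> e"
  unfolding laplacian_quadratic_form by (intro add_nonneg_nonneg divide_nonneg_nonneg sum_nonneg mult_nonneg_nonneg A_nonneg) auto

text \<open>All summands of the form vanish, so a zero error propagates along every edge. The
  leader, whose error counts as zero, reaches every follower by a walk.\<close>

lemma laplacian_form_eq_0:
  assumes "L e \<bullet> e = 0"
  shows "e = 0"
proof -
  let ?S1 = "\<Sum>i\<in>UNIV. \<Sum>j\<in>UNIV. A (Some i) (Some j) * (e $ i - e $ j)\<^sup>2" and ?S2 = "\<Sum>i\<in>UNIV. A (Some i) None * (e $ i)\<^sup>2"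
  have "0 \<le> ?S1" "0 \<le> ?S2" by (intro sum_nonneg mult_nonneg_nonneg A_nonneg; simp)+
  then have "?S1 = 0" "?S2 = 0" using assms unfolding laplacian_quadratic_form by linarith+
  then have z1: "\<And>i j. A (Some i) (Some j) * (e $ i - e $ j)\<^sup>2 = 0" and z2: "\<And>i. A (Some i) None * (e $ i)\<^sup>2 = 0"
    by (simp_all add: sum_nonneg_eq_0_iff sum_nonneg A_nonneg)
  define Z where "Z c = (case c of None \<Rightarrow> True | Some i \<Rightarrow> e $ i = 0)" for c
  have edge: "Z d" if "(c, d) \<in> E" "Z c" for c d
  proof -
    have "A d c > 0" using that(1) digraph by (simp add: weighted_digraph_def)
    show ?thesis
    proof (cases d)
      case (Some i)
      show ?thesis
      proof (cases c)
        case None then show ?thesis using Some z2[of i] \<open>A d c > 0\<close> by (simp add: Z_def)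
      next
        case (Some j) then show ?thesis using \<open>d = Some i\<close> z1[of i j] that(2) \<open>A d c > 0\<close> by (simp add: Z_def)
      qed
    qed (simp add: Z_def)
  qed
  have walk: "Z (last xs)" if "xs \<noteq> []" "Z (hd xs)" "successively (\<lambda>c d. (c, d) \<in> E) xs" for xs
    using that
  proof (induction xs rule: induct_list012)
    case (3 x y zs)
    then show ?case using edge by (auto simp: successively_Cons)
  qed auto
  have "e $ i = 0" for i
  proof -
    obtain xs where "directed_walk E xs None (Some i)" using connectivity unfolding graph_connectivity_def by blast
    then have "Z (Some i)" using walk[of xs] by (auto simp: directed_walk_def Z_def)
    then show ?thesis by (simp add: Z_def)
  qed
  then show ?thesis by (simp add: Finite_Cartesian_Product.vec_eq_iff)
qed

lemma laplacian_coercive: "\<exists>c>0. \<forall>e. c * (norm e)\<^sup>2 \<le> L e \<bullet> e"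
proof -
  have cont: "continuous_on (sphere 0 1) (\<lambda>e. L e \<bullet> e)"
    by (intro continuous_intros linear_continuous_on) (simp add: linear_conv_bounded_linear[symmetric] linear_grounded_laplacian)
  have "axis (undefined::'i) (1::real) \<in> sphere 0 1" by simp
  then obtain e0 where e0: "e0 \<in> sphere 0 1" "\<And>e. e \<in> sphere 0 1 \<Longrightarrow> L e0 \<bullet> e0 \<le> L e \<bullet> e"
    using continuous_attains_inf[OF compact_sphere _ cont] by blast
  define c where "c = L e0 \<bullet> e0"
  have "e0 \<noteq> 0" using e0(1) by auto
  then have c: "c > 0" using laplacian_form_nonneg[of e0] laplacian_form_eq_0[of e0] by (force simp: c_def)
  have "c * (norm e)\<^sup>2 \<le> L e \<bullet> e" for e
  proof (cases "e = 0")
    case False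
    have "c \<le> L (e /\<^sub>R norm e) \<bullet> (e /\<^sub>R norm e)" unfolding c_def using False by (intro e0) simp
    also have "\<dots> = L e \<bullet> e / (norm e)\<^sup>2" by (simp add: linear_scale[OF linear_grounded_laplacian] power2_eq_square divide_inverse)
    finally show ?thesis using False by (simp add: field_simps)
  qed simp
  then show ?thesis using c by blast
qed

lemma norm_le_laplacian: "\<exists>k\<ge>0. \<forall>e. norm e \<le> k * norm (L e)"
proof -
  obtain c where c: "c > 0" "\<And>e. c * (norm e)\<^sup>2 \<le> L e \<bullet> e" using laplacian_coercive by blast
  have "norm e \<le> 1 / c * norm (L e)" for e
  proof (cases "e = 0")
    case False
    have "c * norm e * norm e \<le> norm (L e) * norm e"
      using c(2)[of e] norm_cauchy_schwarz[of "L e" e] by (simp add: power2_eq_square mult.assoc)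
    then show ?thesis using False c(1) by (simp add: field_simps)
  qed (use c(1) in simp)
  then show ?thesis using c(1) by (intro exI[of _ "1 / c"]) auto
qed

text \<open>Makes all sign patterns of the virtual errors attainable by moving the outputs, which
  the Filippov set of the closed loop needs.\<close>

lemma laplacian_surj: "\<exists>e. L e = d"
proof -
  have "inj L"
    using linear_injective_0[OF linear_grounded_laplacian] laplacian_form_eq_0 by (metis inner_zero_left)
  then have "surj L" using linear_injective_imp_surjective[OF linear_grounded_laplacian] by blast
  then show ?thesis by (metis surjD)
qed

end

subsection \<open>Changing the supply rate and choosing the gain\<close>

lemma class_Kinf_D:
  assumes "class_Kinf \<alpha>"
  shows "0 \<le> s \<Longrightarrow> s \<le> t \<Longrightarrow> \<alpha> s \<le> \<alpha> t" "0 < s \<Longrightarrow> 0 < \<alpha> s" "0 \<le> s \<Longrightarrow> 0 \<le> \<alpha> s"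
    "\<exists>r. \<forall>s\<ge>r. c < \<alpha> s"
proof -
  have sm: "strict_mono_on {0..} \<alpha>" "\<alpha> 0 = 0" and lim: "filterlim \<alpha> at_top at_top"
    using assms unfolding class_Kinf_def class_K_def by (auto simp: atLeast_def)
  show mono: "0 \<le> s \<Longrightarrow> s \<le> t \<Longrightarrow> \<alpha> s \<le> \<alpha> t" for s t
    using strict_mono_onD[OF sm(1), of s t] by (cases "s = t") auto
  show "0 < s \<Longrightarrow> 0 < \<alpha> s" using strict_mono_onD[OF sm(1), of 0 s] sm(2) by auto
  show "0 \<le> s \<Longrightarrow> 0 \<le> \<alpha> s" using mono[of 0 s] sm(2) by auto
  show "\<exists>r. \<forall>s\<ge>r. c < \<alpha> s" using lim by (simp add: filterlim_at_top_dense eventually_at_top_linorder)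
qed

text \<open>Composing the Lyapunov function with the antiderivative of a fast growing function makes its dissipation dominate
  any prescribed function of the state, at the price of a larger supply. As a constant supply is allowed, only the
  behaviour for large states matters.\<close>

lemma supply_change:
  fixes V :: "'a::euclidean_space \<Rightarrow> real" and fb :: "'a \<Rightarrow> real \<Rightarrow> 'p \<Rightarrow> 'a" and a :: "'a \<Rightarrow> real \<Rightarrow> 'p \<Rightarrow> real"
  assumes V: "C1 V V'" and \<alpha>1: "class_Kinf \<alpha>1" and V\<alpha>: "\<And>z. z \<in> Z \<Longrightarrow> \<alpha>1 (norm z) \<le> V z"
    and \<alpha>: "class_Kinf \<alpha>" and \<gamma>1: "continuous_on UNIV \<gamma>1"
    and diss: "\<And>p z e. p \<in> \<Sigma> \<Longrightarrow> z \<in> Z \<Longrightarrow> V' z (fb z e p) \<le> - \<alpha> (norm z) + \<gamma>1 e + \<beta>"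
    and drift: "\<And>r. \<exists>H. \<forall>p z e. p \<in> \<Sigma> \<longrightarrow> z \<in> Z \<longrightarrow> norm z \<le> r \<longrightarrow> \<bar>e\<bar> \<le> r \<longrightarrow> (a z e p)\<^sup>2 \<le> H"
    and C: "C \<ge> 0"
  obtains W W' where "C1 W W'" "\<And>z. z \<in> Z \<Longrightarrow> 0 \<le> W z" "\<And>c. \<exists>R. \<forall>z\<in>Z. W z \<le> c \<longrightarrow> norm z \<le> R"
    "\<And>R. \<exists>B. \<forall>e p z. \<bar>e\<bar> \<le> R \<longrightarrow> p \<in> \<Sigma> \<longrightarrow> z \<in> Z \<longrightarrow> W' z (fb z e p) + C * (a z e p)\<^sup>2 \<le> - norm z + B"
proof -
  obtain H where H: "\<And>r p z e. p \<in> \<Sigma> \<Longrightarrow> z \<in> Z \<Longrightarrow> norm z \<le> r \<Longrightarrow> \<bar>e\<bar> \<le> r \<Longrightarrow> (a z e p)\<^sup>2 \<le> H r"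
    using drift by metis
  have sub: "\<exists>R\<ge>0. \<forall>z\<in>Z. V z \<le> c \<longrightarrow> norm z \<le> R" for c
  proof -
    obtain r where r: "\<And>s. s \<ge> r \<Longrightarrow> c < \<alpha>1 s" using class_Kinf_D(4)[OF \<alpha>1] by metis
    have "norm z \<le> max r 0" if "z \<in> Z" "V z \<le> c" for z
      using r[of "norm z"] V\<alpha>[OF that(1)] that(2) by (cases "norm z \<le> r") auto
    then show ?thesis by (intro exI[of _ "max r 0"]) auto
  qed
  have \<alpha>1pos: "\<alpha> 1 > 0" using class_Kinf_D(2)[OF \<alpha>] by simp
  \<comment> \<open>What \<open>\<rho>\<close> must exceed at the value s of V. For large z the
    derivative of V is at most \<open>- \<alpha> 1 / 2\<close>, so a factor of this size pays for
    both \<open>C * (a z e p)\<^sup>2\<close> and \<open>norm z\<close>. Restricting to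
    \<open>\<bar>e\<bar> \<le> norm z\<close> keeps the demand bounded on sublevel sets of
    V.\<close>
  define Dom where "Dom s = {y. \<exists>z e p. z \<in> Z \<and> p \<in> \<Sigma> \<and> V z = s \<and> \<bar>e\<bar> \<le> norm z \<and> y = 2 / \<alpha> 1 * (C * (a z e p)\<^sup>2 + norm z)}" for s
  have "\<exists>b. \<forall>s y. \<bar>s\<bar> \<le> R \<longrightarrow> y \<in> Dom s \<longrightarrow> y \<le> b" for R
  proof -
    obtain r where r: "\<And>z. z \<in> Z \<Longrightarrow> V z \<le> R \<Longrightarrow> norm z \<le> r" using sub by blast
    have "y \<le> 2 / \<alpha> 1 * (C * H r + r)" if s: "\<bar>s\<bar> \<le> R" and y: "y \<in> Dom s" for s y
    proof -
      obtain z e p where z: "z \<in> Z" "p \<in> \<Sigma>" "V z = s" "\<bar>e\<bar> \<le> norm z" "y = 2 / \<alpha> 1 * (C * (a z e p)\<^sup>2 + norm z)"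
        using y unfolding Dom_def by blast
      have nz: "norm z \<le> r" using r[OF z(1)] z(3) s by auto
      have "C * (a z e p)\<^sup>2 + norm z \<le> C * H r + r"
        using H[OF z(2,1) nz, of e] z(4) nz C by (intro add_mono mult_left_mono) auto
      then show ?thesis unfolding z(5) using \<alpha>1pos by (intro mult_left_mono) auto
    qed
    then show ?thesis by blast
  qed
  then obtain \<rho> where \<rho>: "smooth_on UNIV \<rho>" "\<And>s. 1 \<le> \<rho> s" "\<And>s y. y \<in> Dom s \<Longrightarrow> y \<le> \<rho> s"
    using smooth_dominating[of Dom] by metis
  obtain \<theta> where \<theta>: "C1 \<theta> (\<lambda>s h. h * \<rho> s)" "\<theta> 0 = 0"
    using C1_antiderivative[OF smooth_on_real_continuous[OF \<rho>(1)]] by metis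
  have \<theta>ge: "s \<le> \<theta> s" if "s \<ge> 0" for s
  proof -
    have D: "DERIV \<theta> x :> \<rho> x" for x
    proof -
      have "(\<lambda>h. h * \<rho> x) = (*) (\<rho> x)" by (simp add: fun_eq_iff mult.commute)
      then show ?thesis using C1_D(1)[OF \<theta>(1), of x] by (simp add: has_field_derivative_def)
    qed
    have "(\<lambda>s. \<theta> s - s) 0 \<le> (\<lambda>s. \<theta> s - s) s"
    proof (rule DERIV_nonneg_imp_nondecreasing[OF that])
      fix x
      show "\<exists>y. ((\<lambda>s. \<theta> s - s) has_real_derivative y) (at x) \<and> 0 \<le> y"
        using \<rho>(2)[of x] by (intro exI[of _ "\<rho> x - 1"] conjI) (auto intro!: derivative_eq_intros D)
    qed
    then show ?thesis by (simp add: \<theta>(2))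
  qed
  have V0: "0 \<le> V z" if "z \<in> Z" for z using V\<alpha>[OF that] class_Kinf_D(3)[OF \<alpha>1, of "norm z"] by simp
  define W where "W z = \<theta> (V z)" for z
  define W' where "W' z h = V' z h * \<rho> (V z)" for z h
  have W1: "C1 W W'" using C1_compose[OF V \<theta>(1)] by (simp add: W_def[abs_def] W'_def[abs_def])
  have VW: "V z \<le> W z" if "z \<in> Z" for z using \<theta>ge[OF V0[OF that]] by (simp add: W_def)
  show ?thesis
  proof (rule that[OF W1])
    show "0 \<le> W z" if "z \<in> Z" for z using VW[OF that] V0[OF that] by simp
    show "\<exists>R. \<forall>z\<in>Z. W z \<le> c \<longrightarrow> norm z \<le> R" for c using sub[of c] VW by (meson order_trans)
    fix R
    have "bounded (\<gamma>1 ` {-R..R})"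
      by (intro compact_imp_bounded compact_continuous_image continuous_on_subset[OF \<gamma>1]) auto
    then obtain g1 where g1: "g1 > 0" "\<And>e. \<bar>e\<bar> \<le> R \<Longrightarrow> \<bar>\<gamma>1 e\<bar> \<le> g1"
      unfolding bounded_pos by force
    define k where "k = g1 + \<bar>\<beta>\<bar>"
    have k: "k \<ge> 0" "\<And>e. \<bar>e\<bar> \<le> R \<Longrightarrow> \<gamma>1 e + \<beta> \<le> k" using g1 by (auto simp: k_def) (smt (verit) g1(2))
    obtain r1 where r1: "\<And>s. s \<ge> r1 \<Longrightarrow> 2 * k < \<alpha> s" using class_Kinf_D(4)[OF \<alpha>] by metis
    \<comment> \<open>Beyond r0 three things hold:
      \<open>\<alpha> (norm z) \<ge> \<alpha> 1\<close>, the error is at most \<open>norm z\<close>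
      as \<open>Dom\<close> demands, and the supply is at most half of
      \<open>\<alpha> (norm z)\<close>.\<close>
    define r0 where "r0 = max 1 (max R r1)"
    have "bounded ((\<lambda>z. \<rho> (V z)) ` cball 0 r0)"
      by (intro compact_imp_bounded compact_continuous_image continuous_on_compose2[OF smooth_on_real_continuous[OF \<rho>(1)]]
          continuous_on_subset[OF C1_D(4)[OF V]]) auto
    then obtain \<rho>m where \<rho>m: "\<And>z. norm z \<le> r0 \<Longrightarrow> \<bar>\<rho> (V z)\<bar> \<le> \<rho>m" unfolding bounded_iff by force
    define B where "B = \<bar>k * \<rho>m\<bar> + C * \<bar>H r0\<bar> + \<bar>r0\<bar>"
    have B: "B \<ge> 0" using C by (simp add: B_def)
    have "W' z (fb z e p) + C * (a z e p)\<^sup>2 \<le> - norm z + B" if e: "\<bar>e\<bar> \<le> R" and p: "p \<in> \<Sigma>" and z: "z \<in> Z" for e p z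
    proof (cases "r0 \<le> norm z")
      case True
      then have nz: "norm z \<ge> 1" "norm z \<ge> R" "norm z \<ge> r1" by (auto simp: r0_def)
      have "V' z (fb z e p) \<le> - \<alpha> (norm z) + k" using diss[OF p z, of e] k(2)[OF e] by linarith
      also have "\<dots> \<le> - \<alpha> (norm z) / 2" using r1[OF nz(3)] by linarith
      also have "\<dots> \<le> - \<alpha> 1 / 2" using class_Kinf_D(1)[OF \<alpha>, of 1 "norm z"] nz by simp
      finally have "W' z (fb z e p) \<le> - \<alpha> 1 / 2 * \<rho> (V z)"
        unfolding W'_def using \<rho>(2)[of "V z"] by (intro mult_right_mono) auto
      moreover have "2 / \<alpha> 1 * (C * (a z e p)\<^sup>2 + norm z) \<le> \<rho> (V z)"
        using z p order_trans[OF e nz(2)]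
        by (intro \<rho>(3)) (unfold Dom_def, intro CollectI exI[of _ z] exI[of _ e] exI[of _ p] conjI refl)
      then have "C * (a z e p)\<^sup>2 + norm z \<le> \<alpha> 1 / 2 * \<rho> (V z)" using \<alpha>1pos by (simp add: field_simps)
      ultimately show ?thesis using B by linarith
    next
      case False
      then have nz: "norm z \<le> r0" by simp
      have "0 \<le> \<alpha> (norm z)" by (rule class_Kinf_D(3)[OF \<alpha>]) simp
      then have "V' z (fb z e p) \<le> k" using diss[OF p z, of e] k(2)[OF e] by linarith
      then have "W' z (fb z e p) \<le> k * \<rho> (V z)" unfolding W'_def using \<rho>(2)[of "V z"] by (intro mult_right_mono) auto
      also have "\<dots> \<le> k * \<rho>m" using \<rho>m[OF nz] k(1) by (intro mult_left_mono) auto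
      finally have "W' z (fb z e p) \<le> \<bar>k * \<rho>m\<bar>" by simp
      moreover have "C * (a z e p)\<^sup>2 \<le> C * \<bar>H r0\<bar>"
      proof (intro mult_left_mono C)
        have "\<bar>e\<bar> \<le> r0" using e by (simp add: r0_def)
        then show "(a z e p)\<^sup>2 \<le> \<bar>H r0\<bar>" using H[OF p z nz] abs_ge_self order_trans by blast
      qed
      ultimately show ?thesis using nz unfolding B_def by linarith
    qed
    then show "\<exists>B. \<forall>e p z. \<bar>e\<bar> \<le> R \<longrightarrow> p \<in> \<Sigma> \<longrightarrow> z \<in> Z \<longrightarrow> W' z (fb z e p) + C * (a z e p)\<^sup>2 \<le> - norm z + B" by blast
  qed
qed

text \<open>Let s be the virtual error of largest modulus. It bounds all of e, so the sum of the T
  terms is bounded by a function of s, which \<open>\<rho>\<close> can dominate. For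
  \<open>\<bar>s\<bar> \<ge> 1\<close> the single term \<open>\<rho> s * s\<^sup>2\<close> absorbs
  everything; for smaller s everything is bounded by the constant c0.\<close>

lemma choose_gain:
  fixes T :: "'i::finite \<Rightarrow> 'a \<Rightarrow> real \<Rightarrow> 'p \<Rightarrow> real" and L :: "real^'i \<Rightarrow> real^'i"
  assumes T: "\<And>i R. \<exists>B. \<forall>e p z. \<bar>e\<bar> \<le> R \<longrightarrow> p \<in> \<Sigma> \<longrightarrow> z \<in> Z i \<longrightarrow> T i z e p \<le> B"
    and k: "k \<ge> 0" "\<And>e. norm e \<le> k * norm (L e)"
  obtains \<rho> c0 where "smooth_on UNIV \<rho>" "\<And>s. 1 \<le> \<rho> s"
    "\<And>p z e. p \<in> \<Sigma> \<Longrightarrow> (\<And>i. z i \<in> Z i) \<Longrightarrow>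
       (\<Sum>i\<in>UNIV. T i (z i) (e $ i) p) + 4 * (\<Sum>i\<in>UNIV. (L e $ i)\<^sup>2) - (\<Sum>i\<in>UNIV. \<rho> (L e $ i) * (L e $ i)\<^sup>2) \<le> c0"
proof -
  define n where "n = real CARD('i)"
  \<comment> \<open>Truncated at 0 because it is later multiplied by
    \<open>s\<^sup>2 \<ge> 1\<close>, which may only increase it.\<close>
  define Y where "Y p z e = max 0 (\<Sum>i\<in>UNIV. T i (z i) (e $ i) p)" for p z and e :: "real^'i"
  have Yb: "\<exists>B. \<forall>p z e. p \<in> \<Sigma> \<longrightarrow> (\<forall>i. z i \<in> Z i) \<longrightarrow> (\<forall>j. \<bar>L e $ j\<bar> \<le> R) \<longrightarrow> Y p z e \<le> B" for R
  proof -
    obtain B where B: "\<And>i e p z. \<bar>e\<bar> \<le> k * (n * R) \<Longrightarrow> p \<in> \<Sigma> \<Longrightarrow> z \<in> Z i \<Longrightarrow> T i z e p \<le> B i"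
      using T[where R = "k * (n * R)"] by metis
    have "Y p z e \<le> max 0 (\<Sum>i\<in>UNIV. B i)" if "p \<in> \<Sigma>" "\<forall>i. z i \<in> Z i" "\<forall>j. \<bar>L e $ j\<bar> \<le> R" for p z e
    proof -
      have "norm (L e) \<le> (\<Sum>j\<in>UNIV. \<bar>L e $ j\<bar>)" by (rule norm_le_l1_cart)
      also have "\<dots> \<le> (\<Sum>j\<in>(UNIV::'i set). R)" using that(3) by (intro sum_mono) auto
      finally have "norm (L e) \<le> n * R" by (simp add: n_def)
      then have "norm e \<le> k * (n * R)" using k(2)[of e] mult_left_mono[OF _ k(1)] by (meson order_trans)
      then have "\<bar>e $ i\<bar> \<le> k * (n * R)" for i using component_le_norm_cart[of e i] by simp
      then have "(\<Sum>i\<in>UNIV. T i (z i) (e $ i) p) \<le> (\<Sum>i\<in>UNIV. B i)" using that B by (intro sum_mono) auto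
      then show ?thesis by (auto simp: Y_def)
    qed
    then show ?thesis by blast
  qed
  define Dom where "Dom s = {y. \<exists>p z e. p \<in> \<Sigma> \<and> (\<forall>i. z i \<in> Z i) \<and> (\<forall>j. \<bar>L e $ j\<bar> \<le> \<bar>s\<bar>) \<and> y = Y p z e + 4 * n}" for s
  have "\<exists>b. \<forall>s y. \<bar>s\<bar> \<le> R \<longrightarrow> y \<in> Dom s \<longrightarrow> y \<le> b" for R
  proof -
    obtain B where B: "\<And>p z e. p \<in> \<Sigma> \<Longrightarrow> (\<forall>i. z i \<in> Z i) \<Longrightarrow> (\<forall>j. \<bar>L e $ j\<bar> \<le> R) \<Longrightarrow> Y p z e \<le> B" using Yb by metis
    have "y \<le> B + 4 * n" if s: "\<bar>s\<bar> \<le> R" and y: "y \<in> Dom s" for s y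
    proof -
      obtain p z e where pze: "p \<in> \<Sigma>" "\<forall>i. z i \<in> Z i" "\<forall>j. \<bar>L e $ j\<bar> \<le> \<bar>s\<bar>" "y = Y p z e + 4 * n"
        using y unfolding Dom_def by blast
      have "\<forall>j. \<bar>L e $ j\<bar> \<le> R" using pze(3) s order_trans by blast
      then show ?thesis using B[of p z e] pze by auto
    qed
    then show ?thesis by blast
  qed
  then obtain \<rho> where \<rho>: "smooth_on UNIV \<rho>" "\<And>s. 1 \<le> \<rho> s" "\<And>s y. y \<in> Dom s \<Longrightarrow> y \<le> \<rho> s"
    using smooth_dominating[of Dom] by metis
  obtain B1 where B1: "\<And>p z e. p \<in> \<Sigma> \<Longrightarrow> (\<forall>i. z i \<in> Z i) \<Longrightarrow> (\<forall>j. \<bar>L e $ j\<bar> \<le> 1) \<Longrightarrow> Y p z e \<le> B1" using Yb by metis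
  have n0: "n \<ge> 0" by (simp add: n_def)
  show ?thesis
  proof (rule that[OF \<rho>(1,2)])
    fix p and z :: "'i \<Rightarrow> 'a" and e :: "real^'i" assume p: "p \<in> \<Sigma>" and z: "\<And>i. z i \<in> Z i"
    have pos: "0 \<le> \<rho> s * s\<^sup>2" for s using \<rho>(2)[of s] by (intro mult_nonneg_nonneg) auto
    obtain j where j: "\<And>i. \<bar>L e $ i\<bar> \<le> \<bar>L e $ j\<bar>"
    proof -
      have "Max (range (\<lambda>i. \<bar>L e $ i\<bar>)) \<in> range (\<lambda>i. \<bar>L e $ i\<bar>)" by (intro Max_in) auto
      then obtain j where "Max (range (\<lambda>i. \<bar>L e $ i\<bar>)) = \<bar>L e $ j\<bar>" by (rule rangeE)
      then show ?thesis using that[of j] Max_ge[of "range (\<lambda>i. \<bar>L e $ i\<bar>)"] by auto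
    qed
    let ?s = "L e $ j"
    have "(\<Sum>i\<in>UNIV. (L e $ i)\<^sup>2) \<le> (\<Sum>i\<in>(UNIV::'i set). ?s\<^sup>2)" using j by (intro sum_mono) (simp add: abs_le_square_iff)
    then have sq: "(\<Sum>i\<in>UNIV. (L e $ i)\<^sup>2) \<le> n * ?s\<^sup>2" by (simp add: n_def)
    have "\<rho> ?s * ?s\<^sup>2 \<le> (\<Sum>i\<in>UNIV. \<rho> (L e $ i) * (L e $ i)\<^sup>2)"
      using pos by (intro member_le_sum) auto
    moreover have TY: "(\<Sum>i\<in>UNIV. T i (z i) (e $ i) p) \<le> Y p z e" "0 \<le> Y p z e" by (auto simp: Y_def)
    moreover have "Y p z e + 4 * (n * ?s\<^sup>2) \<le> \<rho> ?s * ?s\<^sup>2 + (\<bar>B1\<bar> + 4 * n)"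
    proof (cases "\<bar>?s\<bar> \<le> 1")
      case True
      then have "?s\<^sup>2 \<le> 1" by (simp add: abs_square_le_1)
      then have "n * ?s\<^sup>2 \<le> n" using n0 by (simp add: mult_left_le)
      moreover have "Y p z e \<le> B1" using B1[OF p] z j True order_trans by blast
      ultimately show ?thesis using pos[of ?s] by linarith
    next
      case False
      then have "\<not> ?s\<^sup>2 \<le> 1" by (simp add: abs_square_le_1)
      then have s1: "1 \<le> ?s\<^sup>2" by linarith
      have "Y p z e + 4 * n \<le> \<rho> ?s" using p z j by (intro \<rho>(3)) (auto simp: Dom_def)
      then have "(Y p z e + 4 * n) * ?s\<^sup>2 \<le> \<rho> ?s * ?s\<^sup>2" by (intro mult_right_mono) auto
      moreover have "Y p z e * 1 \<le> Y p z e * ?s\<^sup>2" using TY(2) s1 by (intro mult_left_mono)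
      ultimately show ?thesis using n0 by (simp add: algebra_simps)
    qed
    ultimately show "(\<Sum>i\<in>UNIV. T i (z i) (e $ i) p) + 4 * (\<Sum>i\<in>UNIV. (L e $ i)\<^sup>2) - (\<Sum>i\<in>UNIV. \<rho> (L e $ i) * (L e $ i)\<^sup>2) \<le> \<bar>B1\<bar> + 4 * n"
      using sq by linarith
  qed
qed

subsection \<open>The closed loop in error coordinates\<close>

text \<open>The partial derivative is the joint derivative in the direction \<open>(h, 0)\<close>,
  and so depends continuously on the parameter as well.\<close>

lemma smooth_on_partial:
  fixes f :: "'a::euclidean_space \<Rightarrow> 'b::euclidean_space \<Rightarrow> 'c::euclidean_space"
  assumes f: "smooth_on UNIV (\<lambda>(v, \<mu>). f v \<mu>)"
  shows C1_partial: "C1 (\<lambda>v. f v \<mu>) (\<lambda>v. frechet_derivative (\<lambda>v. f v \<mu>) (at v))"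
    and continuous_on_partial_derivative: "continuous_on S v \<Longrightarrow> continuous_on S m \<Longrightarrow> continuous_on S h \<Longrightarrow>
      continuous_on S (\<lambda>x. frechet_derivative (\<lambda>v. f v (m x)) (at (v x)) (h x))"
    and continuous_on_smooth2: "continuous_on S v \<Longrightarrow> continuous_on S m \<Longrightarrow> continuous_on S (\<lambda>x. f (v x) (m x))"
proof -
  let ?F = "\<lambda>(v, \<mu>). f v \<mu>"
  let ?F' = "\<lambda>x. frechet_derivative ?F (at x)"
  have F: "C1 ?F ?F'" by (rule smooth_on_C1[OF f])
  have D: "((\<lambda>v. f v \<mu>) has_derivative (\<lambda>h. ?F' (v, \<mu>) (h, 0))) (at v)" for v \<mu>
  proof -
    have "((\<lambda>v. (v, \<mu>)) has_derivative (\<lambda>h. (h, 0))) (at v)" by (auto intro!: derivative_eq_intros)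
    from has_derivative_compose[OF this C1_D(1)[OF F]] show ?thesis by simp
  qed
  have eq: "frechet_derivative (\<lambda>v. f v \<mu>) (at v) = (\<lambda>h. ?F' (v, \<mu>) (h, 0))" for v \<mu>
    using frechet_derivative_at[OF D] by simp
  show "continuous_on S (\<lambda>x. frechet_derivative (\<lambda>v. f v (m x)) (at (v x)) (h x))"
    if "continuous_on S v" "continuous_on S m" "continuous_on S h" for S :: "'d::topological_space set" and v m h
    unfolding eq by (intro C1_joint[OF F] continuous_intros that)
  show "C1 (\<lambda>v. f v \<mu>) (\<lambda>v. frechet_derivative (\<lambda>v. f v \<mu>) (at v))"
    unfolding C1_def eq by (intro conjI allI D C1_joint[OF F] continuous_intros)
  show "continuous_on S (\<lambda>x. f (v x) (m x))" if "continuous_on S v" "continuous_on S m" for S :: "'e::topological_space set" and v m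
    using continuous_on_compose2[OF C1_D(4)[OF F], of S "\<lambda>x. (v x, m x)"] that by (auto intro!: continuous_intros)
qed

lemma continuous_on_smooth3:
  fixes f :: "'a::euclidean_space \<Rightarrow> 'b::euclidean_space \<Rightarrow> 'c::euclidean_space \<Rightarrow> 'd::euclidean_space"
  assumes f: "smooth_on UNIV (\<lambda>(z, y, \<mu>). f z y \<mu>)"
    and "continuous_on S z" "continuous_on S y" "continuous_on S m"
  shows "continuous_on S (\<lambda>x. f (z x) (y x) (m x))"
  using continuous_on_compose2[OF C1_D(4)[OF smooth_on_C1[OF f]]
      continuous_on_Pair[OF assms(2) continuous_on_Pair[OF assms(3,4)]]] by simp

lemma continuous_on_matrix_vector_mult:
  fixes Q :: "'a::topological_space \<Rightarrow> real^'w^'v"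
  assumes "continuous_on S Q" "continuous_on S w"
  shows "continuous_on S (\<lambda>x. Q x *v w x)"
  unfolding matrix_vector_mult_def by (intro continuous_intros assms)

lemma linear_imp_continuous_on:
  fixes f :: "'a::euclidean_space \<Rightarrow> 'b::real_normed_vector"
  assumes "linear f" "continuous_on S g"
  shows "continuous_on S (\<lambda>x. f (g x))"
  using continuous_on_compose2[OF linear_continuous_on[of f UNIV] assms(2)] assms(1) by (simp add: linear_conv_bounded_linear)

abbreviation "st_v \<equiv> (\<lambda>s. fst s)"
abbreviation "st_z \<equiv> (\<lambda>s. fst (snd s))"
abbreviation "st_y \<equiv> (\<lambda>s. fst (snd (snd s)))"
abbreviation "st_\<omega> \<equiv> (\<lambda>s. fst (snd (snd (snd s))))"
abbreviation "st_\<eta> \<equiv> (\<lambda>s. snd (snd (snd (snd s))))"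

text \<open>The parameter \<open>dim_o\<close> fixes the ambient type 'o of the disturbance and
  internal model states, which occurs in the type of no other parameter.\<close>

locale leader_follower = undirected_followers E A
  for E :: "('i::finite option \<times> 'i option) set" and A :: "'i option \<Rightarrow> 'i option \<Rightarrow> real" +
  fixes p :: "real^'v \<Rightarrow> real^'v"
    and q :: "real^'v \<Rightarrow> real^'w^'v"
    and r :: "real^'v \<Rightarrow> real^'m \<Rightarrow> real"
    and l :: real
    and nz nom :: "'i \<Rightarrow> nat"
    and f :: "'i \<Rightarrow> real^'z::{finite,linorder} \<Rightarrow> real \<Rightarrow> real^'m \<Rightarrow> real^'z::{finite,linorder}"
    and g :: "'i \<Rightarrow> real^'z::{finite,linorder} \<Rightarrow> real \<Rightarrow> real^'m \<Rightarrow> real"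
    and S :: "'i \<Rightarrow> real mat"
    and D :: "'i \<Rightarrow> real^'m \<Rightarrow> real mat"
    and zs :: "'i \<Rightarrow> real^'v \<Rightarrow> real^'m \<Rightarrow> real^'z::{finite,linorder}"
    and m :: "'i \<Rightarrow> real poly"
    and G :: "'i \<Rightarrow> real mat"
    and dim_o :: "'o::{finite,linorder} itself"
  assumes nom_le: "\<And>i. nom i \<le> CARD('o)"
    and leader_smooth: "smooth_on UNIV p" "smooth_on UNIV q" "smooth_on UNIV (\<lambda>(v, \<mu>). r v \<mu>)"
    and follower_dims:
      "\<And>i y \<mu>. depends_on (nz i) (\<lambda>z. f i z y \<mu>)" "\<And>i z y \<mu>. f i z y \<mu> \<in> coord_space (nz i)"
      "\<And>i y \<mu>. depends_on (nz i) (\<lambda>z. g i z y \<mu>)"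
    and follower_smooth:
      "\<And>i. smooth_on UNIV (\<lambda>(z, y, \<mu>). f i z y \<mu>)" "\<And>i. smooth_on UNIV (\<lambda>(z, y, \<mu>). g i z y \<mu>)"
    and disturbance: "\<And>i. S i \<in> carrier_mat (nom i) (nom i)"
      "\<And>i \<mu>. D i \<mu> \<in> carrier_mat 1 (nom i)"
    and leader_stable: "leader_stability p q l"
    and regulator: "\<And>i. regulator_solution p r (nz i) (f i) (zs i)"
    and iss: "\<And>i. error_dynamics_iss q r (nz i) (f i) (zs i)"
    and minimal_poly: "\<And>i. is_minimal_poly (S i) (m i)"
    and internal_model: "\<And>i. G i \<in> carrier_mat (degree (m i)) 1"
      "\<And>i. hurwitz (F_mat (m i) (G i))"
begin

abbreviation np :: "'i \<Rightarrow> nat" where "np i \<equiv> degree (m i)"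

lemma np_le: "np i \<le> CARD('o)"
  by (rule degree_le_card[OF disturbance(1,2) minimal_poly nom_le])

lemma zs: "smooth_on UNIV (\<lambda>(v, \<mu>). zs i v \<mu>)" "zs i v \<mu> \<in> coord_space (nz i)"
  "frechet_derivative (\<lambda>v. zs i v \<mu>) (at v) (p v) = f i (zs i v \<mu>) (r v \<mu>) \<mu>"
  using regulator[of i] by (auto simp: regulator_solution_def)

text \<open>Primed functions of the state are directional derivatives. In \<open>xt\<close>, the internal model state is taken relative to its
  steady state \<open>immersion\<close>; subtracting \<open>G e\<close> removes the control from its equation.\<close>

definition r' :: "real^'v \<Rightarrow> real^'m \<Rightarrow> real^'v \<Rightarrow> real" where
  "r' v \<mu> = frechet_derivative (\<lambda>v. r v \<mu>) (at v)"

definition err :: "real^'m \<Rightarrow> ('v, 'z, 'o, 'i) cl_state \<Rightarrow> real^'i" where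
  "err \<mu> s = st_y s - (\<chi> i. r (st_v s) \<mu>)"

definition err' :: "real^'m \<Rightarrow> ('v, 'z, 'o, 'i) cl_state \<Rightarrow> ('v, 'z, 'o, 'i) cl_state \<Rightarrow> real^'i" where
  "err' \<mu> s h = st_y h - (\<chi> i. r' (st_v s) \<mu> (st_v h))"

text \<open>The projection puts the error into \<open>coord_space\<close> at every ambient state, so
  dissipation inequalities that are valid only there can be used at all states.\<close>

definition zbar :: "real^'m \<Rightarrow> 'i \<Rightarrow> ('v, 'z, 'o, 'i) cl_state \<Rightarrow> real^'z::{finite,linorder}" where
  "zbar \<mu> i s = coord_proj (nz i) (st_z s $ i) - zs i (st_v s) \<mu>"

definition zbar' :: "real^'m \<Rightarrow> 'i \<Rightarrow> ('v, 'z, 'o, 'i) cl_state \<Rightarrow> ('v, 'z, 'o, 'i) cl_state \<Rightarrow> real^'z::{finite,linorder}" where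
  "zbar' \<mu> i s h = coord_proj (nz i) (st_z h $ i) - frechet_derivative (\<lambda>v. zs i v \<mu>) (at (st_v s)) (st_v h)"

definition xt :: "real^'m \<Rightarrow> 'i \<Rightarrow> ('v, 'z, 'o, 'i) cl_state \<Rightarrow> real^'o::{finite,linorder}" where
  "xt \<mu> i s = coord_proj (np i) (st_\<eta> s $ i) - immersion (S i) (D i \<mu>) (np i) (st_\<omega> s $ i) - col_app (G i) (err \<mu> s $ i)"

definition xt' :: "real^'m \<Rightarrow> 'i \<Rightarrow> ('v, 'z, 'o, 'i) cl_state \<Rightarrow> ('v, 'z, 'o, 'i) cl_state \<Rightarrow> real^'o::{finite,linorder}" where
  "xt' \<mu> i s h = coord_proj (np i) (st_\<eta> h $ i) - immersion (S i) (D i \<mu>) (np i) (st_\<omega> h $ i) - col_app (G i) (err' \<mu> s h $ i)"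

lemma C1_err: "C1 (err \<mu>) (err' \<mu>)"
proof -
  have ones: "linear (\<lambda>c::real. (\<chi> i. c) :: real^'i)" by (rule linearI) (simp_all add: Finite_Cartesian_Product.vec_eq_iff)
  have "linear (st_v :: ('v, 'z, 'o, 'i) cl_state \<Rightarrow> _)" "linear (st_y :: ('v, 'z, 'o, 'i) cl_state \<Rightarrow> _)"
    by (simp_all add: linear_iff)
  from C1_diff[OF C1_linear[OF this(2)] C1_compose[OF C1_compose[OF C1_linear[OF this(1)] C1_partial[OF leader_smooth(3), of \<mu>]] C1_linear[OF ones]]]
  show ?thesis unfolding err_def[abs_def] err'_def[abs_def] r'_def .
qed

lemma C1_zbar: "C1 (zbar \<mu> i) (zbar' \<mu> i)"
proof -
  have "linear (st_v :: ('v, 'z, 'o, 'i) cl_state \<Rightarrow> _)" "linear (\<lambda>s :: ('v, 'z, 'o, 'i) cl_state. coord_proj (nz i) (st_z s $ i))"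
    by (simp_all add: linear_iff linear_add[OF linear_coord_proj] linear_scale[OF linear_coord_proj])
  from C1_diff[OF C1_linear[OF this(2)] C1_compose[OF C1_linear[OF this(1)] C1_partial[OF zs(1), of i \<mu>]]]
  show ?thesis unfolding zbar_def[abs_def] zbar'_def[abs_def] .
qed

lemma C1_xt: "C1 (xt \<mu> i) (xt' \<mu> i)"
proof -
  have 1: "linear (\<lambda>s :: ('v, 'z, 'o, 'i) cl_state. coord_proj (np i) (st_\<eta> s $ i) - immersion (S i) (D i \<mu>) (np i) (st_\<omega> s $ i))"
    by (simp add: linear_iff linear_add[OF linear_coord_proj] linear_scale[OF linear_coord_proj]
        linear_add[OF linear_immersion] linear_scale[OF linear_immersion] algebra_simps)
  have 2: "linear (\<lambda>e :: real^'i. col_app (G i) (e $ i))"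
    by (simp add: linear_iff linear_add[OF linear_col_app] linear_scale[OF linear_col_app, simplified])
  from C1_diff[OF C1_linear[OF 1] C1_compose[OF C1_err[of \<mu>] C1_linear[OF 2]]]
  show ?thesis unfolding xt_def[abs_def] xt'_def[abs_def] .
qed

lemma zbar_in: "zbar \<mu> i s \<in> coord_space (nz i)"
  unfolding zbar_def by (intro coord_space_diff coord_proj_in_coord_space zs)

lemma xt_in: "xt \<mu> i s \<in> coord_space (np i)"
  unfolding xt_def using internal_model(1)[of i]
  by (intro coord_space_diff coord_proj_in_coord_space immersion_in_coord_space col_app_in_coord_space) auto

text \<open>The part of the error equation free of control and disturbance: \<open>g_i\<close> minus
  the derivative of the leader's output, in error coordinates.\<close>

definition drift :: "'i \<Rightarrow> real^'z::{finite,linorder} \<Rightarrow> real \<Rightarrow> (real^'v) \<times> (real^'w) \<times> (real^'m) \<Rightarrow> real" where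
  "drift i z e = (\<lambda>(v, w, \<mu>). g i (z + zs i v \<mu>) (e + r v \<mu>) \<mu> - r' v \<mu> (p v + q v *v w))"

lemma drift_bounded:
  assumes "compact \<Sigma>"
  shows "\<exists>H. \<forall>P z e. P \<in> \<Sigma> \<longrightarrow> norm z \<le> R \<longrightarrow> \<bar>e\<bar> \<le> R \<longrightarrow> (drift i z e P)\<^sup>2 \<le> H"
proof -
  let ?K = "\<Sigma> \<times> cball 0 R \<times> {-R..R}"
  have "continuous_on ?K (\<lambda>x. (drift i (fst (snd x)) (snd (snd x)) (fst x))\<^sup>2)"
    unfolding drift_def r'_def case_prod_beta
    by (intro continuous_intros continuous_on_smooth3[OF follower_smooth(2)] continuous_on_smooth2[OF zs(1)]
        continuous_on_smooth2[OF leader_smooth(3)] continuous_on_partial_derivative[OF leader_smooth(3)]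
        continuous_on_matrix_vector_mult continuous_on_compose2[OF smooth_on_real_continuous[OF leader_smooth(1)]]
        continuous_on_compose2[OF smooth_on_real_continuous[OF leader_smooth(2)]] subset_UNIV)
  then have "compact ((\<lambda>x. (drift i (fst (snd x)) (snd (snd x)) (fst x))\<^sup>2) ` ?K)"
    using assms by (intro compact_continuous_image compact_Times) auto
  then obtain H where H: "\<And>x. x \<in> ?K \<Longrightarrow> norm ((drift i (fst (snd x)) (snd (snd x)) (fst x))\<^sup>2) \<le> H"
    using compact_imp_bounded bounded_iff by (metis (no_types, lifting) imageI)
  have "(drift i z e P)\<^sup>2 \<le> H" if "P \<in> \<Sigma>" "norm z \<le> R" "\<bar>e\<bar> \<le> R" for P z e
    using H[of "(P, z, e)"] that by (simp add: abs_le_iff)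
  then show ?thesis by blast
qed

section \<open>The closed-loop field in error coordinates, for a given gain, parameter and leader
  input\<close>

context
  fixes \<rho> :: "real \<Rightarrow> real" and \<gamma> :: real and \<mu> :: "real^'m" and w :: "real \<Rightarrow> real^'w"
begin

definition X :: "real \<Rightarrow> ('v, 'z, 'o, 'i) cl_state \<Rightarrow> ('v, 'z, 'o, 'i) cl_state" where
  "X = closed_loop p q r f g S D A m G (\<lambda>_. \<rho>) (\<lambda>_. \<gamma>) \<mu> w"

definition jump :: "'i \<Rightarrow> ('v, 'z, 'o, 'i) cl_state" where
  "jump i = (0, 0, - \<gamma> *\<^sub>R axis i 1, 0, axis i (col_app (G i) (- \<gamma>)))"

text \<open>The control without its internal model term, which is kept apart because it serves to
  cancel the disturbance (\<open>row_eta\<close>).\<close>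

definition ubar :: "('v, 'z, 'o, 'i) cl_state \<Rightarrow> 'i \<Rightarrow> real" where
  "ubar s i = - \<rho> (L (err \<mu> s) $ i) * L (err \<mu> s) $ i - \<gamma> * sgn (L (err \<mu> s) $ i)"

lemma e_virtual_eq: "e_virtual A (node_output r \<mu> (st_v s) (st_y s)) i = L (err \<mu> s) $ i"
proof -
  have "err \<mu> s = (\<chi> i. st_y s $ i - r (st_v s) \<mu>)" by (simp add: err_def Finite_Cartesian_Product.vec_eq_iff)
  then show ?thesis by (simp add: e_virtual_eq_laplacian)
qed

lemma X_components:
  "st_v (X t s) = p (st_v s) + q (st_v s) *v w t"
  "st_z (X t s) $ i = f i (st_z s $ i) (st_y s $ i) \<mu>"
  "st_y (X t s) $ i = g i (st_z s $ i) (st_y s $ i) \<mu> + (ubar s i - row_app (Psi_mat (m i)) (st_\<eta> s $ i)) + row_app (D i \<mu>) (st_\<omega> s $ i)"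
  "st_\<omega> (X t s) $ i = mat_app (S i) (st_\<omega> s $ i)"
  "st_\<eta> (X t s) $ i = mat_app (F_mat (m i) (G i)) (st_\<eta> s $ i) + col_app (G i) (ubar s i - row_app (Psi_mat (m i)) (st_\<eta> s $ i))"
proof -
  have "control_law (Psi_mat (m i)) \<rho> \<gamma> (st_\<eta> s $ i) (e_virtual A (node_output r \<mu> (st_v s) (st_y s)) i)
    = ubar s i - row_app (Psi_mat (m i)) (st_\<eta> s $ i)" for i
    by (simp add: control_law_def e_virtual_eq ubar_def)
  then show "st_v (X t s) = p (st_v s) + q (st_v s) *v w t"
    "st_z (X t s) $ i = f i (st_z s $ i) (st_y s $ i) \<mu>"
    "st_y (X t s) $ i = g i (st_z s $ i) (st_y s $ i) \<mu> + (ubar s i - row_app (Psi_mat (m i)) (st_\<eta> s $ i)) + row_app (D i \<mu>) (st_\<omega> s $ i)"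
    "st_\<omega> (X t s) $ i = mat_app (S i) (st_\<omega> s $ i)"
    "st_\<eta> (X t s) $ i = mat_app (F_mat (m i) (G i)) (st_\<eta> s $ i) + col_app (G i) (ubar s i - row_app (Psi_mat (m i)) (st_\<eta> s $ i))"
    by (simp_all add: X_def closed_loop_def case_prod_beta Let_def)
qed

lemma X_eq_jump: "X t s = closed_loop p q r f g S D A m G (\<lambda>_. \<rho>) (\<lambda>_. 0) \<mu> w t s + (\<Sum>i\<in>UNIV. sgn (L (err \<mu> s) $ i) *\<^sub>R jump i)"
proof -
  define Y where "Y = (\<Sum>i\<in>UNIV. sgn (L (err \<mu> s) $ i) *\<^sub>R (- \<gamma> *\<^sub>R axis i (1::real)))"
  define H where "H = (\<Sum>i\<in>UNIV. sgn (L (err \<mu> s) $ i) *\<^sub>R (axis i (col_app (G i) (- \<gamma>)) :: real^'o::{finite,linorder}^'i))"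
  have sum: "(\<Sum>i\<in>UNIV. sgn (L (err \<mu> s) $ i) *\<^sub>R jump i) = (0, 0, Y, 0, H)"
    by (simp add: prod_eq_iff jump_def fst_sum snd_sum Y_def H_def)
  have Y: "Y $ j = - \<gamma> * sgn (L (err \<mu> s) $ j)" for j
    by (simp add: Y_def sum_component axis_def if_distrib sum.delta cong: if_cong)
  have H: "H $ j = col_app (G j) (- \<gamma> * sgn (L (err \<mu> s) $ j))" for j
    by (simp add: H_def sum_component axis_def if_distrib sum.delta linear_scale[OF linear_col_app, symmetric] mult.commute cong: if_cong)
  have ctrl: "control_law \<Psi> \<rho> \<gamma> \<eta> e = control_law \<Psi> \<rho> 0 \<eta> e + - \<gamma> * sgn e" for \<Psi> \<eta> e
    by (simp add: control_law_def)
  show ?thesis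
    unfolding sum X_def closed_loop_def case_prod_beta Let_def e_virtual_eq ctrl[of _ _ "L (err \<mu> s) $ _"] linear_add[OF linear_col_app] plus_prod_def
    by (simp add: Finite_Cartesian_Product.vec_eq_iff Y H)
qed

lemma sign_field_X:
  assumes w: "continuous_on {0..} w" and \<rho>: "continuous_on UNIV \<rho>"
  shows "sign_field X (closed_loop p q r f g S D A m G (\<lambda>_. \<rho>) (\<lambda>_. 0) \<mu> w) (\<lambda>i s. L (err \<mu> s) $ i) jump"
proof
  show "X t s = closed_loop p q r f g S D A m G (\<lambda>_. \<rho>) (\<lambda>_. 0) \<mu> w t s + (\<Sum>i\<in>UNIV. sgn (L (err \<mu> s) $ i) *\<^sub>R jump i)" for t s
    by (rule X_eq_jump)
  have cerr: "continuous_on U (\<lambda>x. L (err \<mu> (s x)) $ i)" if "continuous_on U s" for U :: "'k::topological_space set" and s i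
    by (intro continuous_intros linear_imp_continuous_on[OF linear_grounded_laplacian]
        continuous_on_compose2[OF C1_D(4)[OF C1_err] that]) auto
  show "continuous_on UNIV (\<lambda>s. L (err \<mu> s) $ i)" for i by (intro cerr continuous_intros)
  have wc: "continuous_on ({0..} \<times> UNIV) (\<lambda>x. w (fst x))" by (rule continuous_on_compose2[OF w]) (auto intro!: continuous_intros)
  define u where "u i x = control_law (Psi_mat (m i)) \<rho> 0 (st_\<eta> (snd x) $ i) (L (err \<mu> (snd x)) $ i)"
    for i and x :: "real \<times> ('v, 'z, 'o, 'i) cl_state"
  have cu: "continuous_on ({0..} \<times> UNIV) (u i)" for i
  proof -
    have "u i = (\<lambda>x. - row_app (Psi_mat (m i)) (st_\<eta> (snd x) $ i) - \<rho> (L (err \<mu> (snd x)) $ i) * L (err \<mu> (snd x)) $ i)"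
      by (simp add: u_def control_law_def fun_eq_iff)
    moreover have "continuous_on ({0..} \<times> UNIV) (\<lambda>x :: real \<times> ('v, 'z, 'o, 'i) cl_state. \<rho> (L (err \<mu> (snd x)) $ i))"
      by (rule continuous_on_compose2[OF \<rho> cerr]) (auto intro!: continuous_intros)
    ultimately show ?thesis
      by (auto intro!: continuous_intros cerr linear_imp_continuous_on[OF linear_row_app])
  qed
  have eq: "(\<lambda>(t, s :: ('v, 'z, 'o, 'i) cl_state). closed_loop p q r f g S D A m G (\<lambda>_. \<rho>) (\<lambda>_. 0) \<mu> w t s) =
    (\<lambda>x. (p (st_v (snd x)) + q (st_v (snd x)) *v w (fst x), (\<chi> i. f i (st_z (snd x) $ i) (st_y (snd x) $ i) \<mu>),
      (\<chi> i. g i (st_z (snd x) $ i) (st_y (snd x) $ i) \<mu> + u i x + row_app (D i \<mu>) (st_\<omega> (snd x) $ i)),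
      (\<chi> i. mat_app (S i) (st_\<omega> (snd x) $ i)), (\<chi> i. mat_app (F_mat (m i) (G i)) (st_\<eta> (snd x) $ i) + col_app (G i) (u i x))))"
    unfolding closed_loop_def case_prod_beta Let_def e_virtual_eq u_def ..
  show "continuous_on ({0..} \<times> UNIV) (\<lambda>(t, s :: ('v, 'z, 'o, 'i) cl_state). closed_loop p q r f g S D A m G (\<lambda>_. \<rho>) (\<lambda>_. 0) \<mu> w t s)"
    unfolding eq
    by (intro continuous_on_Pair continuous_on_vec_lambda continuous_on_add continuous_on_smooth3[OF follower_smooth(1)]
        continuous_on_smooth3[OF follower_smooth(2)] continuous_on_matrix_vector_mult wc cu
        continuous_on_compose2[OF smooth_on_real_continuous[OF leader_smooth(1)]]
        continuous_on_compose2[OF smooth_on_real_continuous[OF leader_smooth(2)]] subset_UNIV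
        linear_imp_continuous_on[OF linear_mat_app] linear_imp_continuous_on[OF linear_row_app] linear_imp_continuous_on[OF linear_col_app]
        continuous_on_component continuous_on_fst continuous_on_snd continuous_on_id continuous_on_const)
qed

text \<open>A small displacement of the outputs realises every sign pattern of the virtual errors, as the grounded Laplacian is onto.\<close>

lemma sign_pattern_realised:
  assumes \<delta>: "\<delta> > 0" and \<sigma>: "\<And>i. \<sigma> i \<in> {-1, 1::real}" and sg: "\<And>i. L (err \<mu> s) $ i \<noteq> 0 \<Longrightarrow> \<sigma> i = sgn (L (err \<mu> s) $ i)"
  shows "\<exists>s'\<in>ball s \<delta>. \<forall>i. sgn (L (err \<mu> s') $ i) = \<sigma> i"
proof -
  \<comment> \<open>Where a virtual error is nonzero, \<open>\<sigma> i\<close> is its sign, so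
    adding \<open>e * \<sigma> i\<close> only enlarges it; where it is zero, the displacement
    decides the sign.\<close>
  obtain d where d: "L d = (\<chi> i. \<sigma> i)" using laplacian_surj by blast
  define e where "e = \<delta> / (2 * (norm d + 1))"
  have nd: "norm d + 1 > 0" using norm_ge_zero[of d] by linarith
  have e: "e > 0" using \<delta> nd by (simp add: e_def)
  define s' where "s' = s + (0, 0, e *\<^sub>R d, 0, 0)"
  have "e * norm d \<le> e * (norm d + 1)" using e by simp
  also have "\<dots> = \<delta> / 2"
  proof -
    have "\<delta> / (2 * n) * n = \<delta> / 2" if "n > 0" for n :: real using that by simp
    from this[OF nd] show ?thesis by (simp only: e_def)
  qed
  finally have "dist s s' < \<delta>" using \<delta> e by (simp add: s'_def dist_norm norm_prod_def)
  moreover have "L (err \<mu> s') = L (err \<mu> s) + e *\<^sub>R (\<chi> i. \<sigma> i)"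
  proof -
    have "err \<mu> s' = err \<mu> s + e *\<^sub>R d" by (simp add: err_def s'_def)
    then show ?thesis by (simp add: linear_add[OF linear_grounded_laplacian] linear_scale[OF linear_grounded_laplacian] d)
  qed
  then have "L (err \<mu> s') $ i = L (err \<mu> s) $ i + e * \<sigma> i" for i by simp
  then have "sgn (L (err \<mu> s') $ i) = \<sigma> i" for i
    using \<sigma>[of i] sg[of i] e by (cases "L (err \<mu> s) $ i = 0") (auto simp: sgn_if split: if_splits)
  ultimately show ?thesis by (intro bexI[of _ s']) auto
qed

text \<open>The regulator equation cancels the contribution of p to the motion of the steady state,
  so only that of \<open>q v *v w\<close> remains.\<close>

lemma zbar_dynamics: "zbar' \<mu> i s (X t s) = fbar q r (f i) (zs i) (zbar \<mu> i s) (err \<mu> s $ i) (st_v s) (w t) \<mu>"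
proof -
  have "f i (st_z s $ i) (st_y s $ i) \<mu> = f i (coord_proj (nz i) (st_z s $ i)) (st_y s $ i) \<mu>"
    using follower_dims(1)[of i] by (simp add: depends_on_def)
  then have "f i (zbar \<mu> i s + zs i (st_v s) \<mu>) (err \<mu> s $ i + r (st_v s) \<mu>) \<mu> = f i (st_z s $ i) (st_y s $ i) \<mu>"
    by (simp add: zbar_def err_def)
  then show ?thesis
    by (simp add: zbar'_def fbar_def X_components coord_proj_ident[OF follower_dims(2)] zs(3)
        linear_add[OF C1_D(3)[OF C1_partial[OF zs(1)]]])
qed

lemma eta_decomposition: "coord_proj (np i) (st_\<eta> s $ i) - immersion (S i) (D i \<mu>) (np i) (st_\<omega> s $ i) = xt \<mu> i s + col_app (G i) (err \<mu> s $ i)"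
  by (simp add: xt_def)

text \<open>The steady state part of the internal model output is the disturbance itself, by
  \<open>immersion_output\<close>.\<close>

lemma row_eta: "row_app (Psi_mat (m i)) (st_\<eta> s $ i) = row_app (Psi_mat (m i)) (xt \<mu> i s + col_app (G i) (err \<mu> s $ i)) + row_app (D i \<mu>) (st_\<omega> s $ i)"
proof -
  have "dim_col (Psi_mat (m i)) = np i" by (simp add: Psi_mat_def)
  from row_app_coord_proj[OF this, of "st_\<eta> s $ i"]
  show ?thesis
    unfolding eta_decomposition[symmetric] linear_diff[OF linear_row_app]
    by (simp add: immersion_output[OF disturbance(1,2) minimal_poly nom_le])
qed

lemma err_dynamics: "err' \<mu> s (X t s) $ i = drift i (zbar \<mu> i s) (err \<mu> s $ i) (st_v s, w t, \<mu>) + ubar s i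
    - row_app (Psi_mat (m i)) (xt \<mu> i s + col_app (G i) (err \<mu> s $ i))"
proof -
  have "g i (st_z s $ i) (st_y s $ i) \<mu> = g i (coord_proj (nz i) (st_z s $ i)) (st_y s $ i) \<mu>"
    using follower_dims(3)[of i] by (simp add: depends_on_def)
  then have "g i (zbar \<mu> i s + zs i (st_v s) \<mu>) (err \<mu> s $ i + r (st_v s) \<mu>) \<mu> = g i (st_z s $ i) (st_y s $ i) \<mu>"
    by (simp add: zbar_def err_def)
  then show ?thesis by (simp add: err'_def drift_def X_components row_eta)
qed

text \<open>The term \<open>- Psi eta\<close> in the control turns F into Phi, which matches the
  steady state dynamics. Subtracting \<open>G err\<close> then removes \<open>ubar\<close> and
  brings \<open>G Psi\<close> back, so the Hurwitz matrix F governs the error after all.\<close>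

lemma xt_dynamics: "xt' \<mu> i s (X t s) = mat_app (F_mat (m i) (G i)) (xt \<mu> i s)
    + (mat_app (F_mat (m i) (G i)) (col_app (G i) (err \<mu> s $ i) :: real^'o::{finite,linorder}) - col_app (G i) (drift i (zbar \<mu> i s) (err \<mu> s $ i) (st_v s, w t, \<mu>)))"
proof -
  let ?Phi = "Phi_mat (m i)" and ?Psi = "Psi_mat (m i)" and ?G = "G i"
  let ?x = "xt \<mu> i s + col_app ?G (err \<mu> s $ i)"
  let ?a = "drift i (zbar \<mu> i s) (err \<mu> s $ i) (st_v s, w t, \<mu>)"
  have Phi: "dim_row ?Phi = np i" "dim_col ?Phi = np i" by (simp_all add: Phi_mat_def)
  have G: "dim_row ?G = np i" using internal_model(1)[of i] by auto
  have "st_\<eta> (X t s) $ i = mat_app ?Phi (st_\<eta> s $ i) + col_app ?G (ubar s i)"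
    by (simp add: X_components mat_app_F_mat[OF internal_model(1)] linear_diff[OF linear_col_app])
  moreover have "\<dots> \<in> coord_space (np i)" using Phi G by (intro coord_space_add mat_app_in_coord_space col_app_in_coord_space)
  ultimately have "coord_proj (np i) (st_\<eta> (X t s) $ i) = mat_app ?Phi (coord_proj (np i) (st_\<eta> s $ i)) + col_app ?G (ubar s i)"
    by (simp add: coord_proj_ident mat_app_coord_proj[OF Phi(2)])
  moreover have "immersion (S i) (D i \<mu>) (np i) (st_\<omega> (X t s) $ i) = mat_app ?Phi (immersion (S i) (D i \<mu>) (np i) (st_\<omega> s $ i))"
    by (simp add: X_components immersion_dynamics[OF disturbance(1,2) minimal_poly nom_le])
  ultimately have "xt' \<mu> i s (X t s) = mat_app ?Phi (coord_proj (np i) (st_\<eta> s $ i) - immersion (S i) (D i \<mu>) (np i) (st_\<omega> s $ i))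
      + col_app ?G (ubar s i) - col_app ?G (?a + ubar s i - row_app ?Psi ?x)"
    by (simp add: xt'_def err_dynamics linear_diff[OF linear_mat_app])
  also have "\<dots> = mat_app ?Phi ?x + col_app ?G (row_app ?Psi ?x) - col_app ?G ?a"
    by (simp add: eta_decomposition linear_add[OF linear_col_app] linear_diff[OF linear_col_app])
  also have "mat_app ?Phi ?x + col_app ?G (row_app ?Psi ?x) = mat_app (F_mat (m i) ?G) ?x"
    by (rule mat_app_F_mat[OF internal_model(1), symmetric])
  finally show ?thesis by (simp add: linear_add[OF linear_mat_app])
qed

lemma linear_r': "linear (r' v \<mu>)"
  unfolding r'_def by (rule C1_D(3)[OF C1_partial[OF leader_smooth(3)]])

text \<open>A jump of the control changes the velocity of \<open>eta_i\<close> by \<open>G_i\<close>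
  times its effect on that of \<open>y_i\<close>, so it cancels in \<open>xt\<close>.\<close>

lemma jump_components: "zbar' \<mu> i s (jump j) = 0" "err' \<mu> s (jump j) = - \<gamma> *\<^sub>R axis j 1" "xt' \<mu> i s (jump j) = 0"
proof -
  show e: "err' \<mu> s (jump j) = - \<gamma> *\<^sub>R axis j 1"
    using linear_0[OF linear_r', of "st_v s"] by (simp add: err'_def jump_def Finite_Cartesian_Product.vec_eq_iff)
  show "zbar' \<mu> i s (jump j) = 0"
    using linear_0[OF C1_D(3)[OF C1_partial[OF zs(1)]]] by (simp add: zbar'_def jump_def linear_0[OF linear_coord_proj])
  have G: "dim_row (G i) = np i" using internal_model(1)[of i] by auto
  show "xt' \<mu> i s (jump j) = 0"
    unfolding xt'_def e using coord_proj_ident[OF col_app_in_coord_space[OF G]]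
    by (cases "i = j") (simp_all add: jump_def axis_def linear_0[OF linear_coord_proj] linear_0[OF linear_immersion] linear_0[OF linear_col_app])
qed

end

end

subsection \<open>The Lyapunov function of the closed loop\<close>

lemma linear_norm_bound:
  fixes f :: "'a::euclidean_space \<Rightarrow> 'b::real_normed_vector"
  assumes "linear f"
  obtains K where "K \<ge> 0" "\<And>x. norm (f x) \<le> K * norm x"
  using linear_bounded_pos[OF assms] less_imp_le by metis

lemma vector_norm_le_sum:
  fixes x :: "('a::real_normed_vector)^'i::finite"
  shows "norm x \<le> (\<Sum>i\<in>UNIV. norm (x $ i))"
  unfolding norm_vec_def by (rule L2_set_le_sum) simp

text \<open>The test function for linear growth: along a linear system its derivative is bounded,
  which replaces a Gronwall argument. The summand 1 keeps it smooth at 0.\<close>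

lemma C1_ln_norm: "C1 (\<lambda>x::'a::euclidean_space. ln (1 + x \<bullet> x)) (\<lambda>x h. 2 * (x \<bullet> h) / (1 + x \<bullet> x))"
  unfolding C1_def
proof (intro conjI allI)
  have pos: "1 + x \<bullet> x > 0" for x :: 'a using inner_ge_zero[of x] by linarith
  show "((\<lambda>x. ln (1 + x \<bullet> x)) has_derivative (\<lambda>h. 2 * (x \<bullet> h) / (1 + x \<bullet> x))) (at x)" for x :: 'a
    using pos[of x] by (auto intro!: derivative_eq_intros simp: inner_commute divide_inverse)
  have "1 + x \<bullet> x \<noteq> 0" for x :: 'a using pos[of x] by simp
  then show "continuous_on UNIV (\<lambda>x::'a. 2 * (x \<bullet> h) / (1 + x \<bullet> x))" for h
    by (intro continuous_intros) auto
qed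

lemma filippov_solution_constant:
  fixes x :: "real \<Rightarrow> 'a::euclidean_space" and P :: "'a \<Rightarrow> 'b::euclidean_space"
  assumes sol: "filippov_solution X {0..t} x" and t: "0 \<le> t" and P: "linear P" and 0: "\<And>t s. P (X t s) = 0"
  shows "P (x t) = P (x 0)"
proof -
  define c where "c = P (x t) - P (x 0)"
  have lin: "linear (\<lambda>y. c \<bullet> P y)" using P by (auto simp: linear_iff inner_right_distrib)
  have "c \<bullet> P (x t) - c \<bullet> P (x 0) \<le> 0 * (t - 0)"
    by (rule filippov_solution_increment_le[OF sol t _ C1_linear[OF lin]]) (auto simp: 0 intro!: exI[of _ "1::real"])
  then have "c \<bullet> c \<le> 0" by (simp add: c_def inner_diff_right)
  then have "c = 0" by (metis inner_eq_zero_iff inner_ge_zero order_antisym)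
  then show ?thesis by (simp add: c_def)
qed

lemma class_K_mono:
  assumes "class_K \<infinity> \<alpha>" "0 \<le> s" "s \<le> t"
  shows "\<alpha> s \<le> \<alpha> t"
  using assms strict_mono_onD[of "{s. 0 \<le> s \<and> ereal s < \<infinity>}" \<alpha> s t] unfolding class_K_def by (cases "s = t") auto

lemma compact_cube: "compact (cube M :: (real^'k) set)"
proof -
  have "cube M = cbox (\<chi> _. - M) ((\<chi> _. M) :: real^'k)" by (auto simp: cube_def mem_box_cart)
  then show ?thesis by simp
qed

lemma compact_infnorm_ball: "compact {w :: real^'w. infnorm w \<le> l}"
proof -
  have "{w :: real^'w. infnorm w \<le> l} = (\<Inter>i. {w. \<bar>w $ i\<bar> \<le> l})"
    by (auto simp: infnorm_Max Basis_vec_def inner_axis)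
  also have "\<dots> = cube l" by (auto simp: cube_def abs_le_iff) (metis minus_le_iff)+
  finally show ?thesis using compact_cube by simp
qed

context leader_follower
begin

lemma leader_bounded:
  obtains Rv where "\<And>v :: real^'v. v \<in> cube M \<Longrightarrow> norm v \<le> Rv"
    "\<And>w v T t. admissible_input l w \<Longrightarrow> 0 < T \<Longrightarrow> leader_solution p q w {0..<T} v \<Longrightarrow> v 0 \<in> cube M \<Longrightarrow> t \<in> {0..<T} \<Longrightarrow> norm (v t) \<le> Rv"
proof -
  obtain \<alpha>0 \<gamma>0 where K: "class_K \<infinity> \<alpha>0" "class_K \<infinity> \<gamma>0" and st: "\<And>w v T t. admissible_input l w \<Longrightarrow> 0 < T \<Longrightarrow> leader_solution p q w {0..<T} v \<Longrightarrow>
      t \<in> {0..<T} \<Longrightarrow> norm (v t) \<le> \<alpha>0 (norm (v 0)) + \<gamma>0 (SUP s\<in>{0..}. infnorm (w s))"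
    using leader_stable unfolding leader_stability_def by blast
  obtain R where R: "\<And>v :: real^'v. v \<in> cube M \<Longrightarrow> norm v \<le> R"
    using compact_imp_bounded[OF compact_cube] unfolding bounded_iff by blast
  \<comment> \<open>The maximum with R also covers the initial points, which are all there is on the
    interval \<open>{0..0}\<close>.\<close>
  show ?thesis
  proof (rule that[of "max R (\<alpha>0 R + \<gamma>0 l)"])
    show "norm v \<le> max R (\<alpha>0 R + \<gamma>0 l)" if "v \<in> cube M" for v :: "real^'v" using R[OF that] by simp
    fix w :: "real \<Rightarrow> real^'w" and v T t
    assume w: "admissible_input l w" and T: "0 < T" "leader_solution p q w {0..<T} v" and v0: "v 0 \<in> cube M" and t: "t \<in> {0..<T}"
    have wl: "\<And>s. s \<in> {0..} \<Longrightarrow> infnorm (w s) \<le> l" using w by (auto simp: admissible_input_def)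
    have "infnorm (w 0) \<le> (SUP s\<in>{0..}. infnorm (w s))"
      by (rule cSUP_upper) (auto intro!: bdd_aboveI2[where M = l] wl)
    then have "0 \<le> (SUP s\<in>{0..}. infnorm (w s))" using infnorm_pos_le[of "w 0"] by linarith
    moreover have "(SUP s\<in>{0..}. infnorm (w s)) \<le> l" by (rule cSUP_least) (auto intro: wl)
    ultimately have "\<gamma>0 (SUP s\<in>{0..}. infnorm (w s)) \<le> \<gamma>0 l" by (rule class_K_mono[OF K(2)])
    moreover have "\<alpha>0 (norm (v 0)) \<le> \<alpha>0 R" using R[OF v0] by (intro class_K_mono[OF K(1)]) auto
    ultimately show "norm (v t) \<le> max R (\<alpha>0 R + \<gamma>0 l)" using st[OF w T t] by linarith
  qed
qed

text \<open>Here \<open>\<sigma>\<close> stands for a virtual error and a for the drift; the cross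
  term is the part of the error energy derivative without feedback. Young's inequality on its three
  summands costs \<open>3 * \<sigma>\<^sup>2\<close>, plus a multiple of
  \<open>(norm x)\<^sup>2\<close> that the decay of Q covers.\<close>

lemma internal_lyapunov:
  "\<exists>(Q :: real^'o::{finite,linorder} \<Rightarrow> real) Q' c C. C1 Q Q' \<and> c > 0 \<and> C \<ge> 0 \<and> (\<forall>x. c * (norm x)\<^sup>2 \<le> Q x) \<and>
    (\<forall>x e a \<sigma>. x \<in> coord_space (np i) \<longrightarrow>
      Q' x (mat_app (F_mat (m i) (G i)) x + (mat_app (F_mat (m i) (G i)) (col_app (G i) e :: real^'o::{finite,linorder}) - col_app (G i) a))
        + \<sigma> * (a - row_app (Psi_mat (m i)) (x + col_app (G i) e)) \<le> - (norm x)\<^sup>2 + 3 * \<sigma>\<^sup>2 + C * (a\<^sup>2 + e\<^sup>2))"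
proof -
  let ?F = "F_mat (m i) (G i)" and ?Psi = "Psi_mat (m i)"
  have F: "?F \<in> carrier_mat (np i) (np i)" using internal_model(1)[of i] by (auto simp: F_mat_def Phi_mat_def Psi_mat_def)
  obtain Q Q' c C where Q: "C1 (Q :: real^'o::{finite,linorder} \<Rightarrow> real) Q'" "c > 0" "C \<ge> 0" "\<And>x. c * (norm x)\<^sup>2 \<le> Q x"
    "\<And>x b. x \<in> coord_space (np i) \<Longrightarrow> Q' x (mat_app ?F x + b) \<le> - 2 * (norm x)\<^sup>2 + C * (norm b)\<^sup>2"
    using hurwitz_quadratic[OF F internal_model(2) np_le] by metis
  obtain k where k: "k \<ge> 0" "\<And>x. norm (row_app ?Psi (x :: real^'o::{finite,linorder})) \<le> k * norm x"
    using linear_norm_bound[OF linear_row_app] by metis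
  obtain kG where kG: "kG \<ge> 0" "\<And>a. norm (col_app (G i) a :: real^'o::{finite,linorder}) \<le> kG * norm a"
    using linear_norm_bound[OF linear_col_app] by metis
  obtain kF where kF: "kF \<ge> 0" "\<And>x. norm (mat_app ?F (x :: real^'o::{finite,linorder}) :: real^'o::{finite,linorder}) \<le> kF * norm x"
    using linear_norm_bound[OF linear_mat_app] by metis
  \<comment> \<open>Scaling Q by s raises the decay to \<open>2 * (1 + k\<^sup>2)\<close> times the
    square of \<open>norm x\<close>, of which the output term consumes \<open>k\<^sup>2\<close>
    times that square.\<close>
  define s where "s = 1 + k\<^sup>2"
  have s: "s \<ge> 1" by (simp add: s_def)
  define Cb where "Cb = 2 * kG\<^sup>2 * (1 + kF\<^sup>2)"
  define C' where "C' = s * C * Cb + 1 + (k * kG)\<^sup>2"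
  have "s * C * Cb \<ge> 0" using s Q(3) by (auto simp: Cb_def)
  then have C': "C' \<ge> 0" by (simp add: C'_def)
  have "C1 (\<lambda>x. s * Q x) (\<lambda>x h. s * Q' x h)"
    using C1_mult[OF C1_const[of s] Q(1)] by simp
  moreover have "s * c > 0" using s Q(2) by simp
  moreover have "s * c * (norm x)\<^sup>2 \<le> s * Q x" for x using mult_left_mono[OF Q(4)[of x], of s] s by (simp add: mult.assoc)
  moreover have "s * Q' x (mat_app ?F x + (mat_app ?F (col_app (G i) e :: real^'o::{finite,linorder}) - col_app (G i) a))
        + \<sigma> * (a - row_app ?Psi (x + col_app (G i) e)) \<le> - (norm x)\<^sup>2 + 3 * \<sigma>\<^sup>2 + C' * (a\<^sup>2 + e\<^sup>2)"
    if x: "x \<in> coord_space (np i)" for x e a \<sigma>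
  proof -
    let ?g = "col_app (G i) e :: real^'o::{finite,linorder}"
    let ?b = "mat_app ?F ?g - (col_app (G i) a :: real^'o::{finite,linorder})"
    have ng: "norm ?g \<le> kG * \<bar>e\<bar>" using kG(2)[of e] by simp
    have "norm ?b \<le> kF * norm ?g + kG * \<bar>a\<bar>"
      using norm_triangle_ineq4[of "mat_app ?F ?g :: real^'o::{finite,linorder}" "col_app (G i) a"] kF(2)[of ?g] kG(2)[of a] by simp
    also have "\<dots> \<le> kF * (kG * \<bar>e\<bar>) + kG * \<bar>a\<bar>" using ng kF(1) kG(1) by (intro add_mono mult_left_mono) auto
    finally have "(norm ?b)\<^sup>2 \<le> (kF * (kG * \<bar>e\<bar>) + kG * \<bar>a\<bar>)\<^sup>2" by (intro power_mono) auto
    also have "\<dots> \<le> 2 * (kF * (kG * \<bar>e\<bar>))\<^sup>2 + 2 * (kG * \<bar>a\<bar>)\<^sup>2"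
    proof -
      have "(u + v)\<^sup>2 \<le> 2 * u\<^sup>2 + 2 * v\<^sup>2" for u v :: real
        using zero_le_power2[of "u - v"] by (simp add: power2_eq_square algebra_simps)
      then show ?thesis .
    qed
    also have "\<dots> = 2 * kG\<^sup>2 * (kF\<^sup>2 * e\<^sup>2 + a\<^sup>2)" by (simp add: power_mult_distrib algebra_simps)
    also have "\<dots> \<le> 2 * kG\<^sup>2 * ((1 + kF\<^sup>2) * (a\<^sup>2 + e\<^sup>2))"
      by (intro mult_left_mono) (auto simp: algebra_simps)
    finally have nb: "(norm ?b)\<^sup>2 \<le> Cb * (a\<^sup>2 + e\<^sup>2)" by (simp add: Cb_def mult.assoc)
    have "s * Q' x (mat_app ?F x + ?b) \<le> s * (- 2 * (norm x)\<^sup>2 + C * (Cb * (a\<^sup>2 + e\<^sup>2)))"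
      using Q(5)[OF x, of ?b] mult_left_mono[OF nb Q(3)] s by (intro mult_left_mono) auto
    then have 1: "s * Q' x (mat_app ?F x + ?b) \<le> - 2 * s * (norm x)\<^sup>2 + s * C * Cb * (a\<^sup>2 + e\<^sup>2)" by (simp add: algebra_simps)
    have young: "u * v \<le> u\<^sup>2 + v\<^sup>2" for u v :: real
      using zero_le_power2[of "u - v"] zero_le_power2[of u] zero_le_power2[of v] unfolding power2_diff by linarith
    have 2: "\<sigma> * a \<le> \<sigma>\<^sup>2 + a\<^sup>2" by (rule young)
    have "(row_app ?Psi x)\<^sup>2 \<le> (k * norm x)\<^sup>2" using power_mono[OF k(2)[of x], of 2] by simp
    then have 3: "- \<sigma> * row_app ?Psi x \<le> \<sigma>\<^sup>2 + k\<^sup>2 * (norm x)\<^sup>2"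
      using young[of "- \<sigma>" "row_app ?Psi x"] by (simp add: power_mult_distrib)
    have "norm (row_app ?Psi ?g) \<le> k * (kG * \<bar>e\<bar>)" using k(2)[of ?g] mult_left_mono[OF ng k(1)] by linarith
    from power_mono[OF this norm_ge_zero, of 2] have "(row_app ?Psi ?g)\<^sup>2 \<le> (k * kG)\<^sup>2 * e\<^sup>2" by (simp add: power_mult_distrib mult.assoc)
    then have 4: "- \<sigma> * row_app ?Psi ?g \<le> \<sigma>\<^sup>2 + (k * kG)\<^sup>2 * e\<^sup>2" using young[of "- \<sigma>" "row_app ?Psi ?g"] by simp
    have eq: "\<sigma> * (a - row_app ?Psi (x + ?g)) = \<sigma> * a + - \<sigma> * row_app ?Psi x + - \<sigma> * row_app ?Psi ?g"
      by (simp add: linear_add[OF linear_row_app] algebra_simps)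
    have 5: "(k * kG)\<^sup>2 * a\<^sup>2 \<ge> 0" by simp
    have "C' * (a\<^sup>2 + e\<^sup>2) = s * C * Cb * (a\<^sup>2 + e\<^sup>2) + a\<^sup>2 + e\<^sup>2 + (k * kG)\<^sup>2 * a\<^sup>2 + (k * kG)\<^sup>2 * e\<^sup>2" by (simp add: C'_def algebra_simps)
    moreover have "- 2 * s * (norm x)\<^sup>2 + k\<^sup>2 * (norm x)\<^sup>2 \<le> - (norm x)\<^sup>2"
    proof -
      have "0 \<le> (norm x)\<^sup>2" "0 \<le> k\<^sup>2 * (norm x)\<^sup>2" by simp_all
      moreover have "- 2 * s * (norm x)\<^sup>2 = - 2 * (norm x)\<^sup>2 - 2 * (k\<^sup>2 * (norm x)\<^sup>2)" by (simp add: s_def algebra_simps)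
      ultimately show ?thesis by linarith
    qed
    ultimately show ?thesis unfolding eq using 1 2 3 4 5 zero_le_power2[of e] by linarith
  qed
  ultimately show ?thesis using C' by (intro exI[of _ "\<lambda>x. s * Q x"] exI[of _ "\<lambda>x h. s * Q' x h"] exI[of _ "s * c"] exI[of _ C']) blast
qed

text \<open>The compact set on which the dissipation inequality of the zero dynamics is invoked;
  with Rv bounding the leader it contains \<open>(v(t), w(t), \<mu>)\<close> along all trajectories
  considered.\<close>

definition region :: "real \<Rightarrow> real \<Rightarrow> ((real^'v) \<times> (real^'w) \<times> (real^'m)) set" where
  "region M Rv = cball 0 Rv \<times> {w. infnorm w \<le> l} \<times> cube M"

lemma compact_region: "compact (region M Rv)"
  unfolding region_def by (intro compact_Times compact_cball compact_infnorm_ball compact_cube)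

definition zero_dynamics_lyap where
  "zero_dynamics_lyap M Rv C i W W' \<longleftrightarrow> C1 W W' \<and> (\<forall>z\<in>coord_space (nz i). 0 \<le> W z) \<and>
    (\<forall>c. \<exists>R. \<forall>z\<in>coord_space (nz i). W z \<le> c \<longrightarrow> norm z \<le> R) \<and>
    (\<forall>R. \<exists>B. \<forall>e P z. \<bar>e\<bar> \<le> R \<longrightarrow> P \<in> region M Rv \<longrightarrow> z \<in> coord_space (nz i) \<longrightarrow>
      W' z ((\<lambda>(v, w, \<mu>). fbar q r (f i) (zs i) z e v w \<mu>) P) + C * (drift i z e P)\<^sup>2 \<le> - norm z + B)"

text \<open>The squared drift is the cost left by \<open>internal_lyapunov\<close>, and the changed
  supply rate makes the zero dynamics pay it. The leader's input enters through
  \<open>\<gamma>2\<close>, which is bounded here and becomes a constant supply.\<close>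

lemma zero_dynamics_lyapunov:
  assumes C: "C \<ge> 0"
  shows "\<exists>W W'. zero_dynamics_lyap M Rv C i W W'"
proof -
  obtain V \<alpha>1 \<alpha>2 \<gamma>1 \<gamma>2 \<alpha> where V: "smooth_on UNIV (V :: real^'z::{finite,linorder} \<Rightarrow> real)" and \<alpha>1: "class_Kinf \<alpha>1"
    and V\<alpha>12: "\<forall>z\<in>coord_space (nz i). \<alpha>1 (norm z) \<le> V z \<and> V z \<le> \<alpha>2 (norm z)"
    and \<gamma>1: "smooth_on UNIV (\<gamma>1 :: real \<Rightarrow> real)" and \<gamma>2: "smooth_on UNIV (\<gamma>2 :: real^'w \<Rightarrow> real)" and \<alpha>: "class_Kinf \<alpha>"
    and diss0: "\<forall>(v, w, \<mu>)\<in>region M Rv. \<forall>z\<in>coord_space (nz i). \<forall>e.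
      frechet_derivative V (at z) (fbar q r (f i) (zs i) z e v w \<mu>) \<le> - \<alpha> (norm z) + \<gamma>1 e + \<gamma>2 w"
    using iss[of i, unfolded error_dynamics_iss_def, rule_format, OF compact_region[of M Rv]]
    by (elim exE conjE) (rule that; assumption)
  have V\<alpha>: "\<And>z. z \<in> coord_space (nz i) \<Longrightarrow> \<alpha>1 (norm z) \<le> V z" using V\<alpha>12 by blast
  have diss: "\<And>v w \<mu> z e. (v, w, \<mu>) \<in> region M Rv \<Longrightarrow> z \<in> coord_space (nz i) \<Longrightarrow>
      frechet_derivative V (at z) (fbar q r (f i) (zs i) z e v w \<mu>) \<le> - \<alpha> (norm z) + \<gamma>1 e + \<gamma>2 w"
    using diss0 by fast
  have "bounded (\<gamma>2 ` {w. infnorm w \<le> l})"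
    by (intro compact_imp_bounded compact_continuous_image continuous_on_subset[OF smooth_on_real_continuous[OF \<gamma>2]] compact_infnorm_ball subset_UNIV)
  then obtain c2 where c2: "\<And>w. infnorm w \<le> l \<Longrightarrow> \<bar>\<gamma>2 w\<bar> \<le> c2" unfolding bounded_iff by auto
  show ?thesis
    unfolding zero_dynamics_lyap_def
  proof (rule supply_change[OF smooth_on_C1[OF V] \<alpha>1 V\<alpha> \<alpha> smooth_on_real_continuous[OF \<gamma>1], where \<Sigma> = "region M Rv"
        and fb = "\<lambda>z e. \<lambda>(v, w, \<mu>). fbar q r (f i) (zs i) z e v w \<mu>" and a = "drift i" and \<beta> = c2 and C = C])
    fix P e and z :: "real^'z::{finite,linorder}" assume P: "P \<in> region M Rv" and z: "z \<in> coord_space (nz i)"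
    obtain v w \<mu> where eq: "P = (v, w, \<mu>)" by (cases P) auto
    have "\<gamma>2 w \<le> c2" using c2[of w] P by (auto simp: eq region_def)
    then show "frechet_derivative V (at z) ((\<lambda>(v, w, \<mu>). fbar q r (f i) (zs i) z e v w \<mu>) P) \<le> - \<alpha> (norm z) + \<gamma>1 e + c2"
      using diss[of v w \<mu> z e] P z by (simp add: eq)
  next
    show "\<exists>H. \<forall>P z e. P \<in> region M Rv \<longrightarrow> z \<in> coord_space (nz i) \<longrightarrow> norm z \<le> R \<longrightarrow> \<bar>e\<bar> \<le> R \<longrightarrow> (drift i z e P)\<^sup>2 \<le> H" for R
      using drift_bounded[OF compact_region, of M Rv R i] by blast
    show "C \<ge> 0" by (rule C)
  qed (assumption, rule exI, rule exI, intro conjI, assumption, simp, simp, simp)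
qed

definition U :: "('i \<Rightarrow> real^'z::{finite,linorder} \<Rightarrow> real) \<Rightarrow> ('i \<Rightarrow> real^'o::{finite,linorder} \<Rightarrow> real) \<Rightarrow> real^'m \<Rightarrow> ('v, 'z, 'o, 'i) cl_state \<Rightarrow> real" where
  "U W Q \<mu> s = (\<Sum>i\<in>UNIV. W i (zbar \<mu> i s) + Q i (xt \<mu> i s)) + 1 / 2 * (L (err \<mu> s) \<bullet> err \<mu> s)"

definition U' :: "('i \<Rightarrow> real^'z::{finite,linorder} \<Rightarrow> real^'z::{finite,linorder} \<Rightarrow> real) \<Rightarrow> ('i \<Rightarrow> real^'o::{finite,linorder} \<Rightarrow> real^'o::{finite,linorder} \<Rightarrow> real) \<Rightarrow> real^'m \<Rightarrow> ('v, 'z, 'o, 'i) cl_state \<Rightarrow> ('v, 'z, 'o, 'i) cl_state \<Rightarrow> real" where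
  "U' W' Q' \<mu> s h = (\<Sum>i\<in>UNIV. W' i (zbar \<mu> i s) (zbar' \<mu> i s h) + Q' i (xt \<mu> i s) (xt' \<mu> i s h)) + L (err \<mu> s) \<bullet> err' \<mu> s h"

text \<open>Self-adjointness of L merges the two terms of the product rule.\<close>

lemma C1_error_energy: "C1 (\<lambda>s. 1 / 2 * (L (err \<mu> s) \<bullet> err \<mu> s)) (\<lambda>s h. L (err \<mu> s) \<bullet> err' \<mu> s h)"
proof -
  have "C1 (\<lambda>s. L (err \<mu> s)) (\<lambda>s h. L (err' \<mu> s h))"
    by (rule C1_compose[OF C1_err C1_linear[OF linear_grounded_laplacian]])
  from C1_mult[OF C1_const[of "1/2"] C1_inner[OF this C1_err]]
  have "C1 (\<lambda>s. 1 / 2 * (L (err \<mu> s) \<bullet> err \<mu> s)) (\<lambda>s h. 1 / 2 * (L (err \<mu> s) \<bullet> err' \<mu> s h + L (err' \<mu> s h) \<bullet> err \<mu> s) + 0 * (L (err \<mu> s) \<bullet> err \<mu> s))" .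
  moreover have "1 / 2 * (L a \<bullet> b + L b \<bullet> a) + 0 * (L a \<bullet> a) = L a \<bullet> b" for a b
    using laplacian_sym[of b a] by (simp add: inner_commute)
  ultimately show ?thesis by simp
qed

lemma C1_U:
  assumes "\<And>i. C1 (W i) (W' i)" "\<And>i. C1 (Q i) (Q' i)"
  shows "C1 (U W Q \<mu>) (U' W' Q' \<mu>)"
  unfolding U_def[abs_def] U'_def[abs_def]
  by (intro C1_add C1_sum C1_error_energy C1_compose[OF C1_zbar assms(1)] C1_compose[OF C1_xt assms(2)])

text \<open>Vanishes exactly where the j-th sign may be undetermined if \<gamma> is nonzero, which
  is the condition of \<open>filippov_sign_increment_le\<close>.\<close>

lemma error_energy_jump: "L (err \<mu> s) \<bullet> err' \<mu> s (jump \<gamma> j) = - \<gamma> * L (err \<mu> s) $ j"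
  by (simp add: jump_components inner_axis)

lemma U'_jump:
  assumes "\<And>i. C1 (W i) (W' i)" "\<And>i. C1 (Q i) (Q' i)"
  shows "U' W' Q' \<mu> s (jump \<gamma> j) = - \<gamma> * L (err \<mu> s) $ j"
  unfolding U'_def error_energy_jump jump_components(1,3)
  by (simp add: linear_0[OF C1_D(3)[OF assms(1)]] linear_0[OF C1_D(3)[OF assms(2)]])

lemma error_energy_dynamics:
  "L (err \<mu> s) \<bullet> err' \<mu> s (X \<rho> \<gamma> \<mu> w t s) =
    (\<Sum>i\<in>UNIV. L (err \<mu> s) $ i * (drift i (zbar \<mu> i s) (err \<mu> s $ i) (st_v s, w t, \<mu>) - row_app (Psi_mat (m i)) (xt \<mu> i s + col_app (G i) (err \<mu> s $ i))))
    - (\<Sum>i\<in>UNIV. \<rho> (L (err \<mu> s) $ i) * (L (err \<mu> s) $ i)\<^sup>2) - \<gamma> * (\<Sum>i\<in>UNIV. \<bar>L (err \<mu> s) $ i\<bar>)"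
proof -
  have "L (err \<mu> s) $ i * ubar \<rho> \<gamma> \<mu> s i = - \<rho> (L (err \<mu> s) $ i) * (L (err \<mu> s) $ i)\<^sup>2 - \<gamma> * \<bar>L (err \<mu> s) $ i\<bar>" for i
    by (simp add: ubar_def abs_sgn power2_eq_square algebra_simps)
  note h = this
  have "L (err \<mu> s) $ i * err' \<mu> s (X \<rho> \<gamma> \<mu> w t s) $ i =
     L (err \<mu> s) $ i * (drift i (zbar \<mu> i s) (err \<mu> s $ i) (st_v s, w t, \<mu>) - row_app (Psi_mat (m i)) (xt \<mu> i s + col_app (G i) (err \<mu> s $ i)))
     - \<rho> (L (err \<mu> s) $ i) * (L (err \<mu> s) $ i)\<^sup>2 - \<gamma> * \<bar>L (err \<mu> s) $ i\<bar>" for i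
    unfolding err_dynamics using h[of i] by (simp add: algebra_simps)
  then show ?thesis by (simp add: inner_vec_def sum_subtractf sum_distrib_left)
qed

text \<open>The constant \<open>c0\<close> depends neither on \<open>\<gamma>\<close> nor on the initial state, so that \<open>\<gamma>\<close> can be chosen after the ultimate
  bound that this inequality implies.\<close>

definition lyapunov_design where
  "lyapunov_design M Rv \<rho> c0 W W' Q Q' \<longleftrightarrow> smooth_on UNIV \<rho> \<and> (\<forall>s. 1 \<le> \<rho> s) \<and>
    (\<forall>i. C1 (W i) (W' i)) \<and> (\<forall>i. C1 (Q i) (Q' i)) \<and>
    (\<forall>i. \<forall>z\<in>coord_space (nz i). 0 \<le> W i z) \<and> (\<forall>i c. \<exists>R. \<forall>z\<in>coord_space (nz i). W i z \<le> c \<longrightarrow> norm z \<le> R) \<and>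
    (\<forall>i. \<exists>k>0. \<forall>x. k * (norm x)\<^sup>2 \<le> Q i x) \<and>
    (\<forall>\<gamma> \<mu> w t s. (st_v s, w t, \<mu>) \<in> region M Rv \<longrightarrow>
       U' W' Q' \<mu> s (X \<rho> \<gamma> \<mu> w t s) \<le> c0 - (\<Sum>i\<in>UNIV. norm (zbar \<mu> i s) + (norm (xt \<mu> i s))\<^sup>2 + (L (err \<mu> s) $ i)\<^sup>2)
         - \<gamma> * (\<Sum>i\<in>UNIV. \<bar>L (err \<mu> s) $ i\<bar>))"

lemma lyapunov_design_exists: "\<exists>\<rho> c0 W W' Q Q'. lyapunov_design M Rv \<rho> c0 W W' Q Q'"
proof -
  obtain Q Q' c C where Q: "\<And>i. C1 (Q i :: real^'o::{finite,linorder} \<Rightarrow> real) (Q' i)" "\<And>i. c i > 0" "\<And>i. C i \<ge> 0" "\<And>i x. c i * (norm x)\<^sup>2 \<le> Q i x"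
    "\<And>i x e a \<sigma>. x \<in> coord_space (np i) \<Longrightarrow>
      Q' i x (mat_app (F_mat (m i) (G i)) x + (mat_app (F_mat (m i) (G i)) (col_app (G i) e :: real^'o::{finite,linorder}) - col_app (G i) a))
        + \<sigma> * (a - row_app (Psi_mat (m i)) (x + col_app (G i) e)) \<le> - (norm x)\<^sup>2 + 3 * \<sigma>\<^sup>2 + C i * (a\<^sup>2 + e\<^sup>2)"
    using internal_lyapunov by metis
  let ?fb = "\<lambda>i z e P. (\<lambda>(v, w, \<mu>). fbar q r (f i) (zs i) z e v w \<mu>) P"
  obtain W W' where W: "\<And>i. C1 (W i) (W' i)" "\<And>i z. z \<in> coord_space (nz i) \<Longrightarrow> 0 \<le> W i z"
    "\<And>i c. \<exists>R. \<forall>z\<in>coord_space (nz i). W i z \<le> c \<longrightarrow> norm z \<le> R"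
    "\<And>i R. \<exists>B. \<forall>e P z. \<bar>e\<bar> \<le> R \<longrightarrow> P \<in> region M Rv \<longrightarrow> z \<in> coord_space (nz i) \<longrightarrow>
      W' i z (?fb i z e P) + C i * (drift i z e P)\<^sup>2 \<le> - norm z + B"
  proof -
    have "\<forall>i. \<exists>W W'. zero_dynamics_lyap M Rv (C i) i W W'" using zero_dynamics_lyapunov[OF Q(3)] by blast
    then obtain W W' where "\<And>i. zero_dynamics_lyap M Rv (C i) i (W i) (W' i)" by metis
    then show ?thesis unfolding zero_dynamics_lyap_def by (intro that) blast+
  qed
  \<comment> \<open>Everything the gain has to dominate. Adding \<open>norm z\<close> here leaves
    \<open>- norm z\<close> in the final inequality, as dissipation of the zero dynamics.\<close>
  define T where "T i z e P = W' i z (?fb i z e P) + C i * (drift i z e P)\<^sup>2 + norm z + C i * e\<^sup>2" for i z e P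
  have T: "\<exists>B. \<forall>e P z. \<bar>e\<bar> \<le> R \<longrightarrow> P \<in> region M Rv \<longrightarrow> z \<in> coord_space (nz i) \<longrightarrow> T i z e P \<le> B" for i R
  proof -
    obtain B where B: "\<And>e P z. \<bar>e\<bar> \<le> R \<Longrightarrow> P \<in> region M Rv \<Longrightarrow> z \<in> coord_space (nz i) \<Longrightarrow>
      W' i z (?fb i z e P) + C i * (drift i z e P)\<^sup>2 \<le> - norm z + B" using W(4) by metis
    have "T i z e P \<le> B + C i * R\<^sup>2" if e: "\<bar>e\<bar> \<le> R" and "P \<in> region M Rv" "z \<in> coord_space (nz i)" for e P z
    proof -
      have "e\<^sup>2 \<le> R\<^sup>2" using power_mono[OF e, of 2] by simp
      then have "C i * e\<^sup>2 \<le> C i * R\<^sup>2" using Q(3) by (intro mult_left_mono)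
      then show ?thesis using B[OF that] unfolding T_def by linarith
    qed
    then show ?thesis by blast
  qed
  obtain k where k: "k \<ge> 0" "\<And>e. norm e \<le> k * norm (L e)" using norm_le_laplacian by blast
  have "\<exists>\<rho> c0. smooth_on UNIV \<rho> \<and> (\<forall>s. 1 \<le> \<rho> s) \<and> (\<forall>P z e. P \<in> region M Rv \<longrightarrow> (\<forall>i. z i \<in> coord_space (nz i)) \<longrightarrow>
       (\<Sum>i\<in>UNIV. T i (z i) (e $ i) P) + 4 * (\<Sum>i\<in>UNIV. (L e $ i)\<^sup>2) - (\<Sum>i\<in>UNIV. \<rho> (L e $ i) * (L e $ i)\<^sup>2) \<le> c0)"
  proof (rule choose_gain[where T = T and L = L and k = k and \<Sigma> = "region M Rv" and Z = "\<lambda>i. coord_space (nz i)", OF T k])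
    fix \<rho> c0 assume "smooth_on UNIV \<rho>" "\<And>s. 1 \<le> \<rho> s"
      "\<And>P z e. P \<in> region M Rv \<Longrightarrow> (\<And>i. z i \<in> coord_space (nz i)) \<Longrightarrow>
       (\<Sum>i\<in>UNIV. T i (z i) (e $ i) P) + 4 * (\<Sum>i\<in>UNIV. (L e $ i)\<^sup>2) - (\<Sum>i\<in>UNIV. \<rho> (L e $ i) * (L e $ i)\<^sup>2) \<le> c0"
    then show ?thesis by (intro exI[of _ \<rho>] exI[of _ c0]) simp
  qed
  then obtain \<rho> c0 where \<rho>: "smooth_on UNIV \<rho>" "\<And>s. 1 \<le> \<rho> s" and c0:
    "\<And>P z e. P \<in> region M Rv \<Longrightarrow> (\<And>i. z i \<in> coord_space (nz i)) \<Longrightarrow>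
       (\<Sum>i\<in>UNIV. T i (z i) (e $ i) P) + 4 * (\<Sum>i\<in>UNIV. (L e $ i)\<^sup>2) - (\<Sum>i\<in>UNIV. \<rho> (L e $ i) * (L e $ i)\<^sup>2) \<le> c0"
    by (elim exE conjE) (rule that, assumption, blast, blast)
  have main: "U' W' Q' \<mu> s (X \<rho> \<gamma> \<mu> w t s) \<le> c0 - (\<Sum>i\<in>UNIV. norm (zbar \<mu> i s) + (norm (xt \<mu> i s))\<^sup>2 + (L (err \<mu> s) $ i)\<^sup>2)
         - \<gamma> * (\<Sum>i\<in>UNIV. \<bar>L (err \<mu> s) $ i\<bar>)" if P: "(st_v s, w t, \<mu>) \<in> region M Rv" for \<gamma> \<mu> w t s
  proof -
    let ?P = "(st_v s, w t, \<mu>)"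
    let ?a = "\<lambda>i. drift i (zbar \<mu> i s) (err \<mu> s $ i) ?P" and ?\<sigma> = "\<lambda>i. L (err \<mu> s) $ i" and ?e = "\<lambda>i. err \<mu> s $ i"
    let ?b = "\<lambda>i. row_app (Psi_mat (m i)) (xt \<mu> i s + col_app (G i) (err \<mu> s $ i))"
    \<comment> \<open>The estimate of \<open>internal_lyapunov\<close> contributes
      \<open>3 * \<sigma>\<^sup>2\<close>; a fourth square is added and subtracted, so that the
      virtual errors too appear in the dissipation.\<close>
    have "W' i (zbar \<mu> i s) (zbar' \<mu> i s (X \<rho> \<gamma> \<mu> w t s)) + Q' i (xt \<mu> i s) (xt' \<mu> i s (X \<rho> \<gamma> \<mu> w t s)) + ?\<sigma> i * (?a i - ?b i)
      \<le> T i (zbar \<mu> i s) (?e i) ?P + 4 * (?\<sigma> i)\<^sup>2 - (norm (zbar \<mu> i s) + (norm (xt \<mu> i s))\<^sup>2 + (?\<sigma> i)\<^sup>2)" for i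
      using Q(5)[OF xt_in[of \<mu> i s], of "?e i" "?a i" "?\<sigma> i"]
      unfolding zbar_dynamics xt_dynamics T_def by (simp add: algebra_simps)
    then have "(\<Sum>i\<in>UNIV. W' i (zbar \<mu> i s) (zbar' \<mu> i s (X \<rho> \<gamma> \<mu> w t s)) + Q' i (xt \<mu> i s) (xt' \<mu> i s (X \<rho> \<gamma> \<mu> w t s)) + ?\<sigma> i * (?a i - ?b i))
      \<le> (\<Sum>i\<in>UNIV. T i (zbar \<mu> i s) (?e i) ?P + 4 * (?\<sigma> i)\<^sup>2 - (norm (zbar \<mu> i s) + (norm (xt \<mu> i s))\<^sup>2 + (?\<sigma> i)\<^sup>2))"
      by (rule sum_mono)
    then show ?thesis
      using c0[OF P, of "\<lambda>i. zbar \<mu> i s" "err \<mu> s", OF zbar_in]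
      unfolding U'_def error_energy_dynamics sum.distrib sum_subtractf sum_distrib_left[symmetric] by linarith
  qed
  have "lyapunov_design M Rv \<rho> c0 W W' Q Q'"
    unfolding lyapunov_design_def using \<rho> W(1-3) Q(1,2,4) main by blast
  then show ?thesis by blast
qed

end

subsection \<open>Trajectories of the closed loop\<close>

lemma le_of_square_le: "x\<^sup>2 \<le> c \<Longrightarrow> x \<le> \<bar>c\<bar> + (1::real)"
  by (smt (verit) power2_eq_square mult_le_cancel_left1 mult_right_mono mult_left_mono)

lemma continuous_bounded_cball:
  fixes h :: "'a::euclidean_space \<Rightarrow> 'b::real_normed_vector"
  assumes "continuous_on UNIV h"
  shows "\<exists>B. \<forall>x. norm x \<le> R \<longrightarrow> norm (h x) \<le> B"
proof -
  have "bounded (h ` cball 0 R)"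
    by (intro compact_imp_bounded compact_continuous_image continuous_on_subset[OF assms]) auto
  then obtain B where "\<forall>y\<in>h ` cball 0 R. norm y \<le> B" unfolding bounded_iff by blast
  then have "\<forall>x. norm x \<le> R \<longrightarrow> norm (h x) \<le> B" by (simp add: ball_simps)
  then show ?thesis by blast
qed

context leader_follower
begin

definition leader_bound where
  "leader_bound M Rv \<longleftrightarrow> (\<forall>v :: real^'v. v \<in> cube M \<longrightarrow> norm v \<le> Rv) \<and>
    (\<forall>w v T t. admissible_input l w \<longrightarrow> 0 < T \<longrightarrow> leader_solution p q w {0..<T} v \<longrightarrow> v 0 \<in> cube M \<longrightarrow>
      t \<in> {0..<T} \<longrightarrow> norm (v t) \<le> Rv)"

context
  fixes M Rv \<rho> c0 W W' Q Q'
  assumes design: "lyapunov_design M Rv \<rho> c0 W W' Q Q'"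
    and leader_Rv: "leader_bound M Rv"
begin

lemma design_facts:
  "continuous_on UNIV \<rho>" "1 \<le> \<rho> s0" "C1 (W i) (W' i)" "C1 (Q i) (Q' i)" "z \<in> coord_space (nz i) \<Longrightarrow> 0 \<le> W i z"
  "\<exists>R. \<forall>z\<in>coord_space (nz i). W i z \<le> c \<longrightarrow> norm z \<le> R" "\<exists>k>0. \<forall>x. k * (norm x)\<^sup>2 \<le> Q i x"
  "(st_v s, w t, \<mu>) \<in> region M Rv \<Longrightarrow>
     U' W' Q' \<mu> s (X \<rho> \<gamma> \<mu> w t s) \<le> c0 - (\<Sum>i\<in>UNIV. norm (zbar \<mu> i s) + (norm (xt \<mu> i s))\<^sup>2 + (L (err \<mu> s) $ i)\<^sup>2)
       - \<gamma> * (\<Sum>i\<in>UNIV. \<bar>L (err \<mu> s) $ i\<bar>)"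
proof -
  show "continuous_on UNIV \<rho>" "1 \<le> \<rho> s0" "C1 (W i) (W' i)" "C1 (Q i) (Q' i)" "z \<in> coord_space (nz i) \<Longrightarrow> 0 \<le> W i z"
    "\<exists>R. \<forall>z\<in>coord_space (nz i). W i z \<le> c \<longrightarrow> norm z \<le> R" "\<exists>k>0. \<forall>x. k * (norm x)\<^sup>2 \<le> Q i x"
    using design smooth_on_real_continuous[of \<rho>] unfolding lyapunov_design_def by simp_all
  assume reg: "(st_v s, w t, \<mu>) \<in> region M Rv"
  have "\<forall>\<gamma> \<mu> w t s. (st_v s, w t, \<mu>) \<in> region M Rv \<longrightarrow>
     U' W' Q' \<mu> s (X \<rho> \<gamma> \<mu> w t s) \<le> c0 - (\<Sum>i\<in>UNIV. norm (zbar \<mu> i s) + (norm (xt \<mu> i s))\<^sup>2 + (L (err \<mu> s) $ i)\<^sup>2)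
       - \<gamma> * (\<Sum>i\<in>UNIV. \<bar>L (err \<mu> s) $ i\<bar>)"
    using design unfolding lyapunov_design_def by (elim conjE)
  from this[THEN spec[of _ \<gamma>], THEN spec[of _ \<mu>], THEN spec[of _ w], THEN spec[of _ t], THEN spec[of _ s]] reg
  show "U' W' Q' \<mu> s (X \<rho> \<gamma> \<mu> w t s) \<le> c0 - (\<Sum>i\<in>UNIV. norm (zbar \<mu> i s) + (norm (xt \<mu> i s))\<^sup>2 + (L (err \<mu> s) $ i)\<^sup>2)
     - \<gamma> * (\<Sum>i\<in>UNIV. \<bar>L (err \<mu> s) $ i\<bar>)" by (rule mp)
qed

section \<open>Properness and the ultimate level of the Lyapunov function\<close>

lemma U_bounded:
  "\<exists>B. \<forall>\<mu> s. (\<forall>i. norm (zbar \<mu> i s) \<le> R \<and> norm (xt \<mu> i s) \<le> R) \<and> norm (err \<mu> s) \<le> R \<longrightarrow> U W Q \<mu> s \<le> B"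
proof -
  have bd: "\<exists>B. \<forall>x. norm x \<le> R \<longrightarrow> h x \<le> B" if h: "C1 h h'" for h :: "'a::euclidean_space \<Rightarrow> real" and h'
  proof -
    obtain B where "\<And>x. norm x \<le> R \<Longrightarrow> norm (h x) \<le> B" using continuous_bounded_cball[OF C1_D(4)[OF h]] by blast
    then have "\<And>x. norm x \<le> R \<Longrightarrow> h x \<le> B" by fastforce
    then show ?thesis by blast
  qed
  obtain BW where BW: "\<And>i x. norm x \<le> R \<Longrightarrow> W i x \<le> BW i" using bd[OF design_facts(3)] by metis
  obtain BQ where BQ: "\<And>i x. norm x \<le> R \<Longrightarrow> Q i x \<le> BQ i" using bd[OF design_facts(4)] by metis
  obtain K where K: "K \<ge> 0" "\<And>e. norm (L e) \<le> K * norm e" using linear_norm_bound[OF linear_grounded_laplacian] by metis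
  have "U W Q \<mu> s \<le> (\<Sum>i\<in>UNIV. BW i + BQ i) + 1 / 2 * (K * R * R)"
    if "\<forall>i. norm (zbar \<mu> i s) \<le> R \<and> norm (xt \<mu> i s) \<le> R" "norm (err \<mu> s) \<le> R" for \<mu> s
  proof -
    have "L (err \<mu> s) \<bullet> err \<mu> s \<le> norm (L (err \<mu> s)) * norm (err \<mu> s)" by (rule norm_cauchy_schwarz)
    also have "\<dots> \<le> (K * R) * R"
      using K that(2) order_trans[OF K(2)[of "err \<mu> s"] mult_left_mono[OF that(2) K(1)]] order_trans[OF norm_ge_zero that(2)]
      by (intro mult_mono) auto
    finally show ?thesis unfolding U_def using that(1) BW BQ by (intro add_mono sum_mono mult_left_mono) auto
  qed
  then show ?thesis by blast
qed

lemma U_coercive: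
  "\<exists>R. \<forall>\<mu> s. U W Q \<mu> s \<le> c \<longrightarrow> (\<forall>i. norm (zbar \<mu> i s) \<le> R \<and> norm (xt \<mu> i s) \<le> R) \<and> norm (err \<mu> s) \<le> R"
proof -
  obtain RW where RW: "\<And>i z. z \<in> coord_space (nz i) \<Longrightarrow> W i z \<le> c \<Longrightarrow> norm z \<le> RW i" using design_facts(6)[where c = c] by metis
  obtain k where k: "\<And>i. k i > 0" "\<And>i x. k i * (norm x)\<^sup>2 \<le> Q i x" using design_facts(7) by metis
  obtain cL where cL: "cL > 0" "\<And>e. cL * (norm e)\<^sup>2 \<le> L e \<bullet> e" using laplacian_coercive by blast
  define RQ where "RQ i = \<bar>c / k i\<bar> + 1" for i
  define Re where "Re = \<bar>2 * c / cL\<bar> + 1"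
  define R where "R = (\<Sum>i\<in>UNIV. \<bar>RW i\<bar>) + (\<Sum>i\<in>UNIV. RQ i) + Re"
  have nn: "0 \<le> (\<Sum>i\<in>UNIV. \<bar>RW i\<bar>)" "0 \<le> (\<Sum>i\<in>UNIV. RQ i)" "0 \<le> Re"
    using sum_nonneg[of UNIV "\<lambda>i. \<bar>RW i\<bar>"] sum_nonneg[of UNIV RQ] by (simp_all add: RQ_def Re_def)
  have "(\<forall>i. norm (zbar \<mu> i s) \<le> R \<and> norm (xt \<mu> i s) \<le> R) \<and> norm (err \<mu> s) \<le> R" if U: "U W Q \<mu> s \<le> c" for \<mu> s
  proof -
    have W0: "0 \<le> W i (zbar \<mu> i s)" for i using design_facts(5) zbar_in by blast
    have Q0: "0 \<le> Q i (xt \<mu> i s)" for i using k(2)[of i "xt \<mu> i s"] k(1)[of i] order_trans[OF _ k(2)] by (simp add: less_imp_le)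
    have E: "0 \<le> L (err \<mu> s) \<bullet> err \<mu> s" by (rule laplacian_form_nonneg)
    have S0: "0 \<le> (\<Sum>i\<in>UNIV. W i (zbar \<mu> i s) + Q i (xt \<mu> i s))" using W0 Q0 by (intro sum_nonneg add_nonneg_nonneg)
    have WQ: "W i (zbar \<mu> i s) + Q i (xt \<mu> i s) \<le> c" for i
    proof -
      have "W i (zbar \<mu> i s) + Q i (xt \<mu> i s) \<le> (\<Sum>i\<in>UNIV. W i (zbar \<mu> i s) + Q i (xt \<mu> i s))"
        using W0 Q0 by (intro member_le_sum add_nonneg_nonneg) auto
      then show ?thesis using U E unfolding U_def by linarith
    qed
    have z: "norm (zbar \<mu> i s) \<le> R" for i
    proof -
      have "norm (zbar \<mu> i s) \<le> RW i" using WQ[of i] Q0[of i] by (intro RW zbar_in) linarith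
      moreover have "\<bar>RW i\<bar> \<le> (\<Sum>i\<in>UNIV. \<bar>RW i\<bar>)" by (rule member_le_sum) auto
      ultimately show ?thesis using nn unfolding R_def by linarith
    qed
    have x: "norm (xt \<mu> i s) \<le> R" for i
    proof -
      have "k i * (norm (xt \<mu> i s))\<^sup>2 \<le> c" using k(2)[of i "xt \<mu> i s"] WQ[of i] W0[of i] by linarith
      then have "(norm (xt \<mu> i s))\<^sup>2 \<le> c / k i" using k(1)[of i] by (simp add: field_simps)
      then have "norm (xt \<mu> i s) \<le> RQ i" unfolding RQ_def by (rule le_of_square_le)
      also have "\<dots> \<le> (\<Sum>i\<in>UNIV. RQ i)" by (rule member_le_sum) (auto simp: RQ_def)
      finally show ?thesis using nn unfolding R_def by linarith
    qed
    have "cL * (norm (err \<mu> s))\<^sup>2 \<le> 2 * c" using cL(2)[of "err \<mu> s"] U S0 unfolding U_def by linarith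
    then have "(norm (err \<mu> s))\<^sup>2 \<le> 2 * c / cL" using cL(1) by (simp add: field_simps)
    then have "norm (err \<mu> s) \<le> Re" unfolding Re_def by (rule le_of_square_le)
    then have "norm (err \<mu> s) \<le> R" using nn unfolding R_def by linarith
    then show ?thesis using z x by blast
  qed
  then show ?thesis by blast
qed

text \<open>Where the derivative exceeds -1, the dissipation is at most \<open>c0 + 1\<close>, which
  confines all errors to a ball of radius R; c bounds U on that ball. A nonnegative
  \<open>\<gamma>\<close> only helps, so c does not depend on it.\<close>

lemma ultimate_level:
  "\<exists>c. \<forall>\<gamma> \<mu> w t s. 0 \<le> \<gamma> \<longrightarrow> (st_v s, w t, \<mu>) \<in> region M Rv \<longrightarrow> c < U W Q \<mu> s \<longrightarrow> U' W' Q' \<mu> s (X \<rho> \<gamma> \<mu> w t s) \<le> - 1"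
proof -
  obtain k where k: "k \<ge> 0" "\<And>e. norm e \<le> k * norm (L e)" using norm_le_laplacian by blast
  define r where "r = \<bar>c0 + 1\<bar> + 1"
  define R where "R = r + k * r"
  have r: "r \<ge> 0" "r \<le> R" "k * r \<le> R" using k(1) by (auto simp: r_def R_def)
  obtain c where c: "\<And>\<mu> s. \<forall>i. norm (zbar \<mu> i s) \<le> R \<and> norm (xt \<mu> i s) \<le> R \<Longrightarrow> norm (err \<mu> s) \<le> R \<Longrightarrow> U W Q \<mu> s \<le> c"
    using U_bounded[of R] by blast
  have "U' W' Q' \<mu> s (X \<rho> \<gamma> \<mu> w t s) \<le> - 1" if \<gamma>: "0 \<le> \<gamma>" and reg: "(st_v s, w t, \<mu>) \<in> region M Rv" and Uc: "c < U W Q \<mu> s" for \<gamma> \<mu> w t s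
  proof (rule ccontr)
    assume neg: "\<not> ?thesis"
    let ?S = "\<Sum>i\<in>UNIV. norm (zbar \<mu> i s) + (norm (xt \<mu> i s))\<^sup>2 + (L (err \<mu> s) $ i)\<^sup>2"
    have "0 \<le> \<gamma> * (\<Sum>i\<in>UNIV. \<bar>L (err \<mu> s) $ i\<bar>)" using \<gamma> by (intro mult_nonneg_nonneg sum_nonneg) auto
    then have S: "?S \<le> c0 + 1" using design_facts(8)[where s = s and w = w and t = t and \<mu> = \<mu> and \<gamma> = \<gamma>] reg neg by linarith
    have mem: "norm (zbar \<mu> i s) + (norm (xt \<mu> i s))\<^sup>2 + (L (err \<mu> s) $ i)\<^sup>2 \<le> c0 + 1" for i
    proof -
      have "norm (zbar \<mu> i s) + (norm (xt \<mu> i s))\<^sup>2 + (L (err \<mu> s) $ i)\<^sup>2 \<le> ?S" by (rule member_le_sum) auto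
      then show ?thesis using S by linarith
    qed
    have z: "norm (zbar \<mu> i s) \<le> R" for i
      using mem[of i] r(2) zero_le_power2[of "norm (xt \<mu> i s)"] zero_le_power2[of "L (err \<mu> s) $ i"] unfolding r_def by linarith
    have x: "norm (xt \<mu> i s) \<le> R" for i
    proof -
      have "(norm (xt \<mu> i s))\<^sup>2 \<le> c0 + 1"
        using mem[of i] norm_ge_zero[of "zbar \<mu> i s"] zero_le_power2[of "L (err \<mu> s) $ i"] by linarith
      from le_of_square_le[OF this] show ?thesis using r(2) unfolding r_def by linarith
    qed
    have "(norm (L (err \<mu> s)))\<^sup>2 = (\<Sum>i\<in>UNIV. (L (err \<mu> s) $ i)\<^sup>2)"
      unfolding power2_norm_eq_inner inner_vec_def by (simp add: power2_eq_square)
    also have "\<dots> \<le> ?S" by (intro sum_mono) auto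
    finally have "(norm (L (err \<mu> s)))\<^sup>2 \<le> c0 + 1" using S by linarith
    from le_of_square_le[OF this] have "norm (L (err \<mu> s)) \<le> r" by (simp add: r_def)
    then have "norm (err \<mu> s) \<le> k * r" using k(2)[of "err \<mu> s"] mult_left_mono[OF _ k(1)] order_trans by blast
    then have "norm (err \<mu> s) \<le> R" using r(3) by linarith
    then show False using c[of \<mu> s] z x Uc by force
  qed
  then show ?thesis by blast
qed

section \<open>Filippov trajectories for one parameter value and one leader input\<close>

context
  fixes \<gamma> :: real and \<mu> :: "real^'m" and w :: "real \<Rightarrow> real^'w"
  assumes \<gamma>: "0 \<le> \<gamma>" and \<mu>: "\<mu> \<in> cube M" and w: "admissible_input l w"
begin

abbreviation "XX \<equiv> X \<rho> \<gamma> \<mu> w"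

interpretation sf: sign_field XX "closed_loop p q r f g S D A m G (\<lambda>_. \<rho>) (\<lambda>_. 0) \<mu> w" "\<lambda>i s. L (err \<mu> s) $ i" "jump \<gamma>"
  using w by (intro sign_field_X design_facts(1)) (auto simp: admissible_input_def)

text \<open>The leader's equation contains no sign, so its component is a classical solution and
  leader stability applies on \<open>{0..<t}\<close>; continuity adds the endpoint.\<close>

lemma trajectory_in_region:
  assumes sol: "filippov_solution XX {0..t} x" and t: "0 \<le> t" and x0: "st_v (x 0) \<in> cube M" and \<tau>: "\<tau> \<in> {0..t}"
  shows "(st_v (x \<tau>), w \<tau>, \<mu>) \<in> region M Rv"
proof -
  have wc: "continuous_on {0..t} w" using w by (auto simp: admissible_input_def intro: continuous_on_subset)
  have xc: "continuous_on {0..t} x" using filippov_solution_continuous_on[OF sol] by blast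
  define G where "G s = p (st_v (x s)) + q (st_v (x s)) *v w s" for s
  have pc: "continuous_on UNIV p" and qc: "continuous_on UNIV q"
    using leader_smooth smooth_on_real_continuous by blast+
  have Gc: "continuous_on {0..t} G" unfolding G_def
    by (intro continuous_on_add continuous_on_matrix_vector_mult wc continuous_on_compose2[OF pc] continuous_on_compose2[OF qc]
        continuous_on_fst xc subset_UNIV)
  have deriv: "((\<lambda>s. st_v (x s)) has_vector_derivative G s) (at s within {0..t})" if s: "s \<in> {0..t}" for s
  proof (rule filippov_solution_projection[OF sol is_interval_cc _ Gc _ s])
    show "linear (st_v :: ('v, 'z, 'o, 'i) cl_state \<Rightarrow> _)" by (simp add: linear_iff)
    fix s
    let ?h = "\<lambda>y :: ('v, 'z, 'o, 'i) cl_state. p (st_v y) + q (st_v y) *v w s"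
    have "continuous_on UNIV ?h"
      by (intro continuous_on_add continuous_on_matrix_vector_mult continuous_on_const continuous_on_compose2[OF pc] continuous_on_compose2[OF qc]
        continuous_on_fst continuous_on_id subset_UNIV)
    then have "isCont ?h (x s)" by (simp only: continuous_on_eq_continuous_at[OF open_UNIV] UNIV_I ball_simps)
    then have "(?h \<longlongrightarrow> ?h (x s)) (nhds (x s))" unfolding isCont_def by (rule tendsto_at_iff_tendsto_nhds[of ?h "x s", THEN iffD1])
    then show "((\<lambda>y. st_v (XX s y)) \<longlongrightarrow> G s) (nhds (x s))" by (simp only: X_components G_def)
  qed
  have "norm (st_v (x \<tau>)) \<le> Rv"
  proof (cases "t = 0")
    case True then show ?thesis using \<tau> x0 leader_Rv by (simp add: leader_bound_def)
  next
    case False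
    then have t0: "0 < t" using t by simp
    have "leader_solution p q w {0..<t} (\<lambda>s. st_v (x s))"
      unfolding leader_solution_def
    proof
      fix s assume "s \<in> {0..<t}"
      then have "((\<lambda>s. st_v (x s)) has_vector_derivative G s) (at s within {0..t})" by (intro deriv) auto
      then show "((\<lambda>s. st_v (x s)) has_vector_derivative p (st_v (x s)) + q (st_v (x s)) *v w s) (at s within {0..<t})"
        unfolding G_def by (rule has_vector_derivative_within_subset) auto
    qed
    then have b: "\<forall>s\<in>{0..<t}. norm (st_v (x s)) \<le> Rv"
      using leader_Rv w t0 x0 unfolding leader_bound_def by fast
    have cl: "closure {0..<t} = {0..t}" using t0 by (simp add: closure_atLeastLessThan)
    show ?thesis
      by (rule continuous_on_closure_norm_le[of "{0..<t}" "\<lambda>s. st_v (x s)" Rv \<tau>]) (use b \<tau> xc cl in \<open>auto intro!: continuous_on_fst\<close>)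
  qed
  then show ?thesis using w \<mu> \<tau> by (auto simp: region_def admissible_input_def)
qed

lemma U_decreases:
  assumes sol: "filippov_solution XX J x" and ab: "0 \<le> a" "a \<le> b" "{a..b} \<subseteq> J"
    and dec: "\<And>\<tau>. \<tau> \<in> {a..b} \<Longrightarrow> U' W' Q' \<mu> (x \<tau>) (XX \<tau> (x \<tau>)) \<le> - 1"
  shows "U W Q \<mu> (x b) \<le> U W Q \<mu> (x a) - 1 * (b - a)"
proof -
  have "U W Q \<mu> (x b) - U W Q \<mu> (x a) \<le> (- 1) * (b - a)"
    by (rule sf.filippov_sign_increment_le[OF sol ab(2,3,1) C1_U[OF design_facts(3,4)]])
      (use dec U'_jump[OF design_facts(3,4)] in auto)
  then show ?thesis by simp
qed

text \<open>The disturbance state may grow, and U does not see it. A bound on bounded time intervals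
  is enough to recover \<open>eta\<close> from its error and exclude finite escape.\<close>

lemma omega_bounded: "\<exists>B. \<forall>T y t. 0 \<le> T \<longrightarrow> T \<le> b \<longrightarrow> filippov_solution XX {0..T} y \<longrightarrow> y 0 = x0 \<longrightarrow> t \<in> {0..T} \<longrightarrow> norm (st_\<omega> (y t) $ i) \<le> B"
proof -
  let ?om = "\<lambda>s :: ('v, 'z, 'o, 'i) cl_state. st_\<omega> s $ i"
  let ?h = "\<lambda>s. ln (1 + ?om s \<bullet> ?om s)"
  obtain K where K: "K \<ge> 0" "\<And>x. norm (mat_app (S i) (x :: real^'o::{finite,linorder}) :: real^'o::{finite,linorder}) \<le> K * norm x"
    using linear_norm_bound[OF linear_mat_app] by metis
  have lin: "linear ?om" by (simp add: linear_iff)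
  have c1: "C1 ?h (\<lambda>s h. 2 * (?om s \<bullet> ?om h) / (1 + ?om s \<bullet> ?om s))"
    by (rule C1_compose[OF C1_linear[OF lin] C1_ln_norm])
  have pos: "1 + x \<bullet> x > 0" for x :: "real^'o::{finite,linorder}" using inner_ge_zero[of x] by linarith
  define B where "B = exp (?h x0 + 2 * K * \<bar>b\<bar>) + 1"
  have "norm (?om (y t)) \<le> B" if T: "0 \<le> T" "T \<le> b" and sol: "filippov_solution XX {0..T} y" and y0: "y 0 = x0" and t: "t \<in> {0..T}" for T y t
  proof -
    have "?h (y t) - ?h (y 0) \<le> 2 * K * (t - 0)"
    proof (rule sf.filippov_sign_increment_le[OF sol _ _ _ c1])
      fix \<tau>
      let ?x = "?om (y \<tau>)"
      have "?x \<bullet> mat_app (S i) ?x \<le> norm ?x * (K * norm ?x)"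
        using norm_cauchy_schwarz[of ?x "mat_app (S i) ?x"] mult_left_mono[OF K(2)[of ?x] norm_ge_zero[of ?x]] by linarith
      also have "\<dots> = K * (?x \<bullet> ?x)" by (simp add: dot_square_norm power2_eq_square)
      also have "\<dots> \<le> K * (1 + ?x \<bullet> ?x)" using K(1) by (intro mult_left_mono) auto
      finally show "2 * (?x \<bullet> ?om (XX \<tau> (y \<tau>))) / (1 + ?x \<bullet> ?x) \<le> 2 * K"
        unfolding X_components using pos[of ?x] by (simp add: pos_divide_le_eq algebra_simps)
    qed (use t in \<open>auto simp: jump_def\<close>)
    moreover have "2 * K * t \<le> 2 * K * \<bar>b\<bar>" using t T K(1) by (intro mult_left_mono) auto
    ultimately have "?h (y t) \<le> ?h x0 + 2 * K * \<bar>b\<bar>" using y0 by simp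
    then have "exp (?h (y t)) \<le> exp (?h x0 + 2 * K * \<bar>b\<bar>)" by (simp only: exp_le_cancel_iff)
    then have "1 + ?om (y t) \<bullet> ?om (y t) \<le> exp (?h x0 + 2 * K * \<bar>b\<bar>)" by (simp only: exp_ln[OF pos])
    then have "(norm (?om (y t)))\<^sup>2 \<le> exp (?h x0 + 2 * K * \<bar>b\<bar>)" by (simp add: power2_norm_eq_inner)
    from le_of_square_le[OF this] show ?thesis by (simp add: B_def)
  qed
  then show ?thesis by blast
qed

text \<open>\<open>barrier\<close> keeps U below the maximum of its initial value and the ultimate
  level, which bounds the error coordinates. The state is recovered from them, from the leader's
  bound and from \<open>omega_bounded\<close>.\<close>

lemma apriori_bound:
  assumes x0: "st_v x0 \<in> cube M"
  shows "\<exists>R. \<forall>T y. 0 \<le> T \<longrightarrow> T \<le> b \<longrightarrow> filippov_solution XX {0..T} y \<longrightarrow> y 0 = x0 \<longrightarrow> (\<forall>t\<in>{0..T}. norm (y t) \<le> R)"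
proof -
  obtain c where c: "\<And>s t. (st_v s, w t, \<mu>) \<in> region M Rv \<Longrightarrow> c < U W Q \<mu> s \<Longrightarrow> U' W' Q' \<mu> s (XX t s) \<le> - 1"
    using ultimate_level \<gamma> by metis
  obtain R where R: "\<And>s. U W Q \<mu> s \<le> max (U W Q \<mu> x0) c \<Longrightarrow> (\<forall>i. norm (zbar \<mu> i s) \<le> R \<and> norm (xt \<mu> i s) \<le> R) \<and> norm (err \<mu> s) \<le> R"
    using U_coercive[of "max (U W Q \<mu> x0) c"] by blast
  obtain Bw where Bw: "\<And>i T y t. 0 \<le> T \<Longrightarrow> T \<le> b \<Longrightarrow> filippov_solution XX {0..T} y \<Longrightarrow> y 0 = x0 \<Longrightarrow> t \<in> {0..T} \<Longrightarrow> norm (st_\<omega> (y t) $ i) \<le> Bw i"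
    using omega_bounded[of b x0] by metis
  have "continuous_on UNIV (\<lambda>v. zs i v \<mu>)" for i
    by (intro continuous_on_smooth2[OF zs(1)] continuous_on_const continuous_on_id)
  from continuous_bounded_cball[OF this] obtain Bz where Bz: "\<And>i v. norm v \<le> Rv \<Longrightarrow> norm (zs i v \<mu>) \<le> Bz i" by metis
  have "continuous_on UNIV (\<lambda>v. r v \<mu>)"
    by (intro continuous_on_smooth2[OF leader_smooth(3)] continuous_on_const continuous_on_id)
  from continuous_bounded_cball[OF this] obtain Br where Br: "\<And>v. norm v \<le> Rv \<Longrightarrow> \<bar>r v \<mu>\<bar> \<le> Br" by (metis real_norm_def)
  have "\<exists>KI\<ge>0. \<forall>x. norm (immersion (S i) (D i \<mu>) (np i) x :: real^'o::{finite,linorder}) \<le> KI * norm x" for i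
    using linear_norm_bound[OF linear_immersion] by metis
  then obtain KI where KI: "\<And>i. KI i \<ge> 0" "\<And>i x. norm (immersion (S i) (D i \<mu>) (np i) x :: real^'o::{finite,linorder}) \<le> KI i * norm x" by metis
  have "\<exists>KG\<ge>0. \<forall>x. norm (col_app (G i) x :: real^'o::{finite,linorder}) \<le> KG * norm x" for i
    using linear_norm_bound[OF linear_col_app] by metis
  then obtain KG where KG: "\<And>i. KG i \<ge> 0" "\<And>i x. norm (col_app (G i) x :: real^'o::{finite,linorder}) \<le> KG i * norm x" by metis
  define Kz where "Kz i = norm (st_z x0 $ i - coord_proj (nz i) (st_z x0 $ i)) + (R + Bz i)" for i
  define K\<eta> where "K\<eta> i = norm (st_\<eta> x0 $ i - coord_proj (np i) (st_\<eta> x0 $ i)) + (R + KI i * Bw i + KG i * R)" for i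
  define B where "B = Rv + ((\<Sum>i\<in>UNIV. Kz i) + ((\<Sum>i\<in>(UNIV :: 'i set). R + Br) + ((\<Sum>i\<in>UNIV. Bw i) + (\<Sum>i\<in>UNIV. K\<eta> i))))"
  have "norm (y t) \<le> B" if T: "0 \<le> T" "T \<le> b" and sol: "filippov_solution XX {0..T} y" and y0: "y 0 = x0" and t: "t \<in> {0..T}" for T y t
  proof -
    have solt: "filippov_solution XX {0..t} y"
      using t by (intro filippov_solution_subset[OF sol _ negligible_interval_boundary(1)]) auto
    have reg: "(st_v (y \<tau>), w \<tau>, \<mu>) \<in> region M Rv" if "\<tau> \<in> {0..t}" for \<tau>
      using trajectory_in_region[OF solt _ _ that] t x0 y0 by auto
    have Uc: "continuous_on {0..t} (\<lambda>\<tau>. U W Q \<mu> (y \<tau>))"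
      by (rule continuous_on_compose2[OF C1_D(4)[OF C1_U[OF design_facts(3,4)]] filippov_solution_continuous_on[OF solt]]) auto
    have "U W Q \<mu> (y t) \<le> max (U W Q \<mu> (y 0)) c"
    proof (rule barrier[OF _ Uc])
      show "0 \<le> t" using t by simp
      fix s1 s2 assume s: "0 \<le> s1" "s1 \<le> s2" "s2 \<le> t" "\<forall>\<tau>\<in>{s1..s2}. c < U W Q \<mu> (y \<tau>)"
      have "U W Q \<mu> (y s2) \<le> U W Q \<mu> (y s1) - 1 * (s2 - s1)"
        using s reg by (intro U_decreases[OF solt] c) auto
      then show "U W Q \<mu> (y s2) \<le> U W Q \<mu> (y s1)" using s by simp
    qed
    then have b: "norm (zbar \<mu> i (y t)) \<le> R" "norm (xt \<mu> i (y t)) \<le> R" "norm (err \<mu> (y t)) \<le> R" for i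
      using R[of "y t"] y0 by auto
    have v: "norm (st_v (y t)) \<le> Rv" using reg[of t] t by (auto simp: region_def)
    have om: "norm (st_\<omega> (y t) $ i) \<le> Bw i" for i by (rule Bw[OF T sol y0 t])
    have e: "\<bar>err \<mu> (y t) $ i\<bar> \<le> R" for i using component_le_norm_cart[of "err \<mu> (y t)" i] b(3) by linarith
    have z: "norm (st_z (y t) $ i) \<le> Kz i" for i
    proof -
      let ?P = "\<lambda>s :: ('v, 'z, 'o, 'i) cl_state. st_z s $ i - coord_proj (nz i) (st_z s $ i)"
      have "?P (y t) = ?P (y 0)"
      proof (rule filippov_solution_constant[OF solt])
        show "linear ?P" by (simp add: linear_iff linear_add[OF linear_coord_proj] linear_scale[OF linear_coord_proj] algebra_simps)
        show "?P (XX t s) = 0" for t s by (simp add: X_components coord_proj_ident[OF follower_dims(2)])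
      qed (use t in simp)
      then have "st_z (y t) $ i = ?P x0 + (zbar \<mu> i (y t) + zs i (st_v (y t)) \<mu>)" by (simp add: zbar_def y0 algebra_simps)
      also have "norm \<dots> \<le> norm (?P x0) + (norm (zbar \<mu> i (y t)) + norm (zs i (st_v (y t)) \<mu>))"
        by (intro norm_triangle_le add_left_mono norm_triangle_ineq)
      also have "\<dots> \<le> Kz i" unfolding Kz_def using b(1)[of i] Bz[OF v, of i] by (intro add_mono) auto
      finally show ?thesis .
    qed
    have \<eta>: "norm (st_\<eta> (y t) $ i) \<le> K\<eta> i" for i
    proof -
      let ?P = "\<lambda>s :: ('v, 'z, 'o, 'i) cl_state. st_\<eta> s $ i - coord_proj (np i) (st_\<eta> s $ i)"
      have F: "dim_row (F_mat (m i) (G i)) = np i" "dim_row (G i) = np i"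
        using internal_model(1)[of i] by (auto simp: F_mat_def Phi_mat_def Psi_mat_def)
      have "?P (y t) = ?P (y 0)"
      proof (rule filippov_solution_constant[OF solt])
        show "linear ?P" by (simp add: linear_iff linear_add[OF linear_coord_proj] linear_scale[OF linear_coord_proj] algebra_simps)
        show "?P (XX t s) = 0" for t s
        proof -
          have "st_\<eta> (XX t s) $ i \<in> coord_space (np i)"
            unfolding X_components by (intro coord_space_add mat_app_in_coord_space col_app_in_coord_space F)
          from coord_proj_ident[OF this] show ?thesis by simp
        qed
      qed (use t in simp)
      then have eq: "st_\<eta> (y t) $ i = ?P x0 + (xt \<mu> i (y t) + immersion (S i) (D i \<mu>) (np i) (st_\<omega> (y t) $ i) + col_app (G i) (err \<mu> (y t) $ i))"
        by (simp add: xt_def y0 algebra_simps)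
      have tri: "norm (a + (b + c + d)) \<le> norm a + (norm b + norm c + norm d)" for a b c d :: "real^'o::{finite,linorder}"
        by (intro norm_triangle_le add_left_mono add_right_mono norm_triangle_ineq)
      have 1: "norm (immersion (S i) (D i \<mu>) (np i) (st_\<omega> (y t) $ i) :: real^'o::{finite,linorder}) \<le> KI i * Bw i"
        using order_trans[OF KI(2) mult_left_mono[OF om KI(1)]] .
      have 2: "norm (col_app (G i) (err \<mu> (y t) $ i) :: real^'o::{finite,linorder}) \<le> KG i * R"
        using order_trans[OF KG(2) mult_left_mono[OF _ KG(1)]] e by simp
      show ?thesis unfolding eq K\<eta>_def by (rule order_trans[OF tri]) (intro add_left_mono add_mono b(2) 1 2)
    qed
    have yb: "norm (st_y (y t) $ i) \<le> R + Br" for i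
    proof -
      have "st_y (y t) $ i = err \<mu> (y t) $ i + r (st_v (y t)) \<mu>" by (simp add: err_def)
      then show ?thesis using e[of i] Br[OF v] by simp
    qed
    have "norm (y t) \<le> norm (st_v (y t)) + (norm (st_z (y t)) + (norm (st_y (y t)) + (norm (st_\<omega> (y t)) + norm (st_\<eta> (y t)))))"
      using norm_Pair_le[of "fst (y t)" "snd (y t)"] norm_Pair_le[of "fst (snd (y t))" "snd (snd (y t))"]
        norm_Pair_le[of "fst (snd (snd (y t)))" "snd (snd (snd (y t)))"]
        norm_Pair_le[of "fst (snd (snd (snd (y t))))" "snd (snd (snd (snd (y t))))"] by simp
    also have "\<dots> \<le> B"
      unfolding B_def using z \<eta> yb om v
      by (intro add_mono order_trans[OF vector_norm_le_sum sum_mono]) auto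
    finally show ?thesis .
  qed
  then show ?thesis by blast
qed

lemma well_defined:
  assumes "st_v x0 \<in> cube M"
  shows "filippov_well_defined XX x0"
proof (rule filippov_well_definedI[OF sf.locally_bounded sf.filippov_uscI apriori_bound[OF assms]])
  show "\<exists>s'\<in>ball s \<delta>. \<forall>i. sgn (L (err \<mu> s') $ i) = \<sigma> i"
    if "0 < \<delta>" "\<And>i. \<sigma> i \<in> {-1, 1}" "\<And>i. L (err \<mu> s) $ i \<noteq> 0 \<Longrightarrow> \<sigma> i = sgn (L (err \<mu> s) $ i)" for s \<delta> \<sigma>
    using sign_pattern_realised[OF that] .
qed

text \<open>Once U is below c, the switching term outweighs the rest by 1 and the error energy falls
  at least at the rate of the 1-norm of the virtual errors. That rate is bounded below only while
  the energy exceeds a given level, so convergence is shown level by level.\<close>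

lemma errors_vanish:
  assumes sol: "filippov_solution XX {0..} x" and x0: "st_v (x 0) \<in> cube M"
    and c: "\<And>t s. (st_v s, w t, \<mu>) \<in> region M Rv \<Longrightarrow> c < U W Q \<mu> s \<Longrightarrow> U' W' Q' \<mu> s (XX t s) \<le> - 1"
    and \<Gamma>: "\<And>t s i. (st_v s, w t, \<mu>) \<in> region M Rv \<Longrightarrow> U W Q \<mu> s \<le> c \<Longrightarrow>
      \<bar>drift i (zbar \<mu> i s) (err \<mu> s $ i) (st_v s, w t, \<mu>) - row_app (Psi_mat (m i)) (xt \<mu> i s + col_app (G i) (err \<mu> s $ i))\<bar> \<le> \<gamma> - 1"
  shows "((\<lambda>t. err \<mu> (x t)) \<longlongrightarrow> 0) at_top"
proof -
  have reg: "(st_v (x t), w t, \<mu>) \<in> region M Rv" if "0 \<le> t" for t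
  proof -
    have "filippov_solution XX {0..t} x"
      by (rule filippov_solution_subset[OF sol _ negligible_interval_boundary(1)]) auto
    then show ?thesis using trajectory_in_region that x0 by simp
  qed
  have xc: "continuous_on {a..b} x" if "0 \<le> a" for a b
    by (rule filippov_solution_continuous_on[OF sol]) (use that in auto)
  have "\<exists>T\<ge>0. \<forall>t\<ge>T. U W Q \<mu> (x t) \<le> c"
  proof (rule barrier_eventually[where k = 1])
    show "continuous_on {a..b} (\<lambda>t. U W Q \<mu> (x t))" if "0 \<le> a" for a b
      by (rule continuous_on_compose2[OF C1_D(4)[OF C1_U[OF design_facts(3,4)]] xc[OF that]]) auto
    fix s t assume "0 \<le> s" "s \<le> t" "\<forall>\<tau>\<in>{s..t}. c < U W Q \<mu> (x \<tau>)"
    then show "U W Q \<mu> (x t) \<le> U W Q \<mu> (x s) - 1 * (t - s)"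
      using reg by (intro U_decreases[OF sol] c) auto
  qed simp
  then obtain T where T: "T \<ge> 0" "\<And>t. t \<ge> T \<Longrightarrow> U W Q \<mu> (x t) \<le> c" by blast
  let ?E = "\<lambda>s. 1 / 2 * (L (err \<mu> s) \<bullet> err \<mu> s)"
  have slope: "L (err \<mu> (x t)) \<bullet> err' \<mu> (x t) (XX t (x t)) \<le> - (\<Sum>i\<in>UNIV. \<bar>L (err \<mu> (x t)) $ i\<bar>)" if t: "t \<ge> T" for t
  proof -
    let ?s = "x t"
    let ?b = "\<lambda>i. drift i (zbar \<mu> i ?s) (err \<mu> ?s $ i) (st_v ?s, w t, \<mu>) - row_app (Psi_mat (m i)) (xt \<mu> i ?s + col_app (G i) (err \<mu> ?s $ i))"
    have "L (err \<mu> ?s) $ i * ?b i \<le> \<bar>L (err \<mu> ?s) $ i\<bar> * (\<gamma> - 1)" for i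
    proof -
      have "L (err \<mu> ?s) $ i * ?b i \<le> \<bar>L (err \<mu> ?s) $ i\<bar> * \<bar>?b i\<bar>" unfolding abs_mult[symmetric] by (rule abs_ge_self)
      also have "\<dots> \<le> \<bar>L (err \<mu> ?s) $ i\<bar> * (\<gamma> - 1)"
        using reg[of t] T t by (intro mult_left_mono \<Gamma>) auto
      finally show ?thesis .
    qed
    then have "(\<Sum>i\<in>UNIV. L (err \<mu> ?s) $ i * ?b i) \<le> (\<Sum>i\<in>UNIV. \<bar>L (err \<mu> ?s) $ i\<bar> * (\<gamma> - 1))" by (rule sum_mono)
    also have "\<dots> = (\<gamma> - 1) * (\<Sum>i\<in>UNIV. \<bar>L (err \<mu> ?s) $ i\<bar>)" by (simp add: sum_distrib_left mult.commute)
    finally have 1: "(\<Sum>i\<in>UNIV. L (err \<mu> ?s) $ i * ?b i) \<le> (\<gamma> - 1) * (\<Sum>i\<in>UNIV. \<bar>L (err \<mu> ?s) $ i\<bar>)" .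
    have "0 \<le> \<rho> u" for u using design_facts(2)[of u] by linarith
    then have "0 \<le> (\<Sum>i\<in>UNIV. \<rho> (L (err \<mu> ?s) $ i) * (L (err \<mu> ?s) $ i)\<^sup>2)" by (intro sum_nonneg mult_nonneg_nonneg) auto
    then show ?thesis unfolding error_energy_dynamics using 1 by (simp add: left_diff_distrib)
  qed
  obtain k where k: "k \<ge> 0" "\<And>e. norm e \<le> k * norm (L e)" using norm_le_laplacian by blast
  obtain cL where cL: "cL > 0" "\<And>e. cL * (norm e)\<^sup>2 \<le> L e \<bullet> e" using laplacian_coercive by blast
  have small: "\<exists>T1. \<forall>t\<ge>T1. ?E (x t) \<le> \<epsilon>" if \<epsilon>: "\<epsilon> > 0" for \<epsilon>
  proof -
    \<comment> \<open>If the energy exceeds \<open>\<epsilon>\<close>, then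
      \<open>\<epsilon> < (k + 1) * (norm (L e))\<^sup>2\<close>, and the 1-norm of
      \<open>L e\<close> is at least \<open>\<kappa>\<close>. The summand 1 covers k = 0.\<close>
    define \<kappa> where "\<kappa> = sqrt (\<epsilon> / (k + 1))"
    have \<kappa>: "\<kappa> > 0" using \<epsilon> k(1) by (simp add: \<kappa>_def)
    have low: "\<kappa> \<le> (\<Sum>i\<in>UNIV. \<bar>L (err \<mu> s) $ i\<bar>)" if E: "\<epsilon> < ?E s" for s
    proof -
      have "L (err \<mu> s) \<bullet> err \<mu> s \<le> norm (L (err \<mu> s)) * (k * norm (L (err \<mu> s)))"
        using norm_cauchy_schwarz[of "L (err \<mu> s)" "err \<mu> s"] mult_left_mono[OF k(2)[of "err \<mu> s"] norm_ge_zero[of "L (err \<mu> s)"]] by linarith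
      also have "\<dots> \<le> (k + 1) * (norm (L (err \<mu> s)))\<^sup>2" by (simp add: power2_eq_square algebra_simps)
      finally have "\<epsilon> < (k + 1) * (norm (L (err \<mu> s)))\<^sup>2" using E \<epsilon> by linarith
      then have "\<epsilon> / (k + 1) \<le> (norm (L (err \<mu> s)))\<^sup>2" using k(1) by (simp add: field_simps)
      then have "\<kappa> \<le> norm (L (err \<mu> s))" unfolding \<kappa>_def by (rule real_le_lsqrt[OF _, rotated]) auto
      then show ?thesis using norm_le_l1_cart[of "L (err \<mu> s)"] by linarith
    qed
    have "\<exists>T1\<ge>T. \<forall>t\<ge>T1. ?E (x t) \<le> \<epsilon>"
    proof (rule barrier_eventually[OF \<kappa>])
      show "continuous_on {a..b} (\<lambda>t. ?E (x t))" if "T \<le> a" for a b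
        by (rule continuous_on_compose2[OF C1_D(4)[OF C1_error_energy] xc]) (use that T in auto)
      fix s t assume st: "T \<le> s" "s \<le> t" and big: "\<forall>\<tau>\<in>{s..t}. \<epsilon> < ?E (x \<tau>)"
      have "?E (x t) - ?E (x s) \<le> (- \<kappa>) * (t - s)"
      proof (rule sf.filippov_sign_increment_le[OF sol st(2) _ _ C1_error_energy])
        fix \<tau> assume \<tau>: "\<tau> \<in> {s..t}"
        show "L (err \<mu> (x \<tau>)) \<bullet> err' \<mu> (x \<tau>) (XX \<tau> (x \<tau>)) \<le> - \<kappa>"
          using slope[of \<tau>] low[of "x \<tau>"] big \<tau> st by force
      qed (use T st error_energy_jump in auto)
      then show "?E (x t) \<le> ?E (x s) - \<kappa> * (t - s)" by simp
    qed
    then show ?thesis by blast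
  qed
  show ?thesis
    unfolding tendsto_iff
  proof (intro allI impI)
    fix d :: real assume d: "d > 0"
    \<comment> \<open>Energy at most \<open>\<epsilon>\<close> means
      \<open>L e \<bullet> e \<le> cL * d\<^sup>2 / 2\<close>, so coercivity gives
      \<open>(norm e)\<^sup>2 \<le> d\<^sup>2 / 2\<close>, strictly below
      \<open>d\<^sup>2\<close>.\<close>
    define \<epsilon> where "\<epsilon> = cL * d\<^sup>2 / 4"
    have "\<epsilon> > 0" using d cL(1) by (simp add: \<epsilon>_def)
    then obtain T1 where T1: "\<And>t. t \<ge> T1 \<Longrightarrow> ?E (x t) \<le> \<epsilon>" using small by blast
    have "dist (err \<mu> (x t)) 0 < d" if "t \<ge> T1" for t
    proof -
      have "cL * (norm (err \<mu> (x t)))\<^sup>2 \<le> cL * (d\<^sup>2 / 2)" using T1[OF that] cL(2)[of "err \<mu> (x t)"] by (simp add: \<epsilon>_def)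
      then have "(norm (err \<mu> (x t)))\<^sup>2 \<le> d\<^sup>2 / 2" using cL(1) by simp
      also have "\<dots> < d\<^sup>2" using d by simp
      finally show ?thesis using d power_less_imp_less_base[of "norm (err \<mu> (x t))" 2 d] by simp
    qed
    then show "\<forall>\<^sub>F t in at_top. dist (err \<mu> (x t)) 0 < d" by (auto simp: eventually_at_top_linorder)
  qed
qed

end

text \<open>On the sublevel set all error coordinates are bounded, and so is every term of the error
  equation except the feedback. The bound involves no switching gain, so choosing the gain from it
  is not circular.\<close>

lemma switching_gain:
  "\<exists>\<Gamma>\<ge>0. \<forall>\<mu> u s i. (st_v s, u, \<mu>) \<in> region M Rv \<longrightarrow> U W Q \<mu> s \<le> c \<longrightarrow>
      \<bar>drift i (zbar \<mu> i s) (err \<mu> s $ i) (st_v s, u, \<mu>) - row_app (Psi_mat (m i)) (xt \<mu> i s + col_app (G i) (err \<mu> s $ i))\<bar> \<le> \<Gamma>"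
proof -
  obtain R where R: "\<And>\<mu> s. U W Q \<mu> s \<le> c \<Longrightarrow> (\<forall>i. norm (zbar \<mu> i s) \<le> R \<and> norm (xt \<mu> i s) \<le> R) \<and> norm (err \<mu> s) \<le> R"
    using U_coercive[of c] by blast
  obtain H where H: "\<And>i P z e. P \<in> region M Rv \<Longrightarrow> norm z \<le> R \<Longrightarrow> \<bar>e\<bar> \<le> R \<Longrightarrow> (drift i z e P)\<^sup>2 \<le> H i"
    using drift_bounded[OF compact_region] by metis
  have "\<exists>KG\<ge>0. \<forall>x. norm (col_app (G i) x :: real^'o::{finite,linorder}) \<le> KG * norm x" for i
    using linear_norm_bound[OF linear_col_app] by metis
  then obtain KG where KG: "\<And>i. KG i \<ge> 0" "\<And>i x. norm (col_app (G i) x :: real^'o::{finite,linorder}) \<le> KG i * norm x" by metis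
  have "\<exists>K\<ge>0. \<forall>x. norm (row_app (Psi_mat (m i)) (x :: real^'o::{finite,linorder})) \<le> K * norm x" for i
    using linear_norm_bound[OF linear_row_app] by metis
  then obtain K where K: "\<And>i. K i \<ge> 0" "\<And>i x. norm (row_app (Psi_mat (m i)) (x :: real^'o::{finite,linorder})) \<le> K i * norm x" by metis
  define b where "b i = \<bar>H i\<bar> + 1 + K i * (\<bar>R\<bar> + KG i * \<bar>R\<bar>)" for i
  have b: "b i \<ge> 0" for i using K(1) KG(1) by (simp add: b_def add_nonneg_nonneg mult_nonneg_nonneg)
  have "\<bar>drift i (zbar \<mu> i s) (err \<mu> s $ i) (st_v s, u, \<mu>) - row_app (Psi_mat (m i)) (xt \<mu> i s + col_app (G i) (err \<mu> s $ i))\<bar> \<le> (\<Sum>i\<in>UNIV. b i)"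
    if reg: "(st_v s, u, \<mu>) \<in> region M Rv" and Uc: "U W Q \<mu> s \<le> c" for \<mu> u s i
  proof -
    have e: "\<bar>err \<mu> s $ i\<bar> \<le> R" using component_le_norm_cart[of "err \<mu> s" i] R[OF Uc] by linarith
    have "\<bar>drift i (zbar \<mu> i s) (err \<mu> s $ i) (st_v s, u, \<mu>)\<bar>\<^sup>2 \<le> H i" using H[OF reg _ e] R[OF Uc] by simp
    from le_of_square_le[OF this] have 1: "\<bar>drift i (zbar \<mu> i s) (err \<mu> s $ i) (st_v s, u, \<mu>)\<bar> \<le> \<bar>H i\<bar> + 1" .
    have "norm (col_app (G i) (err \<mu> s $ i) :: real^'o::{finite,linorder}) \<le> KG i * \<bar>R\<bar>"
      using order_trans[OF KG(2) mult_left_mono[OF _ KG(1)]] e by simp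
    then have "norm (xt \<mu> i s + col_app (G i) (err \<mu> s $ i)) \<le> \<bar>R\<bar> + KG i * \<bar>R\<bar>"
      using R[OF Uc] by (intro norm_triangle_le add_mono) (auto intro: order_trans[OF _ abs_ge_self])
    then have 2: "\<bar>row_app (Psi_mat (m i)) (xt \<mu> i s + col_app (G i) (err \<mu> s $ i))\<bar> \<le> K i * (\<bar>R\<bar> + KG i * \<bar>R\<bar>)"
      using order_trans[OF K(2) mult_left_mono[OF _ K(1)]] by simp
    have "b i \<le> (\<Sum>i\<in>UNIV. b i)" using b by (intro member_le_sum) auto
    then show ?thesis using 1 2 unfolding b_def by linarith
  qed
  moreover have "0 \<le> (\<Sum>i\<in>UNIV. b i)" using b by (rule sum_nonneg)
  ultimately show ?thesis by (intro exI[of _ "\<Sum>i\<in>UNIV. b i"] conjI allI impI)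
qed

end

text \<open>M matters only for \<open>\<mu>\<close> and the leader's initial state, through the
  compact region. The other initial values affect the time until U is below its ultimate level, but
  no parameter of the controller.\<close>

lemma output_regulation:
  "\<exists>\<rho> \<gamma>. smooth_on UNIV \<rho> \<and> (\<forall>s. 0 < \<rho> s) \<and> 0 < \<gamma> \<and>
    (\<forall>\<mu>\<in>cube M. \<forall>w. admissible_input l w \<longrightarrow> (\<forall>x0. st_v x0 \<in> cube M \<longrightarrow>
      filippov_well_defined (X \<rho> \<gamma> \<mu> w) x0 \<and>
      (\<forall>x. filippov_solution (X \<rho> \<gamma> \<mu> w) {0..} x \<and> x 0 = x0 \<longrightarrow> ((\<lambda>t. err \<mu> (x t)) \<longlongrightarrow> 0) at_top)))"
proof -
  obtain Rv where Rv: "leader_bound M Rv"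
    using leader_bounded[of M] unfolding leader_bound_def by metis
  obtain \<rho> c0 W W' Q Q' where d: "lyapunov_design M Rv \<rho> c0 W W' Q Q'" using lyapunov_design_exists by blast
  obtain c where c: "\<And>\<gamma> \<mu> w t s. 0 \<le> \<gamma> \<Longrightarrow> (st_v s, w t, \<mu>) \<in> region M Rv \<Longrightarrow> c < U W Q \<mu> s \<Longrightarrow> U' W' Q' \<mu> s (X \<rho> \<gamma> \<mu> w t s) \<le> - 1"
    using ultimate_level[OF d Rv] by blast
  obtain \<Gamma> where \<Gamma>: "\<Gamma> \<ge> 0" "\<forall>\<mu> u s i. (st_v s, u, \<mu>) \<in> region M Rv \<longrightarrow> U W Q \<mu> s \<le> c \<longrightarrow>
      \<bar>drift i (zbar \<mu> i s) (err \<mu> s $ i) (st_v s, u, \<mu>) - row_app (Psi_mat (m i)) (xt \<mu> i s + col_app (G i) (err \<mu> s $ i))\<bar> \<le> \<Gamma>"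
    using switching_gain[OF d Rv, of c] by (elim exE conjE)
  have \<gamma>: "0 \<le> \<Gamma> + 1" using \<Gamma>(1) by simp
  have \<rho>: "smooth_on UNIV \<rho>" "\<And>s. 0 < \<rho> s"
    using d unfolding lyapunov_design_def by (auto intro: less_le_trans[of 0 1])
  show ?thesis
  proof (intro exI[of _ \<rho>] exI[of _ "\<Gamma> + 1"] conjI ballI allI impI)
    fix \<mu> :: "real^'m" and w :: "real \<Rightarrow> real^'w" and x0 :: "('v, 'z, 'o, 'i) cl_state"
    assume \<mu>: "\<mu> \<in> cube M" and w: "admissible_input l w" and x0: "st_v x0 \<in> cube M"
    show "filippov_well_defined (X \<rho> (\<Gamma> + 1) \<mu> w) x0" by (rule well_defined[OF d Rv \<gamma> \<mu> w x0])
    fix x assume x: "filippov_solution (X \<rho> (\<Gamma> + 1) \<mu> w) {0..} x \<and> x 0 = x0"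
    show "((\<lambda>t. err \<mu> (x t)) \<longlongrightarrow> 0) at_top"
    proof (rule errors_vanish[OF d Rv \<gamma> \<mu> w, where c = c])
      show "filippov_solution (X \<rho> (\<Gamma> + 1) \<mu> w) {0..} x" "st_v (x 0) \<in> cube M" using x x0 by simp_all
      fix t and s :: "('v, 'z, 'o, 'i) cl_state" and i
      assume s: "(st_v s, w t, \<mu>) \<in> region M Rv"
      show "U' W' Q' \<mu> s (X \<rho> (\<Gamma> + 1) \<mu> w t s) \<le> - 1" if "c < U W Q \<mu> s"
        using c[where \<gamma> = "\<Gamma> + 1" and \<mu> = \<mu> and w = w and t = t and s = s] \<gamma> s that by blast
      assume "U W Q \<mu> s \<le> c"
      then show "\<bar>drift i (zbar \<mu> i s) (err \<mu> s $ i) (st_v s, w t, \<mu>) - row_app (Psi_mat (m i)) (xt \<mu> i s + col_app (G i) (err \<mu> s $ i))\<bar> \<le> \<Gamma> + 1 - 1"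
        using \<Gamma>(2)[THEN spec[of _ \<mu>], THEN spec[of _ "w t"], THEN spec[of _ s], THEN spec[of _ i]] s by linarith
    qed
  qed (use \<rho> \<Gamma>(1) in auto)
qed

end

theorem theorem2:
  fixes p :: "real^'v \<Rightarrow> real^'v"
    and q :: "real^'v \<Rightarrow> real^'w^'v"
    and r :: "real^'v \<Rightarrow> real^'m \<Rightarrow> real"
    and l :: real
    and nz nom :: "'i::finite \<Rightarrow> nat"
    and f :: "'i \<Rightarrow> real^'z::{finite,linorder} \<Rightarrow> real \<Rightarrow> real^'m \<Rightarrow> real^'z::{finite,linorder}"
    and g :: "'i \<Rightarrow> real^'z::{finite,linorder} \<Rightarrow> real \<Rightarrow> real^'m \<Rightarrow> real"
    and S :: "'i \<Rightarrow> real mat"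
    and D :: "'i \<Rightarrow> real^'m \<Rightarrow> real mat"
    and E :: "('i option \<times> 'i option) set"
    and A :: "'i option \<Rightarrow> 'i option \<Rightarrow> real"
    and zs :: "'i \<Rightarrow> real^'v \<Rightarrow> real^'m \<Rightarrow> real^'z::{finite,linorder}"
    and m :: "'i \<Rightarrow> real poly"
    and G :: "'i \<Rightarrow> real mat"
  assumes dims: "\<And>i. nz i \<le> CARD('z)" "\<And>i. nom i \<le> CARD('o::{finite,linorder})"
    and l_pos: "0 < l"
    and leader_smooth: "smooth_on UNIV p" "smooth_on UNIV q" "smooth_on UNIV (\<lambda>(v, \<mu>). r v \<mu>)"
    and leader_zero: "p 0 = 0" "\<And>\<mu>. r 0 \<mu> = 0"
    and follower_dims:
      "\<And>i y \<mu>. depends_on (nz i) (\<lambda>z. f i z y \<mu>)" "\<And>i z y \<mu>. f i z y \<mu> \<in> coord_space (nz i)"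
      "\<And>i y \<mu>. depends_on (nz i) (\<lambda>z. g i z y \<mu>)"
    and follower_smooth:
      "\<And>i. smooth_on UNIV (\<lambda>(z, y, \<mu>). f i z y \<mu>)" "\<And>i. smooth_on UNIV (\<lambda>(z, y, \<mu>). g i z y \<mu>)"
    and follower_zero: "\<And>i \<mu>. f i 0 0 \<mu> = 0" "\<And>i \<mu>. g i 0 0 \<mu> = 0"
    and disturbance: "\<And>i. S i \<in> carrier_mat (nom i) (nom i)"
      "\<And>i \<mu>. D i \<mu> \<in> carrier_mat 1 (nom i)"
      "\<And>i c. is_eigenvalue (S i) c \<Longrightarrow> \<not> Re c < 0"
    and graph: "weighted_digraph E A"
    and assm1: "graph_connectivity E A"
    and assm2: "leader_stability p q l"
    and assm3: "\<And>i. regulator_solution p r (nz i) (f i) (zs i)"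
    and assm5: "\<And>i. error_dynamics_iss q r (nz i) (f i) (zs i)"
    and minimal_poly: "\<And>i. is_minimal_poly (S i) (m i)"
    and internal_model: "\<And>i. G i \<in> carrier_mat (degree (m i)) 1"
      "\<And>i. hurwitz (F_mat (m i) (G i))"
  shows "\<forall>M>0. \<exists>\<rho> \<gamma> Mbar.
    (\<forall>i. smooth_on UNIV (\<rho> i) \<and> (\<forall>s. 0 < \<rho> i s)) \<and> (\<forall>i. 0 < \<gamma> i) \<and> 0 \<le> Mbar \<and>
    (\<forall>\<mu>\<in>cube M. \<forall>w. admissible_input l w \<longrightarrow>
      (\<forall>x0 :: ('v, 'z, 'o, 'i) cl_state.
        x0 \<in> initial_states nz nom (\<lambda>i. degree (m i)) M Mbar \<longrightarrow>
        filippov_well_defined (closed_loop p q r f g S D A m G \<rho> \<gamma> \<mu> w) x0 \<and>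
        (\<forall>x. filippov_solution (closed_loop p q r f g S D A m G \<rho> \<gamma> \<mu> w) {0..} x \<and> x 0 = x0 \<longrightarrow>
          (\<forall>i. ((\<lambda>t. tracking_error r \<mu> i (x t)) \<longlongrightarrow> 0) at_top))))"
proof -
  interpret leader_follower E A p q r l nz nom f g S D zs m G "TYPE('o)"
    using assms by unfold_locales auto
  show ?thesis
  proof (intro allI impI)
    fix M :: real assume "0 < M"
    obtain \<rho> \<gamma> where \<rho>: "smooth_on UNIV \<rho>" "\<And>s. 0 < \<rho> s" "0 < \<gamma>"
      and reg: "\<And>\<mu> w x0. \<mu> \<in> cube M \<Longrightarrow> admissible_input l w \<Longrightarrow> st_v x0 \<in> cube M \<Longrightarrow>
        filippov_well_defined (X \<rho> \<gamma> \<mu> w) x0 \<and>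
        (\<forall>x. filippov_solution (X \<rho> \<gamma> \<mu> w) {0..} x \<and> x 0 = x0 \<longrightarrow> ((\<lambda>t. err \<mu> (x t)) \<longlongrightarrow> 0) at_top)"
      using output_regulation[of M] by blast
    have track: "tracking_error r \<mu> i s = err \<mu> s $ i" for \<mu> i and s :: "('v, 'z, 'o, 'i) cl_state"
      by (simp add: tracking_error_def err_def case_prod_beta)
    show "\<exists>\<rho> \<gamma> Mbar. (\<forall>i. smooth_on UNIV (\<rho> i) \<and> (\<forall>s. 0 < \<rho> i s)) \<and> (\<forall>i. 0 < \<gamma> i) \<and> 0 \<le> Mbar \<and>
      (\<forall>\<mu>\<in>cube M. \<forall>w. admissible_input l w \<longrightarrow>
        (\<forall>x0 :: ('v, 'z, 'o, 'i) cl_state.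
          x0 \<in> initial_states nz nom (\<lambda>i. degree (m i)) M Mbar \<longrightarrow>
          filippov_well_defined (closed_loop p q r f g S D A m G \<rho> \<gamma> \<mu> w) x0 \<and>
          (\<forall>x. filippov_solution (closed_loop p q r f g S D A m G \<rho> \<gamma> \<mu> w) {0..} x \<and> x 0 = x0 \<longrightarrow>
            (\<forall>i. ((\<lambda>t. tracking_error r \<mu> i (x t)) \<longlongrightarrow> 0) at_top))))"
    \<comment> \<open>All followers share one gain function and one switching gain. As
      \<open>output_regulation\<close> restricts only the leader's initial state, any bound on
      \<open>eta(0)\<close> would do, and 0 is taken.\<close>
    proof (intro exI[of _ "\<lambda>_. \<rho>"] exI[of _ "\<lambda>_. \<gamma>"] exI[of _ "0 :: real"] conjI ballI allI impI)
      fix \<mu> :: "real^'m" and w :: "real \<Rightarrow> real^'w" and x0 :: "('v, 'z, 'o, 'i) cl_state"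
      assume \<mu>: "\<mu> \<in> cube M" and w: "admissible_input l w"
        and "x0 \<in> initial_states nz nom (\<lambda>i. degree (m i)) M 0"
      then have x0: "st_v x0 \<in> cube M" by (auto simp: initial_states_def)
      show "filippov_well_defined (closed_loop p q r f g S D A m G (\<lambda>_. \<rho>) (\<lambda>_. \<gamma>) \<mu> w) x0"
        using reg[OF \<mu> w x0] by (simp add: X_def)
      fix x i assume "filippov_solution (closed_loop p q r f g S D A m G (\<lambda>_. \<rho>) (\<lambda>_. \<gamma>) \<mu> w) {0..} x \<and> x 0 = x0"
      then have "((\<lambda>t. err \<mu> (x t)) \<longlongrightarrow> 0) at_top" using reg[OF \<mu> w x0] by (simp add: X_def)
      from tendsto_vec_nth[OF this, of i] show "((\<lambda>t. tracking_error r \<mu> i (x t)) \<longlongrightarrow> 0) at_top"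
        by (simp add: track)
    qed (use \<rho> in auto)
  qed
qed

end
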